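(* The decision problem DiNDP (Directed Network Design Problem) is $\mathbf{NP}$-complete.
   Context: Let $G=(V,E)$ be a finite directed graph with weight and distance functions $w,d:E\to\mathbb{Z}_{\ge 0}$. A directed path from $u$ to $v$ is a sequence of nodes $u=v_1,\dots,v_k=v$ with $(v_i,v_{i+1})\in E$ for all $i=1,\dots,k-1$; its length is $\sum_{i=1}^{k-1} d(v_i,v_{i+1})$. The distance $\mathrm{dist}(u,v)$ is the length of a shortest directed path from $u$ to $v$ with respect to $d$, with $\mathrm{dist}(u,v)=\infty$ if no such path exists. For $E'\subseteq E$, write $G'=(V,E')$, let $\mathrm{dist}|_{G'}$ be the distance computed in $G'$, let $w(E')=\sum_{e\in E'}w(e)$, and let the total routing costs be $R(G')=\sum_{u,v\in V}\mathrm{dist}|_{G'}(u,v)$. DiNDP. Instance: a directed graph $G=(V,E,w,d)$ with $w,d:E\to\mathbb{Z}_{\ge 0}$ and $\beta,\gamma\in\mathbb{Z}_{\ge 0}$. Question: does there exist a subset $E'\subseteq E$ with $w(E')\le\beta$ and $R((V,E'))\le\gamma$? *)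

theory Defs
  imports
    "HOL-Library.Extended_Nat"
    "HOL-Computational_Algebra.Polynomial"
begin

text \<open>Symbols and states are natural numbers; each machine uses finite sets of them.\<close>

type_synonym symbol = nat

definition blank :: symbol where "blank = 0"

fun bit_sym :: "bool \<Rightarrow> symbol" where
  "bit_sym False = 1"
| "bit_sym True = 2"

definition sep_sym :: symbol where "sep_sym = 3"

datatype move = MoveLeft | Stay | MoveRight

fun offset :: "move \<Rightarrow> int" where
  "offset MoveLeft = - 1"
| "offset Stay = 0"
| "offset MoveRight = 1"

text \<open>The transition function maps a state and the list of scanned symbols (one per tape) to the
  next state and, for each tape, the symbol to write and the subsequent head movement.\<close>

record tm =
  tapes :: nat
  states :: "nat set"
  alphabet :: "symbol set"
  start :: nat
  accept :: nat
  reject :: nat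
  delta :: "nat \<Rightarrow> symbol list \<Rightarrow> nat \<times> (symbol \<times> move) list"

definition turing_machine :: "tm \<Rightarrow> bool" where
  "turing_machine M \<longleftrightarrow>
     0 < tapes M \<and>
     finite (states M) \<and> {start M, accept M, reject M} \<subseteq> states M \<and> accept M \<noteq> reject M \<and>
     finite (alphabet M) \<and> {blank, bit_sym False, bit_sym True, sep_sym} \<subseteq> alphabet M \<and>
     (\<forall>q \<in> states M - {accept M, reject M}. \<forall>ss. length ss = tapes M \<and> set ss \<subseteq> alphabet M \<longrightarrow>
        (case delta M q ss of (q', as) \<Rightarrow>
           q' \<in> states M \<and> length as = tapes M \<and> fst ` set as \<subseteq> alphabet M))"

text \<open>Tapes are infinite in both directions: cell contents together with the head position.\<close>

type_synonym tape = "(int \<Rightarrow> symbol) \<times> int"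
type_synonym config = "nat \<times> tape list"

fun scan :: "tape \<Rightarrow> symbol" where
  "scan (c, h) = c h"

fun act :: "symbol \<times> move \<Rightarrow> tape \<Rightarrow> tape" where
  "act (s, m) (c, h) = (c(h := s), h + offset m)"

definition halted :: "tm \<Rightarrow> config \<Rightarrow> bool" where
  "halted M cf \<longleftrightarrow> fst cf \<in> {accept M, reject M}"

definition step :: "tm \<Rightarrow> config \<Rightarrow> config" where
  "step M cf =
     (if halted M cf then cf
      else case delta M (fst cf) (map scan (snd cf)) of (q', as) \<Rightarrow> (q', map2 act as (snd cf)))"

definition word_tape :: "symbol list \<Rightarrow> tape" where
  "word_tape ws = ((\<lambda>i. if 0 \<le> i \<and> i < int (length ws) then ws ! nat i else blank), 0)"

definition initial :: "tm \<Rightarrow> symbol list \<Rightarrow> config" where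
  "initial M ws = (start M, word_tape ws # replicate (tapes M - 1) (word_tape []))"

definition run :: "tm \<Rightarrow> symbol list \<Rightarrow> nat \<Rightarrow> config" where
  "run M ws t = (step M ^^ t) (initial M ws)"

definition accepts :: "tm \<Rightarrow> symbol list \<Rightarrow> bool" where
  "accepts M ws \<longleftrightarrow> (\<exists>t. fst (run M ws t) = accept M)"

text \<open>The output of a halted machine is read off the last tape, from cell 0 up to the first
  blank.\<close>

definition holds_word :: "tape \<Rightarrow> symbol list \<Rightarrow> bool" where
  "holds_word tp ws \<longleftrightarrow>
     (\<forall>i < length ws. fst tp (int i) = ws ! i) \<and> fst tp (int (length ws)) = blank"

type_synonym language = "bool list set"

definition poly_time_computable :: "(bool list \<Rightarrow> bool list) \<Rightarrow> bool" where
  "poly_time_computable f \<longleftrightarrow>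
     (\<exists>M (T :: nat poly). turing_machine M \<and>
        (\<forall>x. let cf = run M (map bit_sym x) (poly T (length x)) in
             halted M cf \<and> holds_word (last (snd cf)) (map bit_sym (f x))))"

text \<open>The verifier receives the instance and the certificate, separated by a delimiter, on its
  input tape.\<close>

definition pair_word :: "bool list \<Rightarrow> bool list \<Rightarrow> symbol list" where
  "pair_word x u = map bit_sym x @ sep_sym # map bit_sym u"

definition NP :: "language set" where
  "NP = {L. \<exists>M (T :: nat poly) (p :: nat poly). turing_machine M \<and>
            (\<forall>x u. halted M (run M (pair_word x u) (poly T (length x + length u)))) \<and>
            (\<forall>x. x \<in> L \<longleftrightarrow>
                 (\<exists>u. length u \<le> poly p (length x) \<and> accepts M (pair_word x u)))}"

definition poly_reducible :: "language \<Rightarrow> language \<Rightarrow> bool" (infix "\<le>\<^sub>p" 50) where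
  "L' \<le>\<^sub>p L \<longleftrightarrow> (\<exists>f. poly_time_computable f \<and> (\<forall>x. x \<in> L' \<longleftrightarrow> f x \<in> L))"

definition NP_hard :: "language \<Rightarrow> bool" where
  "NP_hard L \<longleftrightarrow> (\<forall>L' \<in> NP. L' \<le>\<^sub>p L)"

definition NP_complete :: "language \<Rightarrow> bool" where
  "NP_complete L \<longleftrightarrow> L \<in> NP \<and> NP_hard L"

definition dipath :: "'v set \<Rightarrow> ('v \<times> 'v) set \<Rightarrow> 'v \<Rightarrow> 'v \<Rightarrow> 'v list \<Rightarrow> bool" where
  "dipath V E u v p \<longleftrightarrow>
     p \<noteq> [] \<and> hd p = u \<and> last p = v \<and> set p \<subseteq> V \<and> successively (\<lambda>x y. (x, y) \<in> E) p"

definition path_length :: "('v \<times> 'v \<Rightarrow> nat) \<Rightarrow> 'v list \<Rightarrow> nat" where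
  "path_length d p = (\<Sum>e\<leftarrow>zip p (tl p). d e)"

text \<open>The infimum over the empty set is \<open>\<infinity>\<close>.\<close>

definition graph_dist :: "'v set \<Rightarrow> ('v \<times> 'v) set \<Rightarrow> ('v \<times> 'v \<Rightarrow> nat) \<Rightarrow> 'v \<Rightarrow> 'v \<Rightarrow> enat" where
  "graph_dist V E d u v = (INF p \<in> {p. dipath V E u v p}. enat (path_length d p))"

definition routing_cost :: "'v set \<Rightarrow> ('v \<times> 'v) set \<Rightarrow> ('v \<times> 'v \<Rightarrow> nat) \<Rightarrow> enat" where
  "routing_cost V E d = (\<Sum>u\<in>V. \<Sum>v\<in>V. graph_dist V E d u v)"

definition DiNDP_yes ::
  "'v set \<Rightarrow> ('v \<times> 'v) set \<Rightarrow> ('v \<times> 'v \<Rightarrow> nat) \<Rightarrow> ('v \<times> 'v \<Rightarrow> nat) \<Rightarrow> nat \<Rightarrow> nat \<Rightarrow> bool" where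
  "DiNDP_yes V E w d \<beta> \<gamma> \<longleftrightarrow>
     (\<exists>E' \<subseteq> E. (\<Sum>e\<in>E'. w e) \<le> \<beta> \<and> routing_cost V E' d \<le> enat \<gamma>)"

text \<open>Instances are encoded over the vertex set \<open>{0, ..., n - 1}\<close>. Numbers are in binary, least
  significant bit first, made self-delimiting by putting \<open>True\<close> before every bit and \<open>False\<close> at
  the end. The graph is given by \<open>n\<close> in unary followed by its adjacency matrix in row-major
  order, whose entry for an edge carries the weight and the distance of that edge.\<close>

fun binary :: "nat \<Rightarrow> bool list" where
  "binary m = (if m = 0 then [] else odd m # binary (m div 2))"

declare binary.simps [simp del]

definition encode_nat :: "nat \<Rightarrow> bool list" where
  "encode_nat m = concat (map (\<lambda>b. [True, b]) (binary m)) @ [False]"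

definition encode_entry ::
  "(nat \<times> nat) set \<Rightarrow> (nat \<times> nat \<Rightarrow> nat) \<Rightarrow> (nat \<times> nat \<Rightarrow> nat) \<Rightarrow> nat \<times> nat \<Rightarrow> bool list" where
  "encode_entry E w d e =
     (if e \<in> E then True # encode_nat (w e) @ encode_nat (d e) else [False])"

definition encode_instance ::
  "nat \<Rightarrow> (nat \<times> nat) set \<Rightarrow> (nat \<times> nat \<Rightarrow> nat) \<Rightarrow> (nat \<times> nat \<Rightarrow> nat) \<Rightarrow> nat \<Rightarrow> nat \<Rightarrow> bool list"
  where
  "encode_instance n E w d \<beta> \<gamma> =
     replicate n True @ [False] @
     concat (map (encode_entry E w d) (List.product [0..<n] [0..<n])) @
     encode_nat \<beta> @ encode_nat \<gamma>"

definition DiNDP :: language where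
  "DiNDP = {encode_instance n E w d \<beta> \<gamma> | n E w d \<beta> \<gamma>.
              E \<subseteq> {0..<n} \<times> {0..<n} \<and> DiNDP_yes {0..<n} E w d \<beta> \<gamma>}"

end

theory Submission
  imports Defs "HOL-Library.Countable"
begin

text \<open>Both halves of the proof need concrete Turing machines. Call a function of a word tame if it is the
  value of a term built from constants, the letters and the length of the word, addition, truncated subtraction, shifts and
  bounded sums. Terms compile to programs over unary counters, whose registers are head
  positions on otherwise blank tapes, so tame predicates are decidable and words with tame letters and tame length are
  computable in polynomial time.

  For membership in NP, the certificate lists the instance once more as tables of fixed layout, together with
  the selected edges and a walk for every pair of vertices. It is then a tame predicate that the tables encode to the
  given instance and that the walks and edges respect the budgets.

  For hardness, an accepting run is a choice of one value per cell of a tableau, subject to local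
  clauses. Choices are hitting sets with as many items as cells, and these are the cheap
  edge sets of a graph in which all distances are 0 or 1.\<close>

section \<open>Counter programs and their compilation from terms\<close>

text \<open>Counters are unary whereas weights, distances and budgets are binary, so no program can
  ever hold such a number. This shapes the language of terms: every value stays polynomial in the
  word length, which is why division by a power of two is primitive and exponentiation is absent.
  Large numbers occur only through their digits, and a sum of them is compared with a budget column
  by column, small guessed surpluses taking the place of carries. It also explains why the
  certificate repeats the instance: instead of parsing the self-delimiting input, the check
  re-encodes the tables and compares words, so only an encoder has to be tame.

  In the hardness part a single routing budget must force both halves of the hitting set condition.
  A hub makes it possible to keep all distances finite, so the cost counts the pairs at distance 1;
  each unselected item and each missed target adds one. Since the weight budget leaves at least I -
  m items unselected, these exhaust the allowance and no target can be missed.\<close>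

datatype cond = Nonzero nat | Nonblank

datatype cmd =
    Skip
  | Inc nat
  | Dec nat
  | HeadL
  | HeadR
  | Probe symbol nat
  | Emit nat
  | Seq cmd cmd (infixr ";;" 60)
  | While cond cmd

instance cond :: countable by countable_datatype
instance cmd :: countable by countable_datatype

datatype effect = Nop | Up nat | Down nat | GoL | GoR | Put bool

type_synonym store = "(nat \<Rightarrow> nat) \<times> int \<times> bool list"

text \<open>A step sees the store only through truth values of conditions and the scanned symbol,
  and answers with an effect on at most one component. A finite control has exactly this
  information, so the same function later drives the transition table of the machine.\<close>

fun small :: "(cond \<Rightarrow> bool) \<Rightarrow> symbol \<Rightarrow> cmd \<Rightarrow> cmd \<times> effect" where
  "small b y Skip = (Skip, Nop)"
| "small b y (Inc r) = (Skip, Up r)"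
| "small b y (Dec r) = (Skip, if b (Nonzero r) then Down r else Nop)"
| "small b y HeadL = (Skip, GoL)"
| "small b y HeadR = (Skip, GoR)"
| "small b y (Probe s r) = (Skip, if y = s then Up r else Nop)"
| "small b y (Emit r) = (Skip, Put (b (Nonzero r)))"
| "small b y (c1 ;; c2) =
     (if c1 = Skip then (c2, Nop) else (fst (small b y c1) ;; c2, snd (small b y c1)))"
| "small b y (While k c) = (if b k then (c ;; While k c, Nop) else (Skip, Nop))"

fun effect_on :: "effect \<Rightarrow> store \<Rightarrow> store" where
  "effect_on Nop s = s"
| "effect_on (Up r) (f, h, zs) = (f(r := Suc (f r)), h, zs)"
| "effect_on (Down r) (f, h, zs) = (f(r := f r - 1), h, zs)"
| "effect_on GoL (f, h, zs) = (f, h - 1, zs)"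
| "effect_on GoR (f, h, zs) = (f, h + 1, zs)"
| "effect_on (Put b) (f, h, zs) = (f, h, zs @ [b])"

definition cell :: "symbol list \<Rightarrow> int \<Rightarrow> symbol" where
  "cell w = fst (word_tape w)"

fun test :: "symbol list \<Rightarrow> store \<Rightarrow> cond \<Rightarrow> bool" where
  "test w (f, h, zs) (Nonzero r) = (f r \<noteq> 0)"
| "test w (f, h, zs) Nonblank = (cell w h \<noteq> blank)"

definition cstep :: "symbol list \<Rightarrow> cmd \<times> store \<Rightarrow> cmd \<times> store" where
  "cstep w = (\<lambda>(c, s). case small (test w s) (cell w (fst (snd s))) c of (c', a) \<Rightarrow> (c', effect_on a s))"

section \<open>Running times of counter programs\<close>

definition exec :: "symbol list \<Rightarrow> cmd \<Rightarrow> store \<Rightarrow> nat \<Rightarrow> store \<Rightarrow> bool" where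
  "exec w c s n s' \<longleftrightarrow> (\<exists>k\<le>n. (cstep w ^^ k) (c, s) = (Skip, s'))"

lemma exec_mono: "exec w c s n s' \<Longrightarrow> n \<le> m \<Longrightarrow> exec w c s m s'"
  unfolding exec_def by (meson le_trans)

lemma exec_weaken: "exec w c s n s1 \<Longrightarrow> n \<le> m \<Longrightarrow> s1 = s' \<Longrightarrow> exec w c s m s'"
  by (simp add: exec_mono)

lemma exec_Skip: "exec w Skip s 0 s"
  by (auto simp: exec_def)

lemma exec_prim:
  "small (test w s) (cell w (fst (snd s))) c = (Skip, a) \<Longrightarrow> exec w c s 1 (effect_on a s)"
  unfolding exec_def by (rule exI[of _ 1]) (simp add: cstep_def)

lemma exec_Inc: "exec w (Inc r) (f, h, zs) 1 (f(r := Suc (f r)), h, zs)"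
  by (rule exec_prim[THEN back_subst[of "exec w (Inc r) (f, h, zs) 1"]]) auto

lemma exec_Dec: "exec w (Dec r) (f, h, zs) 1 (f(r := f r - 1), h, zs)"
  by (rule exec_prim[THEN back_subst[of "exec w (Dec r) (f, h, zs) 1"]]) (auto simp: fun_eq_iff)

lemma exec_HeadL: "exec w HeadL (f, h, zs) 1 (f, h - 1, zs)"
  by (rule exec_prim[THEN back_subst[of "exec w HeadL (f, h, zs) 1"]]) auto

lemma exec_HeadR: "exec w HeadR (f, h, zs) 1 (f, h + 1, zs)"
  by (rule exec_prim[THEN back_subst[of "exec w HeadR (f, h, zs) 1"]]) auto

lemma exec_Probe:
  "exec w (Probe y r) (f, h, zs) 1 (f(r := f r + of_bool (cell w h = y)), h, zs)"
  by (rule exec_prim[THEN back_subst[of "exec w (Probe y r) (f, h, zs) 1"]]) auto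

lemma exec_Emit: "exec w (Emit r) (f, h, zs) 1 (f, h, zs @ [f r \<noteq> 0])"
  by (rule exec_prim[THEN back_subst[of "exec w (Emit r) (f, h, zs) 1"]]) auto

text \<open>Discarding a finished left part costs a step of its own, hence \<open>Suc k\<close>. The
  index \<open>j\<close> is only bounded because \<open>Skip\<close> idles under
  \<open>cstep\<close>, so \<open>k\<close> may exceed the true running time of
  \<open>c1\<close>.\<close>

lemma cstep_Seq_reaches:
  "(cstep w ^^ k) (c1, s) = (Skip, s') \<Longrightarrow> \<exists>j\<le>Suc k. (cstep w ^^ j) (c1 ;; c2, s) = (c2, s')"
proof (induction k arbitrary: c1 s)
  case 0
  then show ?case by (intro exI[of _ 1]) (simp add: cstep_def)
next
  case (Suc k)
  show ?case
  proof (cases "c1 = Skip")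
    case True
    have "(cstep w ^^ n) (Skip, s) = (Skip, s)" for n
      by (induction n) (simp_all add: cstep_def)
    with True Suc.prems have "s = s'" by (metis prod.inject)
    with True show ?thesis
      by (intro exI[of _ 1]) (simp add: cstep_def)
  next
    case False
    obtain d a where da: "small (test w s) (cell w (fst (snd s))) c1 = (d, a)"
      by fastforce
    have "(cstep w ^^ k) (d, effect_on a s) = (Skip, s')"
      using Suc.prems da by (simp add: funpow_swap1 cstep_def)
    from Suc.IH[OF this] obtain j where
      "j \<le> Suc k" "(cstep w ^^ j) (d ;; c2, effect_on a s) = (c2, s')" by blast
    then show ?thesis
      using da False by (intro exI[of _ "Suc j"]) (simp add: funpow_swap1 cstep_def)
  qed
qed

lemma exec_Seq:
  assumes "exec w c1 s n1 s1" "exec w c2 s1 n2 s2"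
  shows "exec w (c1 ;; c2) s (n1 + n2 + 1) s2"
proof -
  obtain k1 k2 where k: "k1 \<le> n1" "(cstep w ^^ k1) (c1, s) = (Skip, s1)"
    "k2 \<le> n2" "(cstep w ^^ k2) (c2, s1) = (Skip, s2)"
    using assms unfolding exec_def by blast
  from cstep_Seq_reaches[OF k(2)] obtain j where
    j: "j \<le> Suc k1" "(cstep w ^^ j) (c1 ;; c2, s) = (c2, s1)" by blast
  have "(cstep w ^^ (k2 + j)) (c1 ;; c2, s) = (Skip, s2)"
    using j k by (simp add: funpow_add)
  then show ?thesis unfolding exec_def using j k by (intro exI[of _ "k2 + j"]) auto
qed

lemma exec_While_end: "\<not> test w s k \<Longrightarrow> exec w (While k c) s 1 s"
  unfolding exec_def by (rule exI[of _ 1]) (simp add: cstep_def)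

lemma exec_While_step:
  assumes "test w s k" "exec w c s n s1" "exec w (While k c) s1 m s2"
  shows "exec w (While k c) s (n + m + 2) s2"
proof -
  from exec_Seq[OF assms(2,3)] obtain j where
    j: "j \<le> n + m + 1" "(cstep w ^^ j) (c ;; While k c, s) = (Skip, s2)"
    unfolding exec_def by blast
  have "(cstep w ^^ Suc j) (While k c, s) = (Skip, s2)"
    using j assms(1) by (simp add: funpow_swap1 cstep_def)
  then show ?thesis unfolding exec_def using j by (intro exI[of _ "Suc j"]) auto
qed

text \<open>The invariant is an explicit sequence \<open>S\<close> of stores, so each later loop is
  verified by naming its store after \<open>i\<close> rounds. The induction counts the rounds that
  remain, because a \<open>While\<close> unfolds from the front.\<close>

lemma exec_loop:
  assumes "\<And>i. i < N \<Longrightarrow> test w (S i) k"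
    and "\<And>i. i < N \<Longrightarrow> exec w c (S i) m (S (Suc i))"
    and "\<not> test w (S N) k"
  shows "exec w (While k c) (S 0) (N * (m + 2) + 1) (S N)"
proof -
  have "j \<le> N \<Longrightarrow> exec w (While k c) (S (N - j)) (j * (m + 2) + 1) (S N)" for j
  proof (induction j)
    case 0
    then show ?case using exec_While_end[OF assms(3)] by simp
  next
    case (Suc j)
    have *: "Suc (N - Suc j) = N - j" using Suc.prems by simp
    have "exec w (While k c) (S (N - j)) (j * (m + 2) + 1) (S N)"
      using Suc by simp
    moreover have "exec w c (S (N - Suc j)) m (S (N - j))"
      using Suc.prems assms(2)[of "N - Suc j"] by (simp add: *)
    ultimately have "exec w (While k c) (S (N - Suc j)) (m + (j * (m + 2) + 1) + 2) (S N)"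
      using Suc.prems by (intro exec_While_step[OF assms(1)]) auto
    then show ?case by (simp add: algebra_simps)
  qed
  from this[of N] show ?thesis by simp
qed


section \<open>Arithmetic on unary registers\<close>

definition move :: "nat \<Rightarrow> nat \<Rightarrow> cmd" where
  "move a b = While (Nonzero a) (Dec a ;; Inc b)"

lemma exec_move:
  assumes "a \<noteq> b"
  shows "exec w (move a b) (f, h, zs) (5 * f a + 1) (f(a := 0, b := f b + f a), h, zs)"
proof -
  define S where "S i = (f(a := f a - i, b := f b + i), h, zs)" for i
  have "exec w (While (Nonzero a) (Dec a ;; Inc b)) (S 0) (f a * (3 + 2) + 1) (S (f a))"
  proof (rule exec_loop)
    fix i assume "i < f a"
    then show "test w (S i) (Nonzero a)" using assms by (simp add: S_def)
    show "exec w (Dec a ;; Inc b) (S i) 3 (S (Suc i))"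
      using assms exec_Seq[OF exec_Dec[of w a "f(a := f a - i, b := f b + i)" h zs] exec_Inc[of w b]]
      by (simp add: S_def fun_upd_twist numeral_3_eq_3)
  qed (use assms in \<open>simp add: S_def\<close>)
  then show ?thesis by (simp add: S_def move_def mult.commute)
qed

definition take_off :: "nat \<Rightarrow> nat \<Rightarrow> cmd" where
  "take_off a b = While (Nonzero a) (Dec a ;; Dec b)"

lemma exec_take_off:
  assumes "a \<noteq> b"
  shows "exec w (take_off a b) (f, h, zs) (5 * f a + 1) (f(a := 0, b := f b - f a), h, zs)"
proof -
  define S where "S i = (f(a := f a - i, b := f b - i), h, zs)" for i
  have "exec w (While (Nonzero a) (Dec a ;; Dec b)) (S 0) (f a * (3 + 2) + 1) (S (f a))"
  proof (rule exec_loop)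
    fix i assume "i < f a"
    then show "test w (S i) (Nonzero a)" using assms by (simp add: S_def)
    show "exec w (Dec a ;; Dec b) (S i) 3 (S (Suc i))"
      using assms exec_Seq[OF exec_Dec[of w a "f(a := f a - i, b := f b - i)" h zs] exec_Dec[of w b]]
      by (simp add: S_def fun_upd_twist numeral_3_eq_3)
  qed (use assms in \<open>simp add: S_def\<close>)
  then show ?thesis by (simp add: S_def take_off_def mult.commute)
qed

definition clear :: "nat \<Rightarrow> cmd" where
  "clear a = While (Nonzero a) (Dec a)"

lemma exec_clear: "exec w (clear a) (f, h, zs) (3 * f a + 1) (f(a := 0), h, zs)"
proof -
  define S where "S i = (f(a := f a - i), h, zs)" for i
  have "exec w (While (Nonzero a) (Dec a)) (S 0) (f a * (1 + 2) + 1) (S (f a))"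
  proof (rule exec_loop)
    fix i assume "i < f a"
    then show "test w (S i) (Nonzero a)" by (simp add: S_def)
    show "exec w (Dec a) (S i) 1 (S (Suc i))"
      using exec_Dec[of w a "f(a := f a - i)" h zs] by (simp add: S_def)
  qed (simp add: S_def)
  then show ?thesis by (simp add: S_def clear_def eval_nat_numeral)
qed

text \<open>Reading a unary register destroys it, so the value is duplicated into the target and an
  auxiliary register, from which it is moved back.\<close>

definition copy :: "nat \<Rightarrow> nat \<Rightarrow> nat \<Rightarrow> cmd" where
  "copy a b t = While (Nonzero a) (Dec a ;; Inc b ;; Inc t) ;; move t a"

lemma exec_copy:
  assumes "a \<noteq> b" "a \<noteq> t" "b \<noteq> t" "f b = 0" "f t = 0"
  shows "exec w (copy a b t) (f, h, zs) (12 * f a + 3) (f(b := f a), h, zs)"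
proof -
  define S where "S i = (f(a := f a - i, b := i, t := i), h, zs)" for i
  have "exec w (While (Nonzero a) (Dec a ;; Inc b ;; Inc t)) (S 0) (f a * (5 + 2) + 1) (S (f a))"
  proof (rule exec_loop)
    fix i assume "i < f a"
    then show "test w (S i) (Nonzero a)" using assms by (simp add: S_def)
    show "exec w (Dec a ;; Inc b ;; Inc t) (S i) 5 (S (Suc i))"
      using assms exec_Seq[OF exec_Dec[of w a "f(a := f a - i, b := i, t := i)" h zs]
          exec_Seq[OF exec_Inc[of w b] exec_Inc[of w t]]]
      by (simp add: S_def fun_upd_twist eval_nat_numeral)
  qed (use assms in \<open>simp add: S_def\<close>)
  moreover have "S 0 = (f, h, zs)" using assms by (auto simp: S_def fun_eq_iff)
  moreover have "exec w (move t a) (S (f a)) (5 * f a + 1) (f(b := f a), h, zs)"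
    using exec_move[of t a w "f(a := f a - f a, b := f a, t := f a)" h zs] assms
    by (auto simp: S_def fun_eq_iff fun_upd_def elim!: back_subst[of "exec _ _ _ _"])
  ultimately have "exec w (copy a b t) (f, h, zs) (f a * (5 + 2) + 1 + (5 * f a + 1) + 1)
      (f(b := f a), h, zs)"
    unfolding copy_def by (intro exec_Seq) auto
  then show ?thesis by (simp add: algebra_simps eval_nat_numeral)
qed

text \<open>The loop removes two units per round and so rounds up. The initial decrement corrects
  this: for positive \<open>a\<close>, half of \<open>a - 1\<close> rounded up is
  \<open>a div 2\<close>.\<close>

definition halve :: "nat \<Rightarrow> nat \<Rightarrow> cmd" where
  "halve a t = Dec a ;; While (Nonzero a) (Dec a ;; Dec a ;; Inc t) ;; move t a"

lemma exec_halve: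
  assumes "a \<noteq> t" "f t = 0"
  shows "exec w (halve a t) (f, h, zs) (12 * f a + 5) (f(a := f a div 2), h, zs)"
proof -
  define S where "S i = (f(a := f a - 1 - 2 * i, t := i), h, zs)" for i
  define N where "N = f a div 2"
  have "exec w (While (Nonzero a) (Dec a ;; Dec a ;; Inc t)) (S 0) (N * (5 + 2) + 1) (S N)"
  proof (rule exec_loop)
    fix i assume i: "i < N"
    then show "test w (S i) (Nonzero a)" using assms by (simp add: S_def N_def)
    show "exec w (Dec a ;; Dec a ;; Inc t) (S i) 5 (S (Suc i))"
      using assms exec_Seq[OF exec_Dec[of w a "f(a := f a - 1 - 2 * i, t := i)" h zs]
          exec_Seq[OF exec_Dec[of w a] exec_Inc[of w t]]]
      by (simp add: S_def fun_upd_twist eval_nat_numeral)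
  qed (use assms in \<open>simp add: S_def N_def\<close>)
  moreover have "S 0 = (f(a := f a - 1), h, zs)" using assms by (auto simp: S_def fun_eq_iff)
  moreover have "S N = (f(a := 0, t := N), h, zs)" using assms by (auto simp: S_def N_def fun_eq_iff)
  moreover have "exec w (move t a) (f(a := 0, t := N), h, zs) (5 * N + 1) (f(a := N), h, zs)"
    using exec_move[of t a w "f(a := 0, t := N)" h zs] assms
    by (auto simp: fun_eq_iff fun_upd_def elim!: back_subst[of "exec _ _ _ _"])
  ultimately have "exec w (halve a t) (f, h, zs) (1 + (N * (5 + 2) + 1 + (5 * N + 1) + 1) + 1)
      (f(a := N), h, zs)"
    unfolding halve_def by (intro exec_Seq[OF exec_Dec] exec_Seq) auto
  then show ?thesis by (rule exec_weaken) (auto simp: N_def)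
qed

section \<open>Terms over a word and their compilation\<close>

datatype trm =
    Cst nat
  | Var nat
  | Len
  | Sym symbol trm
  | Add trm trm
  | Sub trm trm
  | Shr trm trm
  | Sum trm trm

text \<open>\<open>Shr\<close> gives access to binary digits without a power of two ever being a
  value, which keeps all values polynomial. The variable bound by \<open>Sum\<close> is de Bruijn
  index 0.\<close>

fun ev :: "symbol list \<Rightarrow> (nat \<Rightarrow> nat) \<Rightarrow> trm \<Rightarrow> nat" where
  "ev w e (Cst c) = c"
| "ev w e (Var i) = e i"
| "ev w e Len = length w"
| "ev w e (Sym y a) = of_bool (cell w (int (ev w e a)) = y)"
| "ev w e (Add a b) = ev w e a + ev w e b"
| "ev w e (Sub a b) = ev w e a - ev w e b"
| "ev w e (Shr a b) = ev w e a div 2 ^ ev w e b"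
| "ev w e (Sum a b) = (\<Sum>i<ev w e a. ev w (case_nat i e) b)"

text \<open>The argument of the polynomial bounds both the word length and every variable. Under a
  \<open>Sum\<close> the new variable stays below the value of \<open>a\<close>, so the bound of the
  body is composed with the old argument increased by \<open>value_bound a\<close>.\<close>

fun value_bound :: "trm \<Rightarrow> nat poly" where
  "value_bound (Cst c) = [:c:]"
| "value_bound (Var i) = [:0, 1:]"
| "value_bound Len = [:0, 1:]"
| "value_bound (Sym y a) = [:1:]"
| "value_bound (Add a b) = value_bound a + value_bound b"
| "value_bound (Sub a b) = value_bound a"
| "value_bound (Shr a b) = value_bound a"
| "value_bound (Sum a b) = value_bound a * pcompose (value_bound b) ([:0, 1:] + value_bound a)"

lemma poly_nat_mono: "x \<le> y \<Longrightarrow> poly p x \<le> poly (p :: nat poly) y"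
  by (induction p) (auto intro!: add_mono mult_mono)

lemma ev_le_value_bound:
  assumes "length w \<le> N" "\<And>i. e i \<le> N"
  shows "ev w e t \<le> poly (value_bound t) N"
  using assms
proof (induction t arbitrary: e N)
  case (Sum a b)
  let ?A = "poly (value_bound a) N"
  have A: "ev w e a \<le> ?A" using Sum by blast
  have "ev w (case_nat i e) b \<le> poly (value_bound b) (N + ?A)" if "i < ev w e a" for i
    using that A Sum.prems
    by (intro Sum.IH(2)) (auto split: nat.split simp: trans_le_add1)
  then have "ev w e (Sum a b) \<le> ev w e a * poly (value_bound b) (N + ?A)"
    using sum_bounded_above[of "{..<ev w e a}" "\<lambda>i. ev w (case_nat i e) b"] by auto
  also have "\<dots> \<le> ?A * poly (value_bound b) (N + ?A)" using A by (rule mult_right_mono) simp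
  finally show ?case by (simp add: poly_pcompose)
next
  case (Sub a b)
  then show ?case by simp (meson diff_le_self le_trans)
next
  case (Shr a b)
  then show ?case by simp (meson div_le_dividend le_trans)
qed (auto intro: add_mono)

fun incs :: "nat \<Rightarrow> nat \<Rightarrow> cmd" where
  "incs 0 k = Skip"
| "incs (Suc n) k = Inc k ;; incs n k"

lemma exec_incs: "exec w (incs n k) (f, h, zs) (2 * n) (f(k := f k + n), h, zs)"
proof (induction n arbitrary: f)
  case 0
  then show ?case using exec_Skip by simp
next
  case (Suc n)
  from exec_Seq[OF exec_Inc[of w k f h zs] Suc[of "f(k := Suc (f k))"]] show ?case
    by (simp add: fun_upd_def cong: if_cong)
qed

text \<open>Stack discipline: \<open>\<rho>\<close> places the variables in registers below
  \<open>k\<close>, register 0 holds the word length, all registers from \<open>k\<close> on are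
  zero, and afterwards \<open>k\<close> holds the result and those above it are zero again. For
  \<open>Sum\<close>, register \<open>k\<close> accumulates, \<open>k + 1\<close> counts down,
  \<open>k + 2\<close> is the bound variable and \<open>k + 3\<close> receives the summand. For
  \<open>Sym\<close>, register \<open>k + 2\<close> remembers how far the head must travel back to
  cell 0.\<close>

fun compile :: "(nat \<Rightarrow> nat) \<Rightarrow> nat \<Rightarrow> trm \<Rightarrow> cmd" where
  "compile \<rho> k (Cst c) = incs c k"
| "compile \<rho> k (Var i) = copy (\<rho> i) k (k + 1)"
| "compile \<rho> k Len = copy 0 k (k + 1)"
| "compile \<rho> k (Sym y a) =
     compile \<rho> (k + 1) a ;;
     While (Nonzero (k + 1)) (Dec (k + 1) ;; Inc (k + 2) ;; HeadR) ;;
     Probe y k ;;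
     While (Nonzero (k + 2)) (Dec (k + 2) ;; HeadL)"
| "compile \<rho> k (Add a b) = compile \<rho> k a ;; compile \<rho> (k + 1) b ;; move (k + 1) k"
| "compile \<rho> k (Sub a b) = compile \<rho> k a ;; compile \<rho> (k + 1) b ;; take_off (k + 1) k"
| "compile \<rho> k (Shr a b) =
     compile \<rho> k a ;; compile \<rho> (k + 1) b ;;
     While (Nonzero (k + 1)) (Dec (k + 1) ;; halve k (k + 2))"
| "compile \<rho> k (Sum a b) =
     compile \<rho> (k + 1) a ;;
     While (Nonzero (k + 1))
       (Dec (k + 1) ;; compile (case_nat (k + 2) \<rho>) (k + 3) b ;; move (k + 3) k ;; Inc (k + 2)) ;;
     clear (k + 2)"

fun time_bound :: "trm \<Rightarrow> nat poly" where
  "time_bound (Cst c) = [:2 * c:]"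
| "time_bound (Var i) = [:3, 12:]"
| "time_bound Len = [:3, 12:]"
| "time_bound (Sym y a) = time_bound a + [:12:] * value_bound a + [:6:]"
| "time_bound (Add a b) = time_bound a + time_bound b + [:5:] * value_bound b + [:3:]"
| "time_bound (Sub a b) = time_bound a + time_bound b + [:5:] * value_bound b + [:3:]"
| "time_bound (Shr a b) = time_bound a + time_bound b
     + value_bound b * ([:12:] * value_bound a + [:9:]) + [:3:]"
| "time_bound (Sum a b) = time_bound a
     + value_bound a * (pcompose (time_bound b + [:5:] * value_bound b) ([:0, 1:] + value_bound a)
         + [:16:]) + [:4:]"


text \<open>The bound \<open>N\<close> is generalised in the induction because the body of a
  \<open>Sum\<close> runs in an environment whose new variable may exceed the old bound.\<close>

lemma exec_compile:
  assumes "0 < k" "\<And>i. \<rho> i < k" "\<And>r. k \<le> r \<Longrightarrow> f r = 0" "f 0 = length w"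
    and "length w \<le> N" "\<And>i. f (\<rho> i) \<le> N"
  shows "exec w (compile \<rho> k t) (f, 0, zs) (poly (time_bound t) N)
           (f(k := ev w (\<lambda>i. f (\<rho> i)) t), 0, zs)"
  using assms
proof (induction t arbitrary: \<rho> k f N)
  case (Cst c)
  then show ?case using exec_incs[of w c k f 0 zs] by (simp add: fun_upd_def)
next
  case (Var i)
  have "exec w (compile \<rho> k (Var i)) (f, 0, zs) (12 * f (\<rho> i) + 3) (f(k := f (\<rho> i)), 0, zs)"
    unfolding compile.simps using Var.prems(2)[of i] Var.prems(3)
    by (intro exec_copy) auto
  then show ?case by (rule exec_weaken) (use Var.prems(6)[of i] in auto)
next
  case Len
  have "exec w (compile \<rho> k Len) (f, 0, zs) (12 * f 0 + 3) (f(k := f 0), 0, zs)"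
    unfolding compile.simps using Len.prems by (intro exec_copy) auto
  then show ?case by (rule exec_weaken) (use Len.prems in auto)
next
  case (Sym y a)
  define A where "A = ev w (\<lambda>i. f (\<rho> i)) a"
  have A: "A \<le> poly (value_bound a) N" unfolding A_def using Sym.prems by (intro ev_le_value_bound)
  have 1: "exec w (compile \<rho> (k + 1) a) (f, 0, zs) (poly (time_bound a) N) (f(k + 1 := A), 0, zs)"
    unfolding A_def using Sym.prems by (intro Sym.IH) (auto simp: less_Suc_eq)
  define S where "S i = (f(k + 1 := A - i, k + 2 := i), int i, zs)" for i
  have "exec w (While (Nonzero (k + 1)) (Dec (k + 1) ;; Inc (k + 2) ;; HeadR)) (S 0) (A * (5 + 2) + 1) (S A)"
  proof (rule exec_loop)
    fix i assume "i < A"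
    then show "test w (S i) (Nonzero (k + 1))" by (simp add: S_def)
    show "exec w (Dec (k + 1) ;; Inc (k + 2) ;; HeadR) (S i) 5 (S (Suc i))"
      using exec_Seq[OF exec_Dec[of w "k + 1" "f(k + 1 := A - i, k + 2 := i)" "int i" zs]
          exec_Seq[OF exec_Inc[of w "k + 2"] exec_HeadR[of w]]]
      by (simp add: S_def fun_upd_twist eval_nat_numeral add.commute)
  qed (simp add: S_def)
  moreover have "S 0 = (f(k + 1 := A), 0, zs)" using Sym.prems by (auto simp: S_def fun_eq_iff)
  moreover have "S A = (f(k + 2 := A), int A, zs)" using Sym.prems by (auto simp: S_def fun_eq_iff)
  ultimately have 2: "exec w (While (Nonzero (k + 1)) (Dec (k + 1) ;; Inc (k + 2) ;; HeadR))
      (f(k + 1 := A), 0, zs) (7 * A + 1) (f(k + 2 := A), int A, zs)" by (simp add: mult.commute)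
  define v :: nat where "v = of_bool (cell w (int A) = y)"
  have 3: "exec w (Probe y k) (f(k + 2 := A), int A, zs) 1 (f(k + 2 := A, k := v), int A, zs)"
    using exec_Probe[of w y k "f(k + 2 := A)" "int A" zs] Sym.prems by (simp add: v_def)
  define S where "S i = (f(k + 2 := A - i, k := v), int (A - i), zs)" for i
  have "exec w (While (Nonzero (k + 2)) (Dec (k + 2) ;; HeadL)) (S 0) (A * (3 + 2) + 1) (S A)"
  proof (rule exec_loop)
    fix i assume i: "i < A"
    then show "test w (S i) (Nonzero (k + 2))" by (simp add: S_def)
    show "exec w (Dec (k + 2) ;; HeadL) (S i) 3 (S (Suc i))"
      using exec_Seq[OF exec_Dec[of w "k + 2" "f(k + 2 := A - i, k := v)" "int (A - i)" zs]
          exec_HeadL[of w]] i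
      by (simp add: S_def fun_upd_twist eval_nat_numeral of_nat_diff algebra_simps)
  qed (simp add: S_def)
  moreover have "S 0 = (f(k + 2 := A, k := v), int A, zs)" by (simp add: S_def)
  moreover have "S A = (f(k := v), 0, zs)" using Sym.prems by (auto simp: S_def fun_eq_iff)
  ultimately have 4: "exec w (While (Nonzero (k + 2)) (Dec (k + 2) ;; HeadL))
      (f(k + 2 := A, k := v), int A, zs) (5 * A + 1) (f(k := v), 0, zs)" by (simp add: mult.commute)
  have "exec w (compile \<rho> k (Sym y a)) (f, 0, zs)
      (poly (time_bound a) N + (7 * A + 1 + (1 + (5 * A + 1) + 1) + 1) + 1) (f(k := v), 0, zs)"
    unfolding compile.simps by (intro exec_Seq[OF 1] exec_Seq[OF 2] exec_Seq[OF 3 4])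
  then show ?case by (rule exec_weaken) (use A in \<open>auto simp: A_def v_def\<close>)
next
  case (Add a b)
  define A where "A = ev w (\<lambda>i. f (\<rho> i)) a"
  define B where "B = ev w (\<lambda>i. f (\<rho> i)) b"
  have B: "B \<le> poly (value_bound b) N" unfolding B_def using Add.prems by (intro ev_le_value_bound)
  have \<rho>: "\<rho> i \<noteq> k" for i using Add.prems(2)[of i] by simp
  have 1: "exec w (compile \<rho> k a) (f, 0, zs) (poly (time_bound a) N) (f(k := A), 0, zs)"
    unfolding A_def using Add.prems by (intro Add.IH)
  have 2: "exec w (compile \<rho> (k + 1) b) (f(k := A), 0, zs) (poly (time_bound b) N)
      (f(k := A, k + 1 := B), 0, zs)"
    using Add.IH(2)[of "k + 1" \<rho> "f(k := A)" N] Add.prems by (simp add: \<rho> B_def less_Suc_eq fun_upd_def)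
  have 3: "exec w (move (k + 1) k) (f(k := A, k + 1 := B), 0, zs) (5 * B + 1) (f(k := A + B), 0, zs)"
    using exec_move[of "k + 1" k w "f(k := A, k + 1 := B)" 0 zs] Add.prems
    by (auto simp: fun_eq_iff elim!: back_subst[of "exec _ _ _ _"])
  have "exec w (compile \<rho> k (Add a b)) (f, 0, zs)
      (poly (time_bound a) N + (poly (time_bound b) N + (5 * B + 1) + 1) + 1) (f(k := A + B), 0, zs)"
    unfolding compile.simps by (intro exec_Seq[OF 1] exec_Seq[OF 2 3])
  then show ?case by (rule exec_weaken) (use B in \<open>auto simp: A_def B_def\<close>)
next
  case (Sub a b)
  define A where "A = ev w (\<lambda>i. f (\<rho> i)) a"
  define B where "B = ev w (\<lambda>i. f (\<rho> i)) b"
  have B: "B \<le> poly (value_bound b) N" unfolding B_def using Sub.prems by (intro ev_le_value_bound)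
  have \<rho>: "\<rho> i \<noteq> k" for i using Sub.prems(2)[of i] by simp
  have 1: "exec w (compile \<rho> k a) (f, 0, zs) (poly (time_bound a) N) (f(k := A), 0, zs)"
    unfolding A_def using Sub.prems by (intro Sub.IH)
  have 2: "exec w (compile \<rho> (k + 1) b) (f(k := A), 0, zs) (poly (time_bound b) N)
      (f(k := A, k + 1 := B), 0, zs)"
    using Sub.IH(2)[of "k + 1" \<rho> "f(k := A)" N] Sub.prems by (simp add: \<rho> B_def less_Suc_eq fun_upd_def)
  have 3: "exec w (take_off (k + 1) k) (f(k := A, k + 1 := B), 0, zs) (5 * B + 1) (f(k := A - B), 0, zs)"
    using exec_take_off[of "k + 1" k w "f(k := A, k + 1 := B)" 0 zs] Sub.prems
    by (auto simp: fun_eq_iff elim!: back_subst[of "exec _ _ _ _"])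
  have "exec w (compile \<rho> k (Sub a b)) (f, 0, zs)
      (poly (time_bound a) N + (poly (time_bound b) N + (5 * B + 1) + 1) + 1) (f(k := A - B), 0, zs)"
    unfolding compile.simps by (intro exec_Seq[OF 1] exec_Seq[OF 2 3])
  then show ?case by (rule exec_weaken) (use B in \<open>auto simp: A_def B_def\<close>)
next
  case (Shr a b)
  define A where "A = ev w (\<lambda>i. f (\<rho> i)) a"
  define B where "B = ev w (\<lambda>i. f (\<rho> i)) b"
  have A: "A \<le> poly (value_bound a) N" unfolding A_def using Shr.prems by (intro ev_le_value_bound)
  have B: "B \<le> poly (value_bound b) N" unfolding B_def using Shr.prems by (intro ev_le_value_bound)
  have \<rho>: "\<rho> i \<noteq> k" for i using Shr.prems(2)[of i] by simp
  have 1: "exec w (compile \<rho> k a) (f, 0, zs) (poly (time_bound a) N) (f(k := A), 0, zs)"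
    unfolding A_def using Shr.prems by (intro Shr.IH)
  have 2: "exec w (compile \<rho> (k + 1) b) (f(k := A), 0, zs) (poly (time_bound b) N)
      (f(k := A, k + 1 := B), 0, zs)"
    using Shr.IH(2)[of "k + 1" \<rho> "f(k := A)" N] Shr.prems by (simp add: \<rho> B_def less_Suc_eq fun_upd_def)
  define S where "S i = (f(k := A div 2 ^ i, k + 1 := B - i), 0 :: int, zs)" for i
  have "exec w (While (Nonzero (k + 1)) (Dec (k + 1) ;; halve k (k + 2))) (S 0)
     (B * ((1 + (12 * A + 5) + 1) + 2) + 1) (S B)"
  proof (rule exec_loop)
    fix i assume "i < B"
    then show "test w (S i) (Nonzero (k + 1))" by (simp add: S_def)
    have "exec w (halve k (k + 2)) (f(k := A div 2 ^ i, k + 1 := B - i - 1), 0, zs) (12 * (A div 2 ^ i) + 5)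
        (f(k := A div 2 ^ i div 2, k + 1 := B - i - 1), 0, zs)"
      using exec_halve[of k "k + 2" "f(k := A div 2 ^ i, k + 1 := B - i - 1)" w 0 zs] Shr.prems
      by (simp add: fun_upd_twist)
    then have "exec w (halve k (k + 2)) (f(k := A div 2 ^ i, k + 1 := B - i - 1), 0, zs) (12 * A + 5)
        (f(k := A div 2 ^ Suc i, k + 1 := B - Suc i), 0, zs)"
      by (rule exec_weaken) (simp_all add: div_mult2_eq[symmetric] mult.commute)
    moreover have "exec w (Dec (k + 1)) (S i) 1 (f(k := A div 2 ^ i, k + 1 := B - i - 1), 0, zs)"
      using exec_Dec[of w "k + 1" "f(k := A div 2 ^ i, k + 1 := B - i)" 0 zs] by (simp add: S_def)
    ultimately show "exec w (Dec (k + 1) ;; halve k (k + 2)) (S i) (1 + (12 * A + 5) + 1) (S (Suc i))"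
      unfolding S_def[of "Suc i"] by (intro exec_Seq)
  qed (simp add: S_def)
  moreover have "S 0 = (f(k := A, k + 1 := B), 0, zs)" by (simp add: S_def)
  moreover have "S B = (f(k := A div 2 ^ B), 0, zs)" using Shr.prems by (auto simp: S_def fun_eq_iff)
  ultimately have 3: "exec w (While (Nonzero (k + 1)) (Dec (k + 1) ;; halve k (k + 2)))
     (f(k := A, k + 1 := B), 0, zs) (B * (12 * A + 9) + 1) (f(k := A div 2 ^ B), 0, zs)"
    by (simp add: algebra_simps)
  have "exec w (compile \<rho> k (Shr a b)) (f, 0, zs)
      (poly (time_bound a) N + (poly (time_bound b) N + (B * (12 * A + 9) + 1) + 1) + 1)
      (f(k := A div 2 ^ B), 0, zs)"
    unfolding compile.simps by (intro exec_Seq[OF 1] exec_Seq[OF 2 3])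
  moreover have "B * (12 * A + 9) \<le> poly (value_bound b) N * (12 * poly (value_bound a) N + 9)"
    using A B by (intro mult_le_mono) auto
  ultimately show ?case
    by (elim exec_weaken) (auto simp: A_def B_def mult.commute)
next
  case (Sum a b)
  define A where "A = ev w (\<lambda>i. f (\<rho> i)) a"
  define B where "B i = ev w (case_nat i (\<lambda>i. f (\<rho> i))) b" for i
  define N' where "N' = N + poly (value_bound a) N"
  define T where "T = poly (time_bound b) N' + 5 * poly (value_bound b) N' + 7"
  have A: "A \<le> poly (value_bound a) N" unfolding A_def using Sum.prems by (intro ev_le_value_bound)
  have N': "length w \<le> N'" "case_nat i (\<lambda>i. f (\<rho> i)) j \<le> N'" if "i < A" for i j
    using Sum.prems(5,6) that A by (auto simp: N'_def trans_le_add1 split: nat.split)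
  have B: "B i \<le> poly (value_bound b) N'" if "i < A" for i
    unfolding B_def using N'[OF that] by (intro ev_le_value_bound)
  have \<rho>: "\<rho> i \<noteq> k" "\<rho> i \<noteq> k + 1" "\<rho> i \<noteq> k + 2" "\<rho> i < k + 3" for i
    using Sum.prems(2)[of i] by simp_all
  have 1: "exec w (compile \<rho> (k + 1) a) (f, 0, zs) (poly (time_bound a) N) (f(k + 1 := A), 0, zs)"
    unfolding A_def using Sum.prems by (intro Sum.IH(1)) (auto simp: less_Suc_eq)
  define g where "g i = f(k := \<Sum>j<i. B j, k + 1 := A - i, k + 2 := i)" for i
  define S where "S i = (g i, 0 :: int, zs)" for i
  let ?body = "Dec (k + 1) ;; compile (case_nat (k + 2) \<rho>) (k + 3) b ;; move (k + 3) k ;; Inc (k + 2)"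
  have "exec w (While (Nonzero (k + 1)) ?body) (S 0) (A * (T + 4 + 2) + 1) (S A)"
  proof (rule exec_loop)
    fix i assume i: "i < A"
    then show "test w (S i) (Nonzero (k + 1))" by (simp add: S_def g_def)
    let ?g = "(g i)(k + 1 := A - Suc i)"
    \<comment> \<open>Through the extended register assignment the body sees the counter in
      \<open>k + 2\<close> as variable 0 and the old variables shifted by one.\<close>
    have env: "(\<lambda>j. ?g (case_nat (k + 2) \<rho> j)) = case_nat i (\<lambda>j. f (\<rho> j))"
      using \<rho> by (auto simp: fun_eq_iff g_def split: nat.split)
    have s1: "exec w (Dec (k + 1)) (g i, 0, zs) 1 (?g, 0, zs)"
      using exec_Dec[of w "k + 1" "g i" 0 zs] by (simp add: g_def)
    have s2: "exec w (compile (case_nat (k + 2) \<rho>) (k + 3) b) (?g, 0, zs) (poly (time_bound b) N')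
        (?g(k + 3 := B i), 0, zs)"
      unfolding B_def env[symmetric]
    proof (rule Sum.IH(2))
      show "case_nat (k + 2) \<rho> j < k + 3" for j using \<rho> by (simp split: nat.split)
      show "?g (case_nat (k + 2) \<rho> j) \<le> N'" for j using fun_cong[OF env, of j] N'(2)[OF i, of j] by simp
      show "length w \<le> N'" using N'(1)[OF i] .
    qed (use Sum.prems in \<open>auto simp: g_def\<close>)
    have s3: "exec w (move (k + 3) k) (?g(k + 3 := B i), 0, zs) (5 * B i + 1)
        (?g(k := (\<Sum>j<Suc i. B j)), 0, zs)"
      using exec_move[of "k + 3" k w "?g(k + 3 := B i)" 0 zs] Sum.prems
      by (auto simp: fun_eq_iff g_def elim!: back_subst[of "exec _ _ _ _"])
    have s4: "exec w (Inc (k + 2)) (?g(k := (\<Sum>j<Suc i. B j)), 0, zs) 1 (g (Suc i), 0, zs)"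
      using exec_Inc[of w "k + 2" "?g(k := (\<Sum>j<Suc i. B j))" 0 zs]
      by (auto simp: fun_eq_iff g_def elim!: back_subst[of "exec _ _ _ _"])
    have "exec w ?body (S i) (1 + (poly (time_bound b) N' + (5 * B i + 1 + 1 + 1) + 1) + 1) (S (Suc i))"
      unfolding S_def by (intro exec_Seq[OF s1] exec_Seq[OF s2] exec_Seq[OF s3 s4])
    then show "exec w ?body (S i) (T + 4) (S (Suc i))"
      by (rule exec_mono) (use B[OF i] in \<open>simp add: T_def\<close>)
  qed (simp add: S_def g_def)
  moreover have "S 0 = (f(k + 1 := A), 0, zs)" using Sum.prems by (auto simp: S_def g_def fun_eq_iff)
  ultimately have 2: "exec w (While (Nonzero (k + 1)) ?body) (f(k + 1 := A), 0, zs)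
      (A * (T + 4 + 2) + 1) (S A)" by simp
  have 3: "exec w (clear (k + 2)) (S A) (3 * A + 1) (f(k := \<Sum>j<A. B j), 0, zs)"
    using exec_clear[of w "k + 2" "g A" 0 zs] Sum.prems
    by (auto simp: S_def fun_eq_iff g_def elim!: back_subst[of "exec _ _ _ _"])
  have "exec w (compile \<rho> k (Sum a b)) (f, 0, zs)
      (poly (time_bound a) N + (A * (T + 4 + 2) + 1 + (3 * A + 1) + 1) + 1) (f(k := \<Sum>j<A. B j), 0, zs)"
    unfolding compile.simps by (intro exec_Seq[OF 1] exec_Seq[OF 2 3])
  moreover have "A * (T + 4 + 2) + 3 * A \<le> poly (value_bound a) N * (T + 9)"
    using mult_le_mono1[OF A, of "T + 9"] by (simp add: algebra_simps)
  ultimately show ?case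
    by (elim exec_weaken)
      (auto simp: A_def B_def T_def N'_def poly_pcompose algebra_simps)
qed

section \<open>Simulation by Turing machines\<close>

fun cond_regs :: "cond \<Rightarrow> nat set" where
  "cond_regs (Nonzero r) = {r}"
| "cond_regs Nonblank = {}"

fun cmd_regs :: "cmd \<Rightarrow> nat set" where
  "cmd_regs Skip = {}"
| "cmd_regs (Inc r) = {r}"
| "cmd_regs (Dec r) = {r}"
| "cmd_regs HeadL = {}"
| "cmd_regs HeadR = {}"
| "cmd_regs (Probe y r) = {r}"
| "cmd_regs (Emit r) = {r}"
| "cmd_regs (c1 ;; c2) = cmd_regs c1 \<union> cmd_regs c2"
| "cmd_regs (While k c) = cond_regs k \<union> cmd_regs c"

text \<open>A syntactic superset of the residual programs, in the manner of derivatives of regular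
  expressions: residuals of a loop body are followed by the loop itself. Its finiteness gives the
  machine a finite state set.\<close>

fun reach :: "cmd \<Rightarrow> cmd set" where
  "reach (c1 ;; c2) = (\<lambda>c. c ;; c2) ` reach c1 \<union> reach c2"
| "reach (While k c) = {While k c, Skip} \<union> (\<lambda>c'. c' ;; While k c) ` reach c"
| "reach c = {c, Skip}"

lemma reach_self: "c \<in> reach c" and reach_Skip: "Skip \<in> reach c"
  by (induction c) auto

lemma finite_reach: "finite (reach c)"
  by (induction c) auto

lemma small_reach: "d \<in> reach c \<Longrightarrow> fst (small b y d) \<in> reach c"
proof (induction c arbitrary: d)
  case (Seq c1 c2)
  then show ?case using reach_self reach_Skip by (auto split: if_splits)
next
  case (While k c)
  then show ?case using reach_self reach_Skip by (auto split: if_splits)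
qed (auto split: if_splits)

lemma reach_regs: "d \<in> reach c \<Longrightarrow> cmd_regs d \<subseteq> cmd_regs c"
  by (induction c arbitrary: d) fastforce+

fun effect_regs :: "effect \<Rightarrow> nat set" where
  "effect_regs (Up r) = {r}"
| "effect_regs (Down r) = {r}"
| "effect_regs _ = {}"

lemma small_regs: "effect_regs (snd (small b y c)) \<subseteq> cmd_regs c"
  by (induction c) auto

text \<open>Decrements are emitted only after a nonzero test, so a register head never moves left of
  its marker.\<close>

lemma small_Down: "snd (small b y c) = Down r \<Longrightarrow> b (Nonzero r)"
  by (induction c) (auto split: if_splits)

lemma small_cong:
  assumes "\<And>r. r \<in> cmd_regs c \<Longrightarrow> b (Nonzero r) = b' (Nonzero r)" "b Nonblank = b' Nonblank"
  shows "small b y c = small b' y c"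
  using assms
proof (induction c)
  case (While k c)
  then show ?case by (cases k) auto
qed auto

section \<open>The simulating machine\<close>

text \<open>Tape 0 carries the input, tape \<open>r + 1\<close> register \<open>r\<close>, and the last tape the output. A register is
  the head position on a tape that is blank except for a marker in cell 0.\<close>

fun effect_at :: "nat \<Rightarrow> effect \<Rightarrow> nat \<Rightarrow> symbol \<Rightarrow> symbol \<times> move" where
  "effect_at R (Up r) i y = (y, if i = r + 1 then MoveRight else Stay)"
| "effect_at R (Down r) i y = (y, if i = r + 1 then MoveLeft else Stay)"
| "effect_at R GoL i y = (y, if i = 0 then MoveLeft else Stay)"
| "effect_at R GoR i y = (y, if i = 0 then MoveRight else Stay)"
| "effect_at R (Put b) i y = (if i = R + 1 then (bit_sym b, MoveRight) else (y, Stay))"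
| "effect_at R Nop i y = (y, Stay)"

fun scan_test :: "symbol list \<Rightarrow> cond \<Rightarrow> bool" where
  "scan_test ss (Nonzero r) = (ss ! (r + 1) \<noteq> sep_sym)"
| "scan_test ss Nonblank = (ss ! 0 \<noteq> blank)"

text \<open>States 0, 1 and 2 are reserved for acceptance, rejection and the start, so program codes
  begin at 3.\<close>

definition code :: "cmd \<Rightarrow> nat" where
  "code c = 3 + to_nat c"

text \<open>State 2 makes one initial step that puts the markers on the register tapes; the residual
  program \<open>Skip\<close> makes one final step that turns register \<open>out\<close> into a
  verdict. Every other program state mirrors one step of the program.\<close>

definition machine_delta ::
  "nat \<Rightarrow> nat \<Rightarrow> cmd \<Rightarrow> nat \<Rightarrow> symbol list \<Rightarrow> nat \<times> (symbol \<times> move) list" where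
  "machine_delta R out c q ss =
     (if q = 2 then (code c, map (\<lambda>i. (if 0 < i \<and> i \<le> R then sep_sym else ss ! i, Stay)) [0..<Suc (Suc R)])
      else let d = from_nat (q - 3) in
        if d = Skip then (if scan_test ss (Nonzero out) then 0 else 1, map (\<lambda>i. (ss ! i, Stay)) [0..<Suc (Suc R)])
        else (code (fst (small (scan_test ss) (ss ! 0) d)),
              map (\<lambda>i. effect_at R (snd (small (scan_test ss) (ss ! 0) d)) i (ss ! i)) [0..<Suc (Suc R)]))"

definition machine :: "nat \<Rightarrow> nat \<Rightarrow> cmd \<Rightarrow> tm" where
  "machine R out c =
     \<lparr>tapes = Suc (Suc R), states = {0, 1, 2} \<union> code ` reach c, alphabet = {0, 1, 2, 3},
      start = 2, accept = 0, reject = 1, delta = machine_delta R out c\<rparr>"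

lemma fst_effect_at: "fst (effect_at R a i y) \<in> {y, 1, 2}"
proof (cases a)
  case (Put b)
  then show ?thesis by (cases b) auto
qed auto

lemma from_nat_code [simp]: "from_nat (code c - 3) = c"
  by (simp add: code_def)

lemma fst_set_map_upt: "(\<And>i. i < n \<Longrightarrow> fst (g i) \<in> A) \<Longrightarrow> fst ` set (map g [0..<n]) \<subseteq> A"
  by auto

lemma turing_machine_machine: "turing_machine (machine R out c)"
proof -
  have "case machine_delta R out c q ss of (q', as) \<Rightarrow>
      q' \<in> states (machine R out c) \<and> length as = Suc (Suc R) \<and> fst ` set as \<subseteq> {0, 1, 2, 3}"
    if q: "q \<in> {2} \<union> code ` reach c" and ss: "length ss = Suc (Suc R)" "set ss \<subseteq> {0, 1, 2, 3}" for q ss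
  proof -
    have nth: "ss ! i \<in> {0, 1, 2, 3}" if "i < Suc (Suc R)" for i
      using ss that by (metis nth_mem subsetD)
    have eff: "fst (effect_at R a i (ss ! i)) \<in> {0, 1, 2, 3}" if "i < Suc (Suc R)" for a i
      using fst_effect_at[of R a i "ss ! i"] nth[OF that] by auto
    show ?thesis
    proof (cases "q = 2")
      case True
      define g where "g i = (if 0 < i \<and> i \<le> R then sep_sym else ss ! i)" for i
      have g: "g i \<in> {0, 1, 2, 3}" if "i < Suc (Suc R)" for i
        using nth[OF that] by (simp add: g_def sep_sym_def)
      have eq: "machine_delta R out c q ss = (code c, map (\<lambda>i. (g i, Stay)) [0..<Suc (Suc R)])"
        by (simp add: machine_delta_def g_def True del: upt_Suc)
      have "fst ` set (map (\<lambda>i. (g i, Stay)) [0..<Suc (Suc R)]) \<subseteq> {0, 1, 2, 3}"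
        by (rule fst_set_map_upt) (use g in simp)
      then show ?thesis
        unfolding eq using reach_self[of c] by (simp add: machine_def del: upt_Suc)
    next
      case False
      then obtain d where d: "d \<in> reach c" "q = code d" using q by auto
      define a where "a = snd (small (scan_test ss) (ss ! 0) d)"
      have stay: "fst ` set (map (\<lambda>i. (ss ! i, Stay)) [0..<Suc (Suc R)]) \<subseteq> {0, 1, 2, 3}"
        by (rule fst_set_map_upt) (use nth in simp)
      have move: "fst ` set (map (\<lambda>i. effect_at R a i (ss ! i)) [0..<Suc (Suc R)]) \<subseteq> {0, 1, 2, 3}"
        by (rule fst_set_map_upt) (use eff in simp)
      show ?thesis
      proof (cases "d = Skip")
        case True
        with d False stay show ?thesis
          by (simp add: machine_delta_def machine_def Let_def del: upt_Suc)
      next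
        case nSkip: False
        have "machine_delta R out c q ss = (code (fst (small (scan_test ss) (ss ! 0) d)),
            map (\<lambda>i. effect_at R a i (ss ! i)) [0..<Suc (Suc R)])"
          using nSkip d False by (simp add: machine_delta_def a_def del: upt_Suc)
        with small_reach[OF d(1)] move show ?thesis
          by (simp add: machine_def del: upt_Suc)
      qed
    qed
  qed
  then show ?thesis
    unfolding turing_machine_def
    by (auto simp: machine_def finite_reach blank_def sep_sym_def)
qed

section \<open>Correctness of the simulation\<close>

fun tape_of :: "symbol list \<Rightarrow> nat \<Rightarrow> store \<Rightarrow> nat \<Rightarrow> tape" where
  "tape_of w R (f, h, zs) i =
     (if i = 0 then (cell w, h)
      else if i = R + 1 then (\<lambda>z. if 0 \<le> z \<and> z < int (length zs) then bit_sym (zs ! nat z) else blank, int (length zs))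
      else (\<lambda>z. if z = 0 then sep_sym else blank, int (f (i - 1))))"

definition conf :: "symbol list \<Rightarrow> nat \<Rightarrow> cmd \<times> store \<Rightarrow> config" where
  "conf w R = (\<lambda>(c, s). (code c, map (tape_of w R s) [0..<Suc (Suc R)]))"

text \<open>The side condition on \<open>Down\<close> makes truncated subtraction on the register
  agree with the head moving one cell left.\<close>

lemma act_effect_at:
  assumes "effect_regs a \<subseteq> {..<R}" "\<And>r. a = Down r \<Longrightarrow> fst s r \<noteq> 0" "i < Suc (Suc R)"
  shows "act (effect_at R a i (scan (tape_of w R s i))) (tape_of w R s i) = tape_of w R (effect_on a s) i"
proof -
  obtain f h zs where s: "s = (f, h, zs)" by (cases s)
  show ?thesis
    using assms unfolding s
    by (cases a) (auto simp: fun_eq_iff nth_append nat_less_iff)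
qed

lemma map2_map: "map2 g (map a xs) (map b xs) = map (\<lambda>x. g (a x) (b x)) xs"
  by (induction xs) auto

lemma step_machine:
  assumes "cmd_regs d \<subseteq> {..<R}" "d \<noteq> Skip"
  shows "step (machine R out c) (conf w R (d, s)) = conf w R (cstep w (d, s))"
proof -
  obtain f h zs where s: "s = (f, h, zs)" by (cases s)
  let ?ss = "map scan (map (tape_of w R s) [0..<Suc (Suc R)])"
  have ss: "?ss ! i = scan (tape_of w R s i)" if "i < Suc (Suc R)" for i
    using that by (simp del: upt_Suc)
  have eq: "small (scan_test ?ss) (?ss ! 0) d = small (test w s) (cell w (fst (snd s))) d"
    (is "_ = ?sm")
  proof -
    have "scan_test ?ss (Nonzero r) = test w s (Nonzero r)" if "r \<in> cmd_regs d" for r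
    proof -
      have "r < R" using that assms(1) by auto
      then show ?thesis using ss[of "r + 1"] by (simp add: s blank_def sep_sym_def del: upt_Suc map_map)
    qed
    moreover have "scan_test ?ss Nonblank = test w s Nonblank"
      using ss[of 0] by (simp add: s del: upt_Suc map_map)
    ultimately have "small (scan_test ?ss) y d = small (test w s) y d" for y
      by (rule small_cong)
    moreover have "?ss ! 0 = cell w (fst (snd s))"
      using ss[of 0] by (simp add: s del: upt_Suc map_map)
    ultimately show ?thesis by (simp only:)
  qed
  have nh: "\<not> halted (machine R out c) (conf w R (d, s))" "code d \<noteq> 2"
    by (simp_all add: halted_def machine_def conf_def code_def del: upt_Suc)
  have a: "effect_regs (snd ?sm) \<subseteq> {..<R}" using assms(1) small_regs by blast
  have dn: "fst s r \<noteq> 0" if "snd ?sm = Down r" for r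
    using small_Down[OF that] by (simp add: s)
  have "step (machine R out c) (conf w R (d, s)) =
    (code (fst ?sm), map2 act (map (\<lambda>i. effect_at R (snd ?sm) i (?ss ! i)) [0..<Suc (Suc R)])
       (map (tape_of w R s) [0..<Suc (Suc R)]))"
    using nh assms(2) eq unfolding step_def
    by (simp add: conf_def machine_def machine_delta_def Let_def del: upt_Suc map_map)
  also have "map2 act (map (\<lambda>i. effect_at R (snd ?sm) i (?ss ! i)) [0..<Suc (Suc R)])
       (map (tape_of w R s) [0..<Suc (Suc R)]) = map (tape_of w R (effect_on (snd ?sm) s)) [0..<Suc (Suc R)]"
    unfolding map2_map
    by (intro map_cong refl) (use act_effect_at[OF a dn] ss in \<open>simp del: upt_Suc map_map\<close>)
  finally show ?thesis by (simp add: conf_def cstep_def split_beta del: upt_Suc)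
qed

lemma cstep_reach: "d \<in> reach c \<Longrightarrow> fst (cstep w (d, s)) \<in> reach c"
  by (simp add: cstep_def split_beta small_reach)

lemma cstep_Skip: "(cstep w ^^ n) (Skip, s) = (Skip, s)"
  by (induction n) (simp_all add: cstep_def)

text \<open>Only a bound \<open>m \<le> n\<close> can be claimed: a program idles at
  \<open>Skip\<close>, whereas the machine would go on to its verdict.\<close>

lemma steps_machine:
  assumes "cmd_regs c \<subseteq> {..<R}" "(cstep w ^^ n) (d, s) = (Skip, s')" "d \<in> reach c"
  shows "\<exists>m\<le>n. (step (machine R out c) ^^ m) (conf w R (d, s)) = conf w R (Skip, s')"
  using assms(2,3)
proof (induction n arbitrary: d s)
  case 0
  then show ?case by simp
next
  case (Suc n)
  show ?case
  proof (cases "d = Skip")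
    case True
    then have "s = s'" using Suc.prems(1) cstep_Skip[where n = "Suc n"] by simp
    with True show ?thesis by (intro exI[of _ 0]) simp
  next
    case False
    obtain d1 s1 where 1: "cstep w (d, s) = (d1, s1)" by (cases "cstep w (d, s)")
    have "(cstep w ^^ n) (d1, s1) = (Skip, s')" using Suc.prems(1) 1 by (simp add: funpow_swap1)
    moreover have "d1 \<in> reach c" using cstep_reach[OF Suc.prems(2), of w s] 1 by simp
    ultimately obtain m where "m \<le> n" "(step (machine R out c) ^^ m) (conf w R (d1, s1)) = conf w R (Skip, s')"
      using Suc.IH by blast
    moreover have "step (machine R out c) (conf w R (d, s)) = conf w R (d1, s1)"
      using step_machine[OF _ False] reach_regs[OF Suc.prems(2)] assms(1) 1 by (metis order_trans)
    ultimately show ?thesis by (intro exI[of _ "Suc m"]) (simp add: funpow_swap1)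
  qed
qed

lemma step_halted: "halted M cf \<Longrightarrow> (step M ^^ n) cf = cf"
  by (induction n) (auto simp: step_def)

lemma run_halted:
  assumes "halted M (run M ws n)" "n \<le> m"
  shows "run M ws m = run M ws n"
proof -
  have "m = (m - n) + n" using assms by simp
  then have "run M ws m = (step M ^^ (m - n)) (run M ws n)"
    unfolding run_def by (metis funpow_add comp_apply)
  then show ?thesis using step_halted[OF assms(1)] by simp
qed

lemma accepts_iff_halted:
  assumes "halted M (run M ws n)"
  shows "accepts M ws \<longleftrightarrow> fst (run M ws n) = accept M"
proof
  assume "accepts M ws"
  then obtain t where t: "fst (run M ws t) = accept M" by (auto simp: accepts_def)
  then have "halted M (run M ws t)" by (simp add: halted_def)
  with t assms show "fst (run M ws n) = accept M"
    by (metis nat_le_linear run_halted)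
qed (auto simp: accepts_def)

text \<open>The two extra steps are the placing of the markers and the verdict. Halting
  configurations persist, so any later time \<open>m\<close> shows the same result.\<close>

lemma run_machine:
  assumes "exec w c (\<lambda>_. 0, 0, []) n (f, h, zs)" "cmd_regs c \<subseteq> {..<R}" "out < R" "n + 2 \<le> m"
  shows "halted (machine R out c) (run (machine R out c) w m)"
    and "fst (run (machine R out c) w m) = accept (machine R out c) \<longleftrightarrow> f out \<noteq> 0"
    and "holds_word (last (snd (run (machine R out c) w m))) (map bit_sym zs)"
proof -
  let ?M = "machine R out c"
  obtain k where k: "k \<le> n" "(cstep w ^^ k) (c, (\<lambda>_. 0, 0, [])) = (Skip, (f, h, zs))"
    using assms(1) by (auto simp: exec_def)
  have upt: "[0..<Suc (Suc R)] = 0 # map Suc [0..<R + 1]"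
    by (simp add: upt_conv_Cons map_Suc_upt del: upt_Suc)
  have init: "initial ?M w = (2, map (\<lambda>i. if i = 0 then word_tape w else word_tape []) [0..<Suc (Suc R)])"
    unfolding upt by (simp add: initial_def machine_def map_replicate_const o_def del: upt_Suc)
  have first: "step ?M (initial ?M w) = conf w R (c, (\<lambda>_. 0, 0, []))"
  proof -
    have "\<not> halted ?M (initial ?M w)" unfolding init by (simp add: halted_def machine_def)
    then have "step ?M (initial ?M w) = (code c,
       map2 act (map (\<lambda>i. (if 0 < i \<and> i \<le> R then sep_sym else
           map scan (map (\<lambda>i. if i = 0 then word_tape w else word_tape []) [0..<Suc (Suc R)]) ! i, Stay)) [0..<Suc (Suc R)])
         (map (\<lambda>i. if i = 0 then word_tape w else word_tape []) [0..<Suc (Suc R)]))"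
      unfolding step_def init by (simp add: machine_def machine_delta_def del: upt_Suc map_map)
    also have "map2 act (map (\<lambda>i. (if 0 < i \<and> i \<le> R then sep_sym else
           map scan (map (\<lambda>i. if i = 0 then word_tape w else word_tape []) [0..<Suc (Suc R)]) ! i, Stay)) [0..<Suc (Suc R)])
         (map (\<lambda>i. if i = 0 then word_tape w else word_tape []) [0..<Suc (Suc R)])
       = map (tape_of w R (\<lambda>_. 0, 0, [])) [0..<Suc (Suc R)]"
      unfolding map2_map
      by (intro map_cong refl)
        (auto simp: word_tape_def cell_def fun_eq_iff simp del: upt_Suc)
    finally show ?thesis by (simp add: conf_def)
  qed
  obtain j where j: "j \<le> k" "(step ?M ^^ j) (conf w R (c, (\<lambda>_. 0, 0, []))) = conf w R (Skip, (f, h, zs))"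
    using steps_machine[OF assms(2) k(2) reach_self] by blast
  define q :: nat where "q = (if f out \<noteq> 0 then 0 else 1)"
  have last: "step ?M (conf w R (Skip, (f, h, zs))) = (q, map (tape_of w R (f, h, zs)) [0..<Suc (Suc R)])"
  proof -
    let ?ts = "map (tape_of w R (f, h, zs)) [0..<Suc (Suc R)]"
    have "\<not> halted ?M (conf w R (Skip, (f, h, zs)))" "code Skip \<noteq> 2"
      by (simp_all add: halted_def conf_def machine_def code_def del: upt_Suc)
    then have "step ?M (conf w R (Skip, (f, h, zs))) =
       (if map scan ?ts ! (out + 1) \<noteq> sep_sym then 0 else 1,
        map2 act (map (\<lambda>i. (map scan ?ts ! i, Stay)) [0..<Suc (Suc R)]) ?ts)"
      unfolding step_def by (simp add: conf_def machine_def machine_delta_def Let_def del: upt_Suc map_map)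
    also have "map2 act (map (\<lambda>i. (map scan ?ts ! i, Stay)) [0..<Suc (Suc R)]) ?ts = ?ts"
      unfolding map2_map by (intro map_cong refl) (auto simp del: upt_Suc)
    also have "(if map scan ?ts ! (out + 1) \<noteq> sep_sym then 0 else 1) = q"
      using assms(3) by (simp add: q_def sep_sym_def blank_def del: upt_Suc)
    finally show ?thesis .
  qed
  have "run ?M w (Suc (Suc j)) = step ?M ((step ?M ^^ j) (step ?M (initial ?M w)))"
    unfolding run_def by (simp add: funpow_swap1)
  also have "\<dots> = (q, map (tape_of w R (f, h, zs)) [0..<Suc (Suc R)])"
    unfolding first j(2) last ..
  finally have "run ?M w (Suc (Suc j)) = (q, map (tape_of w R (f, h, zs)) [0..<Suc (Suc R)])" .
  moreover from this have "halted ?M (run ?M w (Suc (Suc j)))" by (simp add: halted_def q_def machine_def)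
  ultimately have run: "run ?M w m = (q, map (tape_of w R (f, h, zs)) [0..<Suc (Suc R)])"
    using run_halted[of ?M w "Suc (Suc j)" m] j(1) k(1) assms(4) by simp
  show "halted ?M (run ?M w m)" unfolding run by (simp add: halted_def q_def machine_def)
  show "fst (run ?M w m) = accept ?M \<longleftrightarrow> f out \<noteq> 0" unfolding run by (simp add: q_def machine_def)
  show "holds_word (last (snd (run ?M w m))) (map bit_sym zs)"
    unfolding run by (simp add: holds_word_def)
qed

section \<open>Deciders and transducers\<close>

lemma finite_cmd_regs: "finite (cmd_regs c)"
proof -
  have "finite (cond_regs k)" for k by (cases k) auto
  then show ?thesis by (induction c) auto
qed

lemma cell_nonblank: "blank \<notin> set w \<Longrightarrow> i < length w \<Longrightarrow> cell w (int i) \<noteq> blank"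
  by (auto simp: cell_def word_tape_def dest: nth_mem)

lemma cell_end: "cell w (int (length w)) = blank"
  by (auto simp: cell_def word_tape_def dest: nth_mem)

text \<open>The length is counted twice: for keeps in register 0, and in register 1 to bring the
  head back to cell 0, after which register 1 is zero again.\<close>

definition measure_input :: cmd where
  "measure_input = While Nonblank (HeadR ;; Inc 0 ;; Inc 1) ;; While (Nonzero 1) (Dec 1 ;; HeadL)"

lemma exec_measure_input:
  assumes "blank \<notin> set w"
  shows "exec w measure_input (\<lambda>_. 0, 0, []) (12 * length w + 3) ((\<lambda>_. 0)(0 := length w), 0, [])"
proof -
  let ?n = "length w"
  define S where "S i = (((\<lambda>_. 0) :: nat \<Rightarrow> nat)(0 := i, 1 := i), int i, [] :: bool list)" for i
  have "exec w (While Nonblank (HeadR ;; Inc 0 ;; Inc 1)) (S 0) (?n * (5 + 2) + 1) (S ?n)"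
  proof (rule exec_loop)
    fix i assume i: "i < ?n"
    then show "test w (S i) Nonblank" using cell_nonblank[OF assms] by (simp add: S_def)
    show "exec w (HeadR ;; Inc 0 ;; Inc 1) (S i) 5 (S (Suc i))"
      using exec_Seq[OF exec_HeadR[of w "(\<lambda>_. 0)(0 := i, 1 := i)" "int i" "[]"]
          exec_Seq[OF exec_Inc[of w 0] exec_Inc[of w 1]]]
      by (simp add: S_def fun_upd_twist eval_nat_numeral add.commute)
  qed (simp add: S_def cell_end)
  moreover have "S 0 = (\<lambda>_. 0, 0, [])" by (auto simp: S_def fun_eq_iff)
  ultimately have 1: "exec w (While Nonblank (HeadR ;; Inc 0 ;; Inc 1)) (\<lambda>_. 0, 0, []) (7 * ?n + 1) (S ?n)"
    by (simp add: mult.commute)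
  define S' where "S' i = (((\<lambda>_. 0) :: nat \<Rightarrow> nat)(0 := ?n, 1 := ?n - i), int (?n - i), [] :: bool list)" for i
  have "exec w (While (Nonzero 1) (Dec 1 ;; HeadL)) (S' 0) (?n * (3 + 2) + 1) (S' ?n)"
  proof (rule exec_loop)
    fix i assume i: "i < ?n"
    then show "test w (S' i) (Nonzero 1)" by (simp add: S'_def)
    show "exec w (Dec 1 ;; HeadL) (S' i) 3 (S' (Suc i))"
      using exec_Seq[OF exec_Dec[of w 1 "(\<lambda>_. 0)(0 := ?n, 1 := ?n - i)" "int (?n - i)" "[]"]
          exec_HeadL[of w]] i
      by (simp add: S'_def eval_nat_numeral algebra_simps)
  qed (simp add: S'_def)
  moreover have "S' 0 = S ?n" by (simp add: S_def S'_def)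
  moreover have "S' ?n = ((\<lambda>_. 0)(0 := ?n), 0, [])" by (auto simp: S'_def fun_eq_iff)
  ultimately have "exec w (While (Nonzero 1) (Dec 1 ;; HeadL)) (S ?n) (5 * ?n + 1) ((\<lambda>_. 0)(0 := ?n), 0, [])"
    by (simp add: mult.commute)
  from exec_Seq[OF 1 this] show ?thesis unfolding measure_input_def by (rule exec_weaken) auto
qed

text \<open>One machine serves as decider, through \<open>t\<close>, and as transducer, through a
  length term \<open>l\<close> and a letter term \<open>b\<close>. Registers: 0 the word length, 1 a
  permanent zero standing for the all-zero environment, 2 the verdict, 3 the number of letters still
  to be written, 4 the index of the current letter, 5 its value.\<close>

lemma term_machine:
  fixes t l b :: trm
  obtains M and T :: "nat poly" where "turing_machine M"
    and "\<And>w n. blank \<notin> set w \<Longrightarrow> poly T (length w) \<le> n \<Longrightarrow> halted M (run M w n) \<and>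
      (fst (run M w n) = accept M \<longleftrightarrow> ev w (\<lambda>_. 0) t \<noteq> 0) \<and>
      holds_word (last (snd (run M w n)))
        (map bit_sym (map (\<lambda>i. ev w (case_nat i (\<lambda>_. 0)) b \<noteq> 0) [0..<ev w (\<lambda>_. 0) l]))"
proof -
  define body where "body = Dec 3 ;; compile (case_nat 4 (\<lambda>_. 1)) 5 b ;; Emit 5 ;; clear 5 ;; Inc 4"
  define c where "c = measure_input ;; compile (\<lambda>_. 1) 2 t ;; compile (\<lambda>_. 1) 3 l ;; While (Nonzero 3) body"
  obtain R where R: "insert 2 (cmd_regs c) \<subseteq> {..<R}"
    using finite_cmd_regs[of c] finite_nat_set_iff_bounded[of "insert 2 (cmd_regs c)"] by auto
  define M where "M = machine R 2 c"
  define B where "B = pcompose (time_bound b + [:3:] * value_bound b + [:9:]) ([:0, 1:] + value_bound l)"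
  \<comment> \<open>The constant 9 consists of 3 for measuring the input, 3 for sequencing, 1 for
    leaving the loop, and 2 for the initial and final steps of the machine.\<close>
  define T where "T = [:9, 12:] + time_bound t + time_bound l + value_bound l * (B + [:2:])"
  have ex: "\<exists>f. (f 2 \<noteq> 0 \<longleftrightarrow> ev w (\<lambda>_. 0) t \<noteq> 0) \<and> exec w c (\<lambda>_. 0, 0, []) (poly T (length w) - 2)
      (f, 0, map (\<lambda>i. ev w (case_nat i (\<lambda>_. 0)) b \<noteq> 0) [0..<ev w (\<lambda>_. 0) l])" if w: "blank \<notin> set w" for w
  proof -
    let ?n = "length w"
    define N where "N = ?n + poly (value_bound l) ?n"
    define L where "L = ev w (\<lambda>_. 0) l"
    define b' where "b' i = ev w (case_nat i (\<lambda>_. 0)) b" for i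
    have L: "L \<le> poly (value_bound l) ?n" unfolding L_def by (rule ev_le_value_bound) auto
    have LN: "?n \<le> N" "L \<le> N" using L by (auto simp: N_def)
    have b': "b' i \<le> poly (value_bound b) N" if "i < L" for i
      unfolding b'_def using LN that by (intro ev_le_value_bound) (auto split: nat.split)
    define V where "V = ev w (\<lambda>_. 0) t"
    have 0: "exec w (compile (\<lambda>_. 1) 2 t) ((\<lambda>_. 0)(0 := ?n), 0, []) (poly (time_bound t) ?n)
      ((\<lambda>_. 0)(0 := ?n, 2 := V), 0, [])"
      using exec_compile[of 2 "\<lambda>_. 1" "(\<lambda>_. 0)(0 := ?n)" w ?n t "[]"] by (simp add: V_def)
    have 1: "exec w (compile (\<lambda>_. 1) 3 l) ((\<lambda>_. 0)(0 := ?n, 2 := V), 0, []) (poly (time_bound l) ?n)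
      ((\<lambda>_. 0)(0 := ?n, 2 := V, 3 := L), 0, [])"
      using exec_compile[of 3 "\<lambda>_. 1" "(\<lambda>_. 0)(0 := ?n, 2 := V)" w ?n l "[]"] by (simp add: L_def)
    define g where "g i = ((\<lambda>_. 0) :: nat \<Rightarrow> nat)(0 := ?n, 2 := V, 3 := L - i, 4 := i)" for i
    define S where "S i = (g i, 0 :: int, map (\<lambda>i. b' i \<noteq> 0) [0..<i])" for i
    have "exec w (While (Nonzero 3) body) (S 0) (L * (poly B ?n + 2) + 1) (S L)"
    proof (rule exec_loop)
      fix i assume i: "i < L"
      then show "test w (S i) (Nonzero 3)" by (simp add: S_def g_def)
      let ?g = "(g i)(3 := L - Suc i)" and ?zs = "map (\<lambda>i. b' i \<noteq> 0) [0..<i]"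
      have env: "(\<lambda>j. ?g (case_nat 4 (\<lambda>_. 1) j)) = case_nat i (\<lambda>_. 0)"
        by (auto simp: fun_eq_iff g_def split: nat.split)
      have s1: "exec w (Dec 3) (g i, 0, ?zs) 1 (?g, 0, ?zs)"
        using exec_Dec[of w 3 "g i" 0 ?zs] by (simp add: g_def)
      have s2: "exec w (compile (case_nat 4 (\<lambda>_. 1)) 5 b) (?g, 0, ?zs) (poly (time_bound b) N)
          (?g(5 := b' i), 0, ?zs)"
        unfolding b'_def env[symmetric]
      proof (rule exec_compile)
        show "case_nat 4 (\<lambda>_. 1) j < (5 :: nat)" for j by (simp split: nat.split)
        show "?g (case_nat 4 (\<lambda>_. 1) j) \<le> N" for j
          using fun_cong[OF env, of j] LN i by (simp split: nat.split)
      qed (use LN in \<open>auto simp: g_def\<close>)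
      have s3: "exec w (Emit 5) (?g(5 := b' i), 0, ?zs) 1 (?g(5 := b' i), 0, ?zs @ [b' i \<noteq> 0])"
        using exec_Emit[of w 5 "?g(5 := b' i)" 0 ?zs] by simp
      have s4: "exec w (clear 5) (?g(5 := b' i), 0, ?zs @ [b' i \<noteq> 0]) (3 * b' i + 1)
          (?g, 0, ?zs @ [b' i \<noteq> 0])"
        using exec_clear[of w 5 "?g(5 := b' i)" 0 "?zs @ [b' i \<noteq> 0]"]
        by (auto simp: fun_eq_iff g_def elim!: back_subst[of "exec _ _ _ _"])
      have s5: "exec w (Inc 4) (?g, 0, ?zs @ [b' i \<noteq> 0]) 1 (S (Suc i))"
        using exec_Inc[of w 4 ?g 0 "?zs @ [b' i \<noteq> 0]"]
        by (auto simp: fun_eq_iff g_def S_def elim!: back_subst[of "exec _ _ _ _"])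
      have "exec w body (S i)
          (1 + (poly (time_bound b) N + (1 + (3 * b' i + 1 + 1 + 1) + 1) + 1) + 1) (S (Suc i))"
        unfolding body_def S_def[of i]
        by (intro exec_Seq[OF s1] exec_Seq[OF s2] exec_Seq[OF s3] exec_Seq[OF s4 s5])
      then show "exec w body (S i) (poly B ?n) (S (Suc i))"
        by (rule exec_mono) (use b'[OF i] in \<open>simp add: B_def N_def poly_pcompose\<close>)
    qed (simp add: S_def g_def)
    moreover have "S 0 = ((\<lambda>_. 0)(0 := ?n, 2 := V, 3 := L), 0, [])" by (auto simp: S_def g_def fun_eq_iff)
    ultimately have 2: "exec w (While (Nonzero 3) body) ((\<lambda>_. 0)(0 := ?n, 2 := V, 3 := L), 0, [])
        (L * (poly B ?n + 2) + 1) (S L)" by simp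
    have "L * (poly B ?n + 2) \<le> poly (value_bound l) ?n * (poly B ?n + 2)" using L by (rule mult_le_mono1)
    then have "exec w c (\<lambda>_. 0, 0, []) (poly T ?n - 2) (S L)"
      unfolding c_def
      by (intro exec_mono[OF exec_Seq[OF exec_measure_input[OF w] exec_Seq[OF 0 exec_Seq[OF 1 2]]]])
        (simp add: T_def algebra_simps)
    then show ?thesis by (intro exI[of _ "g L"]) (simp add: S_def L_def b'_def V_def g_def)
  qed
  show ?thesis
  proof (rule that[of M T])
    show "turing_machine M" unfolding M_def by (rule turing_machine_machine)
    fix w n assume w: "blank \<notin> set w" and n: "poly T (length w) \<le> n"
    from ex[OF w] obtain f where V: "f 2 \<noteq> 0 \<longleftrightarrow> ev w (\<lambda>_. 0) t \<noteq> 0" and f: "exec w c (\<lambda>_. 0, 0, []) (poly T (length w) - 2)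
      (f, 0, map (\<lambda>i. ev w (case_nat i (\<lambda>_. 0)) b \<noteq> 0) [0..<ev w (\<lambda>_. 0) l])" by blast
    have "poly T (length w) - 2 + 2 \<le> n" using n by (simp add: T_def)
    then show "halted M (run M w n) \<and> (fst (run M w n) = accept M \<longleftrightarrow> ev w (\<lambda>_. 0) t \<noteq> 0) \<and>
        holds_word (last (snd (run M w n)))
        (map bit_sym (map (\<lambda>i. ev w (case_nat i (\<lambda>_. 0)) b \<noteq> 0) [0..<ev w (\<lambda>_. 0) l]))"
      using run_machine[OF f, of R 2 n] R V unfolding M_def by auto
  qed
qed

section \<open>Functions given by terms\<close>

fun ren :: "(nat \<Rightarrow> nat) \<Rightarrow> trm \<Rightarrow> trm" where
  "ren \<rho> (Cst c) = Cst c"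
| "ren \<rho> (Var i) = Var (\<rho> i)"
| "ren \<rho> Len = Len"
| "ren \<rho> (Sym y a) = Sym y (ren \<rho> a)"
| "ren \<rho> (Add a b) = Add (ren \<rho> a) (ren \<rho> b)"
| "ren \<rho> (Sub a b) = Sub (ren \<rho> a) (ren \<rho> b)"
| "ren \<rho> (Shr a b) = Shr (ren \<rho> a) (ren \<rho> b)"
| "ren \<rho> (Sum a b) = Sum (ren \<rho> a) (ren (case_nat 0 (Suc \<circ> \<rho>)) b)"

fun sub :: "(nat \<Rightarrow> trm) \<Rightarrow> trm \<Rightarrow> trm" where
  "sub \<sigma> (Cst c) = Cst c"
| "sub \<sigma> (Var i) = \<sigma> i"
| "sub \<sigma> Len = Len"
| "sub \<sigma> (Sym y a) = Sym y (sub \<sigma> a)"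
| "sub \<sigma> (Add a b) = Add (sub \<sigma> a) (sub \<sigma> b)"
| "sub \<sigma> (Sub a b) = Sub (sub \<sigma> a) (sub \<sigma> b)"
| "sub \<sigma> (Shr a b) = Shr (sub \<sigma> a) (sub \<sigma> b)"
| "sub \<sigma> (Sum a b) = Sum (sub \<sigma> a) (sub (case_nat (Var 0) (ren Suc \<circ> \<sigma>)) b)"

lemma ev_ren: "ev w e (ren \<rho> t) = ev w (\<lambda>i. e (\<rho> i)) t"
proof (induction t arbitrary: e \<rho>)
  case (Sum a b)
  have "(\<lambda>i. case_nat j e (case_nat 0 (Suc \<circ> \<rho>) i)) = case_nat j (\<lambda>i. e (\<rho> i))" for j
    by (auto simp: fun_eq_iff split: nat.split)
  with Sum show ?case by simp
qed simp_all

lemma ev_sub: "ev w e (sub \<sigma> t) = ev w (\<lambda>i. ev w e (\<sigma> i)) t"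
proof (induction t arbitrary: e \<sigma>)
  case (Sum a b)
  have "(\<lambda>i. ev w (case_nat j e) (case_nat (Var 0) (ren Suc \<circ> \<sigma>) i)) = case_nat j (\<lambda>i. ev w e (\<sigma> i))" for j
    by (auto simp: fun_eq_iff ev_ren split: nat.split)
  with Sum show ?case by simp
qed simp_all

text \<open>A function of a word and an environment of numbers is \<^emph>\<open>tame\<close> if it is the value of a term. The
  environment acts as a stack of bound variables, so that under a binder \<open>e 0\<close> is the bound variable
  and \<open>\<lambda>i. e (Suc i)\<close> the outer environment.\<close>

definition tc :: "(symbol list \<Rightarrow> (nat \<Rightarrow> nat) \<Rightarrow> nat) \<Rightarrow> bool" where
  "tc f \<longleftrightarrow> (\<exists>t. \<forall>w e. ev w e t = f w e)"

abbreviation tcb :: "(symbol list \<Rightarrow> (nat \<Rightarrow> nat) \<Rightarrow> bool) \<Rightarrow> bool" where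
  "tcb P \<equiv> tc (\<lambda>w e. of_bool (P w e))"

text \<open>The device behind all later changes of environment: shifting under a binder, permuting
  bound variables and plugging in arguments are instances.\<close>

lemma tc_subst:
  assumes "tc F" "\<And>i. tc (A i)"
  shows "tc (\<lambda>w e. F w (\<lambda>i. A i w e))"
proof -
  obtain t where t: "\<And>w e. ev w e t = F w e" using assms(1) unfolding tc_def by blast
  obtain s where s: "\<And>i w e. ev w e (s i) = A i w e" using assms(2) unfolding tc_def by metis
  have "ev w e (sub s t) = F w (\<lambda>i. A i w e)" for w e by (simp add: ev_sub t s)
  then show ?thesis unfolding tc_def by blast
qed

section \<open>Closure properties of tame functions\<close>

lemma tc_const: "tc (\<lambda>w e. c)"
  unfolding tc_def by (rule exI[of _ "Cst c"]) simp

lemma tc_var: "tc (\<lambda>w e. e k)"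
  unfolding tc_def by (rule exI[of _ "Var k"]) simp

lemma tc_length: "tc (\<lambda>w e. length w)"
  unfolding tc_def by (rule exI[of _ Len]) simp

lemma tc_add: "tc A \<Longrightarrow> tc B \<Longrightarrow> tc (\<lambda>w e. A w e + B w e)"
  unfolding tc_def by (metis ev.simps(5))

lemma tc_diff: "tc A \<Longrightarrow> tc B \<Longrightarrow> tc (\<lambda>w e. A w e - B w e)"
  unfolding tc_def by (metis ev.simps(6))

lemma tc_shr: "tc A \<Longrightarrow> tc B \<Longrightarrow> tc (\<lambda>w e. A w e div 2 ^ B w e)"
  unfolding tc_def by (metis ev.simps(7))

lemma tc_cell: "tc A \<Longrightarrow> tcb (\<lambda>w e. cell w (int (A w e)) = y)"
  unfolding tc_def by (metis ev.simps(4))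

lemma tc_sum:
  assumes "tc A" "tc (\<lambda>w e. B w (e 0) (\<lambda>i. e (Suc i)))"
  shows "tc (\<lambda>w e. \<Sum>i<A w e. B w i e)"
proof -
  obtain a where a: "\<And>w e. ev w e a = A w e" using assms(1) unfolding tc_def by blast
  obtain b where b: "\<And>w e. ev w e b = B w (e 0) (\<lambda>i. e (Suc i))" using assms(2) unfolding tc_def by blast
  have "ev w e (Sum a b) = (\<Sum>i<A w e. B w i e)" for w e by (simp add: a b)
  then show ?thesis unfolding tc_def by blast
qed

lemma tc_shift: "tc A \<Longrightarrow> tc (\<lambda>w e. A w (\<lambda>i. e (Suc i)))"
  by (rule tc_subst[of A "\<lambda>i w e. e (Suc i)"]) (auto intro: tc_var)

lemma tc_mult:
  assumes "tc A" "tc B"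
  shows "tc (\<lambda>w e. A w e * B w e)"
proof -
  have "tc (\<lambda>w e. \<Sum>i<A w e. B w e)"
    using assms by (intro tc_sum tc_shift)
  then show ?thesis by simp
qed

lemma tc_Suc: "tc A \<Longrightarrow> tc (\<lambda>w e. Suc (A w e))"
  using tc_add[OF tc_const[of 1], of A] by simp

lemma tc_power: "tc A \<Longrightarrow> tc (\<lambda>w e. A w e ^ k)"
  by (induction k) (auto intro: tc_const tc_mult)

lemma tc_poly: "tc A \<Longrightarrow> tc (\<lambda>w e. poly p (A w e))"
  by (induction p) (auto intro!: tc_const tc_mult tc_add)

lemma tcb_not:
  assumes "tcb P"
  shows "tcb (\<lambda>w e. \<not> P w e)"
proof -
  have "tc (\<lambda>w e. 1 - of_bool (P w e))" using assms by (intro tc_diff tc_const)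
  moreover have "1 - of_bool p = (of_bool (\<not> p) :: nat)" for p by simp
  ultimately show ?thesis by (simp only:)
qed

lemma tcb_conj:
  assumes "tcb P" "tcb Q"
  shows "tcb (\<lambda>w e. P w e \<and> Q w e)"
  using tc_mult[OF assms] by (simp only: of_bool_conj)

lemma tcb_disj:
  assumes "tcb P" "tcb Q"
  shows "tcb (\<lambda>w e. P w e \<or> Q w e)"
  using tcb_not[OF tcb_conj[OF tcb_not[OF assms(1)] tcb_not[OF assms(2)]]]
  by (simp only: de_Morgan_conj not_not)

lemma tcb_imp:
  assumes "tcb P" "tcb Q"
  shows "tcb (\<lambda>w e. P w e \<longrightarrow> Q w e)"
  using tcb_disj[OF tcb_not[OF assms(1)] assms(2)] by (simp only: imp_conv_disj)

lemma tcb_less: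
  assumes "tc A" "tc B"
  shows "tcb (\<lambda>w e. A w e < B w e)"
proof -
  \<comment> \<open>In truncated subtraction, \<open>1 - (1 - c)\<close> is the indicator of
    \<open>c \<noteq> 0\<close>.\<close>
  have "tc (\<lambda>w e. 1 - (1 - (B w e - A w e)))" using assms by (intro tc_diff tc_const)
  moreover have "of_bool (a < b) = 1 - (1 - (b - a))" for a b :: nat by auto
  ultimately show ?thesis by simp
qed

lemma tcb_le: "tc A \<Longrightarrow> tc B \<Longrightarrow> tcb (\<lambda>w e. A w e \<le> B w e)"
  using tcb_not[OF tcb_less, of B A] by (simp add: not_less)

lemma tcb_eq: "tc A \<Longrightarrow> tc B \<Longrightarrow> tcb (\<lambda>w e. A w e = (B w e :: nat))"
  using tcb_conj[OF tcb_le tcb_le, of A B B A] by (simp add: eq_iff)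

lemma tcb_iff:
  assumes "tcb P" "tcb Q"
  shows "tcb (\<lambda>w e. P w e = (Q w e :: bool))"
proof -
  have "tcb (\<lambda>w e. (P w e \<longrightarrow> Q w e) \<and> (Q w e \<longrightarrow> P w e))" using assms by (intro tcb_conj tcb_imp)
  moreover have "(p = q) = ((p \<longrightarrow> q) \<and> (q \<longrightarrow> p))" for p q :: bool by blast
  ultimately show ?thesis by simp
qed

lemma tcb_ex:
  assumes "tc A" "tcb (\<lambda>w e. P w (e 0) (\<lambda>i. e (Suc i)))"
  shows "tcb (\<lambda>w e. \<exists>i<A w e. P w i e)"
proof -
  have "tcb (\<lambda>w e. 0 < (\<Sum>i<A w e. of_bool (P w i e) :: nat))"
    by (intro tcb_less tc_const tc_sum assms)
  moreover have "(0 < (\<Sum>i<n. of_bool (Q i) :: nat)) = (\<exists>i<n. Q i)" for n :: nat and Q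
    unfolding zero_less_iff_neq_zero by (subst sum_eq_0_iff) auto
  ultimately show ?thesis by (simp only:)
qed

lemma tcb_all:
  assumes "tc A" "tcb (\<lambda>w e. P w (e 0) (\<lambda>i. e (Suc i)))"
  shows "tcb (\<lambda>w e. \<forall>i<A w e. P w i e)"
  using tcb_not[OF tcb_ex[OF assms(1) tcb_not[OF assms(2)]]] by simp

lemma tc_if:
  assumes "tcb P" "tc A" "tc B"
  shows "tc (\<lambda>w e. if P w e then A w e else B w e)"
proof -
  have "tc (\<lambda>w e. of_bool (P w e) * A w e + of_bool (\<not> P w e) * B w e)"
    using assms by (intro tc_add tc_mult tcb_not)
  moreover have "(if p then a else b) = of_bool p * a + of_bool (\<not> p) * b" for p and a b :: nat by simp
  ultimately show ?thesis by simp
qed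

lemma tcb_if:
  assumes "tcb P" "tcb A" "tcb B"
  shows "tcb (\<lambda>w e. if P w e then A w e else B w e)"
  using tc_if[OF assms] by (simp add: if_distrib)

text \<open>The quotient counts the positive multiples of the divisor up to the dividend; the guard
  \<open>0 < B w e\<close> reproduces the convention that division by zero gives 0.\<close>

lemma tc_div:
  assumes "tc A" "tc B"
  shows "tc (\<lambda>w e. A w e div B w e)"
proof -
  have "tc (\<lambda>w e. \<Sum>i<A w e. of_bool (0 < B w e \<and> Suc i * B w e \<le> A w e))"
    using assms by (intro tc_sum tcb_conj tcb_less tcb_le tc_mult tc_const tc_var tc_Suc tc_shift)
  moreover have "a div b = (\<Sum>i<a. of_bool (0 < b \<and> Suc i * b \<le> a))" for a b :: nat
  proof (cases "b = 0")
    case False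
    have "{i. i < a \<and> Suc i * b \<le> a} = {..<a div b}"
    proof -
      have "Suc i * b \<le> a \<longleftrightarrow> i < a div b" for i
        using False by (metis Suc_le_eq less_eq_div_iff_mult_less_eq neq0_conv)
      then show ?thesis by (auto intro: less_le_trans)
    qed
    moreover have "(\<Sum>i<a. of_bool (0 < b \<and> Suc i * b \<le> a) :: nat) = card {i. i < a \<and> Suc i * b \<le> a}"
      using False by (simp add: sum.If_cases of_bool_def Int_def)
    ultimately show ?thesis by simp
  qed simp
  ultimately show ?thesis by simp
qed

lemma tc_mod: "tc A \<Longrightarrow> tc B \<Longrightarrow> tc (\<lambda>w e. A w e mod B w e)"
  by (simp only: modulo_nat_def) (intro tc_diff tc_mult tc_div)

lemma tcb_bit: "tc A \<Longrightarrow> tc B \<Longrightarrow> tcb (\<lambda>w e. odd (A w e div 2 ^ B w e))"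
  by (simp only: odd_iff_mod_2_eq_one) (intro tcb_eq tc_mod tc_shr tc_const)

text \<open>A case distinction over constantly many values needs no uniformity among its branches.
  This is how the finite but unstructured transition function of a given machine enters.\<close>

lemma tc_table:
  assumes "tc A" "\<And>i. i < K \<Longrightarrow> tc (F i)"
  shows "tc (\<lambda>w e. if A w e < K then F (A w e) w e else 0)"
  using assms(2)
proof (induction K)
  case 0
  then show ?case by (simp add: tc_const)
next
  case (Suc K)
  have "tc (\<lambda>w e. if A w e = K then F K w e else if A w e < K then F (A w e) w e else 0)"
    using Suc by (intro tc_if[OF tcb_eq[OF assms(1) tc_const]]) auto
  moreover have "(if a = K then F K w e else if a < K then F a w e else 0)
      = (if a < Suc K then F a w e else 0)" for a w e by auto
  ultimately show ?case by simp
qed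

lemma tcb_table:
  assumes "tc A" "\<And>i. i < K \<Longrightarrow> tcb (F i)"
  shows "tcb (\<lambda>w e. A w e < K \<and> F (A w e) w e)"
proof -
  have "tc (\<lambda>w e. if A w e < K then of_bool (F (A w e) w e) else 0)"
    using tc_table[of A K "\<lambda>i w e. of_bool (F i w e)", OF assms(1)] assms(2) by blast
  moreover have "(if a < K then of_bool (F a w e) else 0) = (of_bool (a < K \<and> F a w e) :: nat)" for a w e
    by simp
  ultimately show ?thesis by (simp only:)
qed

lemmas tc_intros =
  tc_cell tcb_bit
  tc_const tc_var tc_length tc_add tc_diff tc_mult tc_Suc tc_div tc_mod tc_power tc_poly tc_sum tc_if
  tcb_not tcb_conj tcb_disj tcb_imp tcb_less tcb_le tcb_eq tcb_iff tcb_ex tcb_all tcb_if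

lemma tc_app1:
  assumes "tc (\<lambda>w e. F w (e 0))" "tc A"
  shows "tc (\<lambda>w e. F w (A w e))"
  using tc_subst[OF assms(1), of "\<lambda>_. A"] assms(2) by simp

lemma tc_app2:
  assumes "tc (\<lambda>w e. F w (e 0) (e 1))" "tc A" "tc B"
  shows "tc (\<lambda>w e. F w (A w e) (B w e))"
  using tc_subst[OF assms(1), of "case_nat A (\<lambda>_. B)"] assms by (simp split: nat.split)

lemma tc_app3:
  assumes "tc (\<lambda>w e. F w (e 0) (e 1) (e 2))" "tc A" "tc B" "tc C"
  shows "tc (\<lambda>w e. F w (A w e) (B w e) (C w e))"
  using tc_subst[OF assms(1), of "case_nat A (case_nat B (\<lambda>_. C))"] assms
  by (simp split: nat.split add: eval_nat_numeral)

text \<open>The letter predicate carries its own range check, since \<open>!\<close> is unspecified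
  beyond the end of a list; it is simply false there.\<close>

definition tcw :: "(symbol list \<Rightarrow> (nat \<Rightarrow> nat) \<Rightarrow> bool list) \<Rightarrow> bool" where
  "tcw F \<longleftrightarrow> tc (\<lambda>w e. length (F w e)) \<and>
     tcb (\<lambda>w e. e 0 < length (F w (\<lambda>i. e (Suc i))) \<and> F w (\<lambda>i. e (Suc i)) ! e 0)"

lemma tcw_length: "tcw F \<Longrightarrow> tc (\<lambda>w e. length (F w e))"
  by (simp add: tcw_def)

lemma tcw_nth:
  assumes "tcw F" "tc I"
  shows "tcb (\<lambda>w e. I w e < length (F w e) \<and> F w e ! I w e)"
proof -
  have "tcb (\<lambda>w e. e 0 < length (F w (\<lambda>i. e (Suc i))) \<and> F w (\<lambda>i. e (Suc i)) ! e 0)"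
    using assms(1) by (simp add: tcw_def)
  from tc_subst[OF this, of "case_nat I (\<lambda>i w e. e i)"] show ?thesis
    using assms(2) by (simp add: tc_var split: nat.split)
qed

lemma tcw_subst:
  assumes "tcw F" "\<And>i. tc (A i)"
  shows "tcw (\<lambda>w e. F w (\<lambda>i. A i w e))"
proof -
  have "tcb (\<lambda>w e. e 0 < length (F w (\<lambda>i. e (Suc i))) \<and> F w (\<lambda>i. e (Suc i)) ! e 0)"
    using assms(1) by (simp add: tcw_def)
  from tc_subst[OF this, of "case_nat (\<lambda>w e. e 0) (\<lambda>i w e. A i w (\<lambda>i. e (Suc i)))"]
  have "tcb (\<lambda>w e. e 0 < length (F w (\<lambda>i. A i w (\<lambda>i. e (Suc i)))) \<and> F w (\<lambda>i. A i w (\<lambda>i. e (Suc i))) ! e 0)"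
    using assms(2) by (simp add: tc_var tc_shift split: nat.split)
  moreover have "tc (\<lambda>w e. length (F w (\<lambda>i. A i w e)))"
    using tc_subst[OF tcw_length[OF assms(1)] assms(2)] .
  ultimately show ?thesis by (simp add: tcw_def)
qed

lemma tcw_shift: "tcw F \<Longrightarrow> tcw (\<lambda>w e. F w (\<lambda>i. e (Suc i)))"
  by (rule tcw_subst[of F "\<lambda>i w e. e (Suc i)"]) (auto intro: tc_var)

lemma tcw_Nil: "tcw (\<lambda>w e. [])"
  by (simp add: tcw_def tc_const tc_const[of 0, simplified])

lemma tcw_single: "tcb P \<Longrightarrow> tcw (\<lambda>w e. [P w e])"
proof -
  assume P: "tcb P"
  have "tcb (\<lambda>w e. e 0 = 0 \<and> P w (\<lambda>i. e (Suc i)))"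
    by (intro tc_intros tc_shift[OF P])
  moreover have "(i < length [p] \<and> [p] ! i) = (i = 0 \<and> p)" for i and p :: bool by auto
  ultimately show ?thesis by (simp add: tcw_def tc_const)
qed

lemma tcw_append:
  assumes "tcw F" "tcw G"
  shows "tcw (\<lambda>w e. F w e @ G w e)"
proof -
  let ?F = "\<lambda>w e. F w (\<lambda>i. e (Suc i))" and ?G = "\<lambda>w e. G w (\<lambda>i. e (Suc i))"
  have "tcb (\<lambda>w e. e 0 < length (?F w e) \<and> ?F w e ! e 0 \<or>
      length (?F w e) \<le> e 0 \<and> e 0 - length (?F w e) < length (?G w e) \<and> ?G w e ! (e 0 - length (?F w e)))"
    using assms by (intro tcb_disj tcb_conj[OF tcb_le] tcw_nth tcw_shift tc_var tc_diff tcw_length)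
  moreover have "(i < length xs \<and> xs ! i \<or> length xs \<le> i \<and> i - length xs < length ys \<and> ys ! (i - length xs))
      = (i < length (xs @ ys) \<and> (xs @ ys) ! i)" for i and xs ys :: "bool list"
    by (auto simp: nth_append)
  ultimately show ?thesis using assms by (simp add: tcw_def tc_add)
qed

lemma tcw_Cons: "tcb P \<Longrightarrow> tcw F \<Longrightarrow> tcw (\<lambda>w e. P w e # F w e)"
  using tcw_append[OF tcw_single, of P F] by simp

lemma tcw_if:
  assumes "tcb P" "tcw F" "tcw G"
  shows "tcw (\<lambda>w e. if P w e then F w e else G w e)"
proof -
  let ?F = "\<lambda>w e. F w (\<lambda>i. e (Suc i))" and ?G = "\<lambda>w e. G w (\<lambda>i. e (Suc i))"
  have "tcb (\<lambda>w e. if P w (\<lambda>i. e (Suc i)) then e 0 < length (?F w e) \<and> ?F w e ! e 0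
      else e 0 < length (?G w e) \<and> ?G w e ! e 0)"
    using assms by (intro tcb_if tcw_nth tcw_shift tc_var tc_shift[OF assms(1)])
  moreover have "(if p then i < length xs \<and> xs ! i else i < length ys \<and> ys ! i)
      = (i < length (if p then xs else ys) \<and> (if p then xs else ys) ! i)" for p i and xs ys :: "bool list"
    by auto
  moreover have "tc (\<lambda>w e. length (if P w e then F w e else G w e))"
    using tc_if[OF assms(1) tcw_length tcw_length, OF assms(2,3)] by (simp add: if_distrib)
  ultimately show ?thesis by (simp only: tcw_def)
qed

text \<open>The block containing position \<open>i\<close> is located by prefix sums of block
  lengths. Bounded search and bounded sums are what terms can express, so this form carries over to
  tame words.\<close>

lemma concat_nth_iff:
  "i < length (concat xss) \<and> concat xss ! i \<longleftrightarrow>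
     (\<exists>j<length xss. (\<Sum>k<j. length (xss ! k)) \<le> i \<and>
        i - (\<Sum>k<j. length (xss ! k)) < length (xss ! j) \<and> xss ! j ! (i - (\<Sum>k<j. length (xss ! k))))"
  (is "_ \<longleftrightarrow> ?R xss i")
proof (induction xss arbitrary: i)
  case (Cons xs xss)
  have "?R (xs # xss) i \<longleftrightarrow> i < length xs \<and> xs ! i \<or> (length xs \<le> i \<and> ?R xss (i - length xs))"
    (is "_ \<longleftrightarrow> ?A \<or> ?B")
  proof
    assume "?R (xs # xss) i"
    then obtain j where j: "j < Suc (length xss)" "(\<Sum>k<j. length ((xs # xss) ! k)) \<le> i"
      "i - (\<Sum>k<j. length ((xs # xss) ! k)) < length ((xs # xss) ! j)"
      "(xs # xss) ! j ! (i - (\<Sum>k<j. length ((xs # xss) ! k)))" by auto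
    show "?A \<or> ?B"
    proof (cases j)
      case (Suc m)
      have "(\<Sum>k<j. length ((xs # xss) ! k)) = length xs + (\<Sum>k<m. length (xss ! k))"
        unfolding Suc sum.lessThan_Suc_shift by simp
      then show ?thesis using j Suc by (auto intro!: exI[of _ m])
    qed (use j in simp)
  next
    assume "?A \<or> ?B"
    then show "?R (xs # xss) i"
    proof
      assume ?B
      then obtain j where j: "j < length xss" "(\<Sum>k<j. length (xss ! k)) \<le> i - length xs"
        "i - length xs - (\<Sum>k<j. length (xss ! k)) < length (xss ! j)"
        "xss ! j ! (i - length xs - (\<Sum>k<j. length (xss ! k)))" "length xs \<le> i" by auto
      have "(\<Sum>k<Suc j. length ((xs # xss) ! k)) = length xs + (\<Sum>k<j. length (xss ! k))"
        unfolding sum.lessThan_Suc_shift by simp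
      then show ?thesis using j by (auto intro!: exI[of _ "Suc j"])
    qed (auto intro!: exI[of _ 0])
  qed
  then show ?case using Cons.IH[of "i - length xs"] by (auto simp: nth_append)
qed simp

lemma tcw_concat:
  assumes "tc A" "tcw (\<lambda>w e. F w (e 0) (\<lambda>i. e (Suc i)))"
  shows "tcw (\<lambda>w e. concat (map (\<lambda>i. F w i e) [0..<A w e]))"
proof -
  \<comment> \<open>The body is needed at arbitrary indices and environments, because the prefix
    sums evaluate it under a further binder.\<close>
  have at: "tcw (\<lambda>w e. F w (I w e) (\<lambda>i. J i w e))" if "tc I" "\<And>i. tc (J i)" for I J
    using tcw_subst[OF assms(2), of "case_nat I J"] that by (simp split: nat.split)
  define L where "L w j e = (\<Sum>k<j. length (F w k e))" for w j e
  have L: "tc (\<lambda>w e. L w (e 0) (\<lambda>i. e (Suc (Suc i))))"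
    unfolding L_def by (intro tc_sum tc_var tcw_length at)
  have "tcb (\<lambda>w e. \<exists>j<A w (\<lambda>i. e (Suc i)). L w j (\<lambda>i. e (Suc i)) \<le> e 0 \<and>
      e 0 - L w j (\<lambda>i. e (Suc i)) < length (F w j (\<lambda>i. e (Suc i))) \<and>
      F w j (\<lambda>i. e (Suc i)) ! (e 0 - L w j (\<lambda>i. e (Suc i))))"
    using assms(1) L by (intro tcb_ex tcb_conj[OF tcb_le] tc_shift[of A] tcw_nth at tc_var tc_diff)
  moreover have "(i < length (concat (map (\<lambda>i. F w i e) [0..<n])) \<and> concat (map (\<lambda>i. F w i e) [0..<n]) ! i)
      = (\<exists>j<n. L w j e \<le> i \<and> i - L w j e < length (F w j e) \<and> F w j e ! (i - L w j e))" for i n w e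
    unfolding concat_nth_iff by (auto simp: L_def)
  moreover have "tc (\<lambda>w e. length (concat (map (\<lambda>i. F w i e) [0..<A w e])))"
  proof -
    have "length (concat (map f [0..<n])) = (\<Sum>i<n. length (f i))" for f :: "nat \<Rightarrow> bool list" and n
      by (simp add: length_concat o_def sum_list_map_eq_sum_count2 interv_sum_list_conv_sum_set_nat lessThan_atLeast0)
    moreover have "tc (\<lambda>w e. \<Sum>i<A w e. length (F w i e))"
      using assms by (intro tc_sum tcw_length)
    ultimately show ?thesis by simp
  qed
  ultimately show ?thesis by (simp only: tcw_def)
qed

lemma tcw_map:
  assumes "tc A" "tcb (\<lambda>w e. P w (e 0) (\<lambda>i. e (Suc i)))"
  shows "tcw (\<lambda>w e. map (\<lambda>i. P w i e) [0..<A w e])"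
proof -
  have "tcw (\<lambda>w e. concat (map (\<lambda>i. [P w i e]) [0..<A w e]))"
    using assms by (intro tcw_concat tcw_single)
  moreover have "concat (map (\<lambda>i. [f i]) xs) = map f xs" for f :: "nat \<Rightarrow> bool" and xs
    by (induction xs) auto
  ultimately show ?thesis by simp
qed

lemma tcw_eq:
  assumes "tcw F" "tcw G"
  shows "tcb (\<lambda>w e. F w e = G w e)"
proof -
  let ?F = "\<lambda>w e. F w (\<lambda>i. e (Suc i))" and ?G = "\<lambda>w e. G w (\<lambda>i. e (Suc i))"
  have "tcb (\<lambda>w e. length (F w e) = length (G w e) \<and>
      (\<forall>i<length (F w e). (i < length (F w e) \<and> F w e ! i) = (i < length (G w e) \<and> G w e ! i)))"
    using assms by (intro tcb_conj tcb_eq tcb_all tcb_iff tcw_nth tcw_shift tc_var tcw_length)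
  moreover have "(xs = ys) = (length xs = length ys \<and>
      (\<forall>i<length xs. (i < length xs \<and> xs ! i) = (i < length ys \<and> ys ! i)))" for xs ys :: "bool list"
    by (auto simp: list_eq_iff_nth_eq)
  ultimately show ?thesis by simp
qed

lemmas tcw_intros = tcw_Nil tcw_Cons tcw_append tcw_if tcw_concat tcw_map

lemma poly_time_computable_tcw:
  assumes "tcw F"
  shows "poly_time_computable (\<lambda>x. F (map bit_sym x) (\<lambda>_. 0))"
proof -
  obtain l where l: "\<And>w e. ev w e l = length (F w e)"
    using tcw_length[OF assms] unfolding tc_def by blast
  obtain b where b: "\<And>w e. ev w e b = of_bool (e 0 < length (F w (\<lambda>i. e (Suc i))) \<and> F w (\<lambda>i. e (Suc i)) ! e 0)"
    using assms unfolding tcw_def tc_def by blast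
  obtain M T where M: "turing_machine M" and run: "\<And>w n. blank \<notin> set w \<Longrightarrow> poly T (length w) \<le> n \<Longrightarrow>
      halted M (run M w n) \<and> (fst (run M w n) = accept M \<longleftrightarrow> ev w (\<lambda>_. 0) l \<noteq> 0) \<and>
      holds_word (last (snd (run M w n)))
        (map bit_sym (map (\<lambda>i. ev w (case_nat i (\<lambda>_. 0)) b \<noteq> 0) [0..<ev w (\<lambda>_. 0) l]))"
    using that by (rule term_machine)
  have "map (\<lambda>i. ev w (case_nat i (\<lambda>_. 0)) b \<noteq> 0) [0..<ev w (\<lambda>_. 0) l] = F w (\<lambda>_. 0)" for w
    by (rule nth_equalityI) (simp_all add: l b)
  moreover have "blank \<notin> set (map bit_sym x)" for x
  proof -
    have "bit_sym a \<noteq> blank" for a by (cases a) (auto simp: blank_def)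
    then have "blank \<notin> bit_sym ` A" for A by (metis imageE)
    then show ?thesis by simp
  qed
  ultimately have "halted M (run M (map bit_sym x) (poly T (length x))) \<and>
      holds_word (last (snd (run M (map bit_sym x) (poly T (length x))))) (map bit_sym (F (map bit_sym x) (\<lambda>_. 0)))" for x
    using run[of "map bit_sym x" "poly T (length x)"] by simp
  then show ?thesis
    unfolding poly_time_computable_def Let_def using M by blast
qed

lemma NP_tcb:
  fixes P :: "symbol list \<Rightarrow> bool" and p :: "nat poly"
  assumes P: "tcb (\<lambda>w e. P w)"
    and L: "\<And>x. x \<in> L \<longleftrightarrow> (\<exists>u. length u \<le> poly p (length x) \<and> P (pair_word x u))"
  shows "L \<in> NP"
proof -
  obtain t where t: "\<And>w e. ev w e t = of_bool (P w)" using P unfolding tc_def by blast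
  obtain M T where M: "turing_machine M"
    and run: "\<And>w n. blank \<notin> set w \<Longrightarrow> poly T (length w) \<le> n \<Longrightarrow>
      halted M (run M w n) \<and> (fst (run M w n) = accept M \<longleftrightarrow> ev w (\<lambda>_. 0) t \<noteq> 0) \<and>
      holds_word (last (snd (run M w n)))
        (map bit_sym (map (\<lambda>i. ev w (case_nat i (\<lambda>_. 0)) t \<noteq> 0) [0..<ev w (\<lambda>_. 0) t]))"
    using that by (rule term_machine)
  have nb: "blank \<notin> set (pair_word x u)" for x u
  proof -
    have "bit_sym a \<noteq> blank" for a by (cases a) (auto simp: blank_def)
    then have "blank \<notin> bit_sym ` A" for A by (metis imageE)
    then show ?thesis by (simp add: pair_word_def sep_sym_def blank_def)
  qed
  \<comment> \<open>The delimiter makes the pair word one letter longer than \<open>x\<close> and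
    \<open>u\<close> together, hence the composition with \<open>[:1, 1:]\<close>.\<close>
  have "halted M (run M (pair_word x u) (poly (pcompose T [:1, 1:]) (length x + length u)))" for x u
    using run[OF nb] by (simp add: poly_pcompose pair_word_def)
  moreover have "accepts M (pair_word x u) \<longleftrightarrow> P (pair_word x u)" for x u
    using accepts_iff_halted[of M "pair_word x u"] run[OF nb order_refl, of x u] unfolding t by auto
  ultimately show ?thesis
    unfolding NP_def using M L by blast
qed

section \<open>Encoding numbers and instances\<close>

definition val :: "nat \<Rightarrow> (nat \<Rightarrow> bool) \<Rightarrow> nat" where
  "val B f = (\<Sum>k<B. of_bool (f k) * 2 ^ k)"

text \<open>The position of the highest set digit plus one (0 if there is none), written as a sum of
  indicators so that it is tame.\<close>

definition nbits :: "nat \<Rightarrow> (nat \<Rightarrow> bool) \<Rightarrow> nat" where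
  "nbits B f = (\<Sum>k<B. of_bool (\<exists>j<B. k \<le> j \<and> f j))"

lemma val_Suc: "val (Suc B) f = of_bool (f 0) + 2 * val B (\<lambda>k. f (Suc k))"
  unfolding val_def sum.lessThan_Suc_shift by (simp add: sum_distrib_left mult_ac del: sum_of_bool_mult_eq sum_mult_of_bool_eq)

lemma ex_less_Suc_shift: "(\<exists>j<Suc B. P j) \<longleftrightarrow> P 0 \<or> (\<exists>j<B. P (Suc j))"
  by (metis less_Suc_eq_0_disj)

lemma nbits_Suc: "nbits (Suc B) f = of_bool (\<exists>j<Suc B. f j) + nbits B (\<lambda>k. f (Suc k))"
  unfolding nbits_def sum.lessThan_Suc_shift by (simp add: ex_less_Suc_shift)

lemma nbits_0: "(\<And>j. j < B \<Longrightarrow> \<not> f j) \<Longrightarrow> nbits B f = 0"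
  by (auto simp: nbits_def)

lemma val_pos_iff: "0 < val B f \<longleftrightarrow> (\<exists>j<B. f j)"
  unfolding val_def zero_less_iff_neq_zero by (subst sum_eq_0_iff) auto

text \<open>Halving the value shifts the digit function, so both sides lose their first element
  together; \<open>nbits\<close> stops before the leading zeros that \<open>binary\<close>
  omits.\<close>

lemma binary_val: "binary (val B f) = map f [0..<nbits B f]"
proof (induction B arbitrary: f)
  case 0
  then show ?case by (simp add: val_def nbits_def binary.simps)
next
  case (Suc B)
  show ?case
  proof (cases "\<exists>j<Suc B. f j")
    case True
    then have "val (Suc B) f \<noteq> 0" using val_pos_iff[of "Suc B" f] by simp
    then have "binary (val (Suc B) f) = f 0 # binary (val B (\<lambda>k. f (Suc k)))"
      unfolding binary.simps[of "val (Suc B) f"] by (simp add: val_Suc)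
    with True Suc show ?thesis
      by (simp add: nbits_Suc upt_conv_Cons map_Suc_upt[symmetric] o_def del: upt_Suc)
  next
    case False
    then have "val (Suc B) f = 0" using val_pos_iff[of "Suc B" f] by blast
    with False show ?thesis by (simp add: nbits_0 binary.simps)
  qed
qed

lemma val_bits: "n < 2 ^ B \<Longrightarrow> val B (\<lambda>k. odd (n div 2 ^ k)) = n"
proof (induction B arbitrary: n)
  case (Suc B)
  have "val B (\<lambda>k. odd (n div 2 ^ Suc k)) = n div 2"
    using Suc.IH[of "n div 2"] Suc.prems by (simp add: div_mult2_eq)
  then show ?case by (simp add: val_Suc)
qed (simp add: val_def)

text \<open>The value may be exponential and is never computed. Its code is written digit by digit,
  and only the number of significant digits occurs as a number.\<close>

lemma tcw_encode_val:
  assumes "tc B" "tcb (\<lambda>w e. f w (e 0) (\<lambda>i. e (Suc i)))"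
  shows "tcw (\<lambda>w e. encode_nat (val (B w e) (\<lambda>k. f w k e)))"
proof -
  have f': "tcb (\<lambda>w e. f w (I w e) (\<lambda>i. J i w e))" if "tc I" "\<And>i. tc (J i)" for I J
    using tc_subst[OF assms(2), of "case_nat I J"] that by (simp split: nat.split)
  have "tc (\<lambda>w e. nbits (B w e) (\<lambda>k. f w k e))"
    unfolding nbits_def by (intro tc_sum tcb_ex tcb_conj tcb_le tc_var assms(1) tc_shift[OF assms(1)] f')
  then have "tcw (\<lambda>w e. concat (map (\<lambda>k. [True, f w k e]) [0..<nbits (B w e) (\<lambda>k. f w k e)]) @ [False])"
    by (intro tcw_intros tc_const assms(2))
  moreover have "encode_nat (val b g) = concat (map (\<lambda>k. [True, g k]) [0..<nbits b g]) @ [False]" for b g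
    by (simp add: encode_nat_def binary_val o_def)
  ultimately show ?thesis by simp
qed

lemma tcw_encode_nat:
  assumes "tc A"
  shows "tcw (\<lambda>w e. encode_nat (A w e))"
proof -
  \<comment> \<open>\<open>A w e\<close> digits suffice because \<open>a < 2 ^ a\<close>; such a
    generous width is affordable when the value itself is tame.\<close>
  have "tcw (\<lambda>w e. encode_nat (val (A w e) (\<lambda>k. odd (A w e div 2 ^ k))))"
    by (intro tcw_encode_val assms tcb_bit tc_shift[OF assms] tc_var)
  then show ?thesis by (simp add: val_bits)
qed

lemma tcw_encode_instance:
  assumes n: "tc (\<lambda>w e. n w)"
    and E: "tcb (\<lambda>w e. E w (e 0) (e 1))"
    and w: "tcw (\<lambda>w e. encode_nat (wt w (e 0) (e 1)))"
    and d: "tcw (\<lambda>w e. encode_nat (ds w (e 0) (e 1)))"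
    and \<beta>: "tcw (\<lambda>w e. encode_nat (\<beta> w))"
    and \<gamma>: "tcw (\<lambda>w e. encode_nat (\<gamma> w))"
  shows "tcw (\<lambda>w e. encode_instance (n w) {(i, j). i < n w \<and> j < n w \<and> E w i j}
    (\<lambda>(i, j). wt w i j) (\<lambda>(i, j). ds w i j) (\<beta> w) (\<gamma> w))"
proof -
  \<comment> \<open>Inside the two nested \<open>concat\<close>s the column is variable 0 and the
    row variable 1, the reverse of the order in the assumptions.\<close>
  have ij: "tcw (\<lambda>w e. F w (e 1) (e 0))" if "tcw (\<lambda>w e. F w (e 0) (e 1))" for F
    using tcw_subst[OF that, of "case_nat (\<lambda>w e. e 1) (\<lambda>_ w e. e 0)"] by (simp add: tc_var split: nat.split)
  have E': "tcb (\<lambda>w e. E w (e 1) (e 0))"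
    by (rule tc_app2[OF E tc_var tc_var])
  have "tcw (\<lambda>w e. map (\<lambda>i. True) [0..<n w] @ [False] @
    concat (map (\<lambda>i. concat (map (\<lambda>j.
      if E w i j then True # encode_nat (wt w i j) @ encode_nat (ds w i j) else [False])
      [0..<n w])) [0..<n w]) @ encode_nat (\<beta> w) @ encode_nat (\<gamma> w))"
    using ij[OF w] ij[OF d] E' by (intro tcw_intros tc_const n \<beta> \<gamma>) simp_all
  moreover have "encode_instance n {(i, j). i < n \<and> j < n \<and> E i j} (\<lambda>(i, j). wt i j) (\<lambda>(i, j). ds i j) \<beta> \<gamma>
     = map (\<lambda>i. True) [0..<n] @ [False] @
    concat (map (\<lambda>i. concat (map (\<lambda>j. if E i j then True # encode_nat (wt i j) @ encode_nat (ds i j) else [False])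
      [0..<n])) [0..<n]) @ encode_nat \<beta> @ encode_nat \<gamma>" for n E wt ds \<beta> \<gamma>
  proof -
    have "concat (map g (List.product xs ys)) = concat (map (\<lambda>i. concat (map (\<lambda>j. g (i, j)) ys)) xs)"
      for g :: "nat \<times> nat \<Rightarrow> bool list" and xs ys
      by (induction xs) (simp_all add: o_def)
    then show ?thesis
      by (auto simp: encode_instance_def encode_entry_def map_replicate_const intro!: arg_cong[where f = concat])
  qed
  ultimately show ?thesis by simp
qed

section \<open>Distances and budget inequalities\<close>

text \<open>A nonempty set of extended naturals contains its infimum, so a finite bound is witnessed
  by an actual path; the empty set has infimum infinity.\<close>

lemma graph_dist_le_iff:
  "graph_dist V E d u v \<le> enat m \<longleftrightarrow> (\<exists>p. dipath V E u v p \<and> path_length d p \<le> m)"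
proof
  assume le: "graph_dist V E d u v \<le> enat m"
  let ?A = "(\<lambda>p. enat (path_length d p)) ` {p. dipath V E u v p}"
  have "?A \<noteq> {}"
  proof
    assume "?A = {}"
    then have "{p. dipath V E u v p} = {}" by blast
    then have "graph_dist V E d u v = \<infinity>" unfolding graph_dist_def by (simp only: image_empty Inf_empty top_enat_def)
    with le show False by simp
  qed
  then have "Inf ?A \<in> ?A" by (metis (lifting) LeastI ex_in_conv Inf_enat_def)
  then show "\<exists>p. dipath V E u v p \<and> path_length d p \<le> m"
    using le unfolding graph_dist_def by auto
next
  assume "\<exists>p. dipath V E u v p \<and> path_length d p \<le> m"
  then obtain p where p: "dipath V E u v p" "path_length d p \<le> m" by blast
  have "graph_dist V E d u v \<le> enat (path_length d p)"
    unfolding graph_dist_def using p(1) by (intro INF_lower) simp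
  with p(2) show "graph_dist V E d u v \<le> enat m" by (meson enat_ord_simps(1) order_trans)
qed

lemma path_length_simps [simp]:
  "path_length d [x] = 0"
  "path_length d (x # y # p) = d (x, y) + path_length d (y # p)"
  by (simp_all add: path_length_def)

lemma path_length_append:
  "path_length d (xs @ y # zs) = path_length d (xs @ [y]) + path_length d (y # zs)"
proof (induction xs)
  case (Cons x xs)
  then show ?case by (cases xs) simp_all
qed simp

lemma path_length_snoc: "p \<noteq> [] \<Longrightarrow> path_length d (p @ [x]) = path_length d p + d (last p, x)"
  by (cases p rule: rev_cases) (simp_all add: path_length_append[of d _ _ "[x]"])

lemma graph_dist_refl: "u \<in> V \<Longrightarrow> graph_dist V E d u u \<le> enat 0"
  unfolding graph_dist_le_iff by (rule exI[of _ "[u]"]) (simp add: dipath_def)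

lemma graph_dist_step:
  assumes "graph_dist V E d u v \<le> enat m" "(v, x) \<in> E" "x \<in> V"
  shows "graph_dist V E d u x \<le> enat (m + d (v, x))"
proof -
  obtain p where p: "dipath V E u v p" "path_length d p \<le> m"
    using assms(1) unfolding graph_dist_le_iff by blast
  then have "dipath V E u x (p @ [x])" "path_length d (p @ [x]) \<le> m + d (v, x)"
    using assms(2,3) by (auto simp: dipath_def successively_append_iff path_length_snoc)
  then show ?thesis unfolding graph_dist_le_iff by blast
qed

text \<open>Cutting out the segment between two visits of a vertex cannot lengthen a path, as
  lengths are natural numbers.\<close>

lemma dipath_distinct:
  assumes "dipath V E u v p"
  shows "\<exists>q. dipath V E u v q \<and> distinct q \<and> path_length d q \<le> path_length d p"
  using assms
proof (induction "length p" arbitrary: p rule: less_induct)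
  case less
  show ?case
  proof (cases "distinct p")
    case False
    then obtain xs ys zs y where p: "p = xs @ [y] @ ys @ [y] @ zs"
      using not_distinct_decomp by blast
    have "dipath V E u v (xs @ y # zs)"
      using less.prems unfolding p dipath_def
      by (cases xs; cases zs rule: rev_cases) (auto simp: successively_append_iff successively_Cons hd_append split: if_splits)
    moreover have "path_length d (xs @ y # zs) \<le> path_length d p"
      unfolding p using path_length_append[of d xs y zs] path_length_append[of d xs y "ys @ y # zs"]
        path_length_append[of d "y # ys" y zs] by simp
    moreover have "length (xs @ y # zs) < length p" by (simp add: p)
    ultimately show ?thesis using less.hyps[of "xs @ y # zs"] by (meson le_trans)
  qed (use less.prems in blast)
qed

lemma path_length_nth: "path_length d p = (\<Sum>s<length p - 1. d (p ! s, p ! Suc s))"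
proof (induction p rule: induct_list012)
  case (3 x y zs)
  then show ?case by (simp add: sum.lessThan_Suc_shift del: sum.lessThan_Suc)
qed (simp_all add: path_length_def)

lemma sum_enat: "(\<Sum>x\<in>A. enat (f x)) = enat (\<Sum>x\<in>A. f x)"
  by (metis (mono_tags, lifting) of_nat_eq_enat of_nat_sum sum.cong)

lemma routing_cost_le:
  assumes "\<And>u v. u \<in> V \<Longrightarrow> v \<in> V \<Longrightarrow> graph_dist V E d u v \<le> enat (c u v)"
  shows "routing_cost V E d \<le> enat (\<Sum>u\<in>V. \<Sum>v\<in>V. c u v)"
  unfolding routing_cost_def sum_enat[symmetric] by (intro sum_mono assms)

text \<open>A finite total forces each of its nonnegative terms to be finite, which moves the budget
  inequality from \<open>enat\<close> to \<open>nat\<close>.\<close>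

lemma routing_cost_le_D:
  assumes "finite V" "routing_cost V E d \<le> enat g"
  obtains c where "\<And>u v. u \<in> V \<Longrightarrow> v \<in> V \<Longrightarrow> graph_dist V E d u v = enat (c u v)"
    and "(\<Sum>u\<in>V. \<Sum>v\<in>V. c u v) \<le> g"
proof -
  have fin: "graph_dist V E d u v \<noteq> \<infinity>" if "u \<in> V" "v \<in> V" for u v
  proof
    assume inf: "graph_dist V E d u v = \<infinity>"
    have "graph_dist V E d u v \<le> (\<Sum>v\<in>V. graph_dist V E d u v)"
      using assms(1) that by (intro member_le_sum) auto
    also have "\<dots> \<le> routing_cost V E d"
      unfolding routing_cost_def using assms(1) that by (intro member_le_sum) auto
    finally show False using inf assms(2) by auto
  qed
  define c where "c u v = the_enat (graph_dist V E d u v)" for u v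
  have c: "graph_dist V E d u v = enat (c u v)" if "u \<in> V" "v \<in> V" for u v
    using fin[OF that] by (auto simp: c_def)
  then have "routing_cost V E d = enat (\<Sum>u\<in>V. \<Sum>v\<in>V. c u v)"
    unfolding routing_cost_def sum_enat[symmetric] by (intro sum.cong refl)
  then show ?thesis using that[of c] c assms(2) by simp
qed

section \<open>Comparing sums of binary numbers by columns\<close>

text \<open>The inequality \<open>\<Sum>k<b. col k * 2 ^ k \<le> val b g\<close> is certified by small numbers \<open>S k\<close>: the surplus of
  the right over the left side, when only the binary digits from position \<open>k\<close> on are taken into
  account, truncated to a bound \<open>M\<close> on the columns.\<close>

definition slack_ok :: "nat \<Rightarrow> (nat \<Rightarrow> nat) \<Rightarrow> (nat \<Rightarrow> nat) \<Rightarrow> (nat \<Rightarrow> bool) \<Rightarrow> bool" where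
  "slack_ok b S col g \<longleftrightarrow> (\<forall>k<b. S k + col k \<le> 2 * S (Suc k) + of_bool (g k))"

text \<open>Multiplying the condition at position \<open>k\<close> by \<open>2 ^ k\<close> makes the
  surpluses telescope, and the topmost one vanishes.\<close>

lemma slack_sound:
  assumes "slack_ok b S col g" "S b = 0"
  shows "(\<Sum>k<b. col k * 2 ^ k) \<le> val b g"
proof -
  have "m \<le> b \<Longrightarrow> (\<Sum>k<m. col k * 2 ^ k) + S 0 \<le> val m g + 2 ^ m * S m" for m
  proof (induction m)
    case (Suc m)
    have "2 ^ m * (S m + col m) \<le> 2 ^ m * (2 * S (Suc m) + of_bool (g m))"
      using assms(1) Suc.prems unfolding slack_ok_def by (intro mult_left_mono) auto
    with Suc show ?case by (simp add: val_def algebra_simps del: sum_of_bool_mult_eq sum_mult_of_bool_eq)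
  qed (simp add: val_def)
  from this[of b] assms(2) show ?thesis by simp
qed

text \<open>The exact surpluses, computed from the top digit downwards, satisfy the recurrence with
  equality but may be exponential. Capping them at \<open>M\<close> is harmless: once the cap is
  reached, \<open>2 * M\<close> pays for both \<open>S k\<close> and \<open>col k\<close>.\<close>

lemma slack_complete:
  assumes "(\<Sum>k<b. col k * 2 ^ k) \<le> val b g" "\<And>k. col k \<le> M"
  shows "\<exists>S. slack_ok b S col g \<and> (\<forall>k. S k \<le> M) \<and> S b = 0"
proof -
  define t where "t k = int (of_bool (g k)) - int (col k)" for k
  define D where "D = rec_nat 0 (\<lambda>j r. 2 * r + t (b - Suc j))"
  have D_Suc: "D (Suc j) = 2 * D j + t (b - Suc j)" for j by (simp add: D_def)
  have D_0: "D 0 = 0" by (simp add: D_def)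
  have D_sum: "j \<le> b \<Longrightarrow> 2 ^ (b - j) * D j = (\<Sum>k=b-j..<b. 2 ^ k * t k)" for j
  proof (induction j)
    case (Suc j)
    have "b - j = Suc (b - Suc j)" using Suc.prems by simp
    then have "2 ^ (b - Suc j) * D (Suc j) = 2 ^ (b - j) * D j + 2 ^ (b - Suc j) * t (b - Suc j)"
      by (simp add: D_Suc algebra_simps)
    also have "\<dots> = (\<Sum>k=b-j..<b. 2 ^ k * t k) + 2 ^ (b - Suc j) * t (b - Suc j)" using Suc by simp
    also have "\<dots> = (\<Sum>k=b-Suc j..<b. 2 ^ k * t k)"
      using \<open>b - j = Suc (b - Suc j)\<close> Suc.prems
      by (subst (2) sum.atLeast_Suc_lessThan) auto
    finally show ?case .
  qed (simp add: D_0)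
  have "D b = int (val b g) - int (\<Sum>k<b. col k * 2 ^ k)"
    using D_sum[of b] by (simp add: t_def val_def atLeast0LessThan sum_subtractf algebra_simps
        del: sum_of_bool_mult_eq sum_mult_of_bool_eq)
  moreover have "int (\<Sum>k<b. col k * 2 ^ k) \<le> int (val b g)" using assms(1) by (simp only: of_nat_le_iff)
  ultimately have "0 \<le> D b" by linarith
  \<comment> \<open>A negative surplus is doubled and then gains at most 1 from the next digit, so
    it never recovers. As the final one is nonnegative, all are.\<close>
  have neg: "D j < 0 \<Longrightarrow> D (j + i) < 0" for i j
    by (induction i) (auto simp: D_Suc t_def of_bool_def)
  have nonneg: "0 \<le> D j" if "j \<le> b" for j
    using neg[of j "b - j"] \<open>0 \<le> D b\<close> that by force
  define S where "S k = min M (nat (D (b - k)))" for k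
  have "S k + col k \<le> 2 * S (Suc k) + of_bool (g k)" if k: "k < b" for k
  proof -
    have "b - k = Suc (b - Suc k)" using k by simp
    then have "D (b - k) = 2 * D (b - Suc k) + t k" using D_Suc[of "b - Suc k"] k by simp
    moreover have "0 \<le> D (b - Suc k)" "0 \<le> D (b - k)" using nonneg k by simp_all
    ultimately have "nat (D (b - k)) + col k = 2 * nat (D (b - Suc k)) + of_bool (g k)"
      unfolding t_def by (cases "g k") simp_all
    then show ?thesis using assms(2)[of k] unfolding S_def by (cases "g k") (auto simp: min_def)
  qed
  moreover have "S b = 0" by (simp add: S_def D_0)
  ultimately show ?thesis by (intro exI[of _ S]) (auto simp: slack_ok_def S_def)
qed

lemma sum_val: "finite A \<Longrightarrow> (\<Sum>x\<in>A. val b (f x)) = (\<Sum>k<b. (\<Sum>x\<in>A. of_bool (f x k)) * 2 ^ k)"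
  unfolding val_def sum_distrib_right by (rule sum.swap)

text \<open>Applied twice, this evaluates a unary number that the certificate spreads over three
  indices.\<close>

lemma sum_digits: "(\<Sum>p<a. \<Sum>q<b. g (p * b + q)) = (\<Sum>i<a * b. g i)" for a b :: nat
proof -
  have "(\<Sum>q<b. g (p * b + q)) = sum g {p * b..<p * b + b}" for p
    using sum.shift_bounds_nat_ivl[of g 0 "p * b" b] by (simp add: atLeast0LessThan add.commute)
  then show ?thesis using sum.nat_group[of g b a] by simp
qed

lemma sum_of_bool_less: "m \<le> n \<Longrightarrow> (\<Sum>i<n. of_bool (i < m)) = (m :: nat)"
proof -
  assume "m \<le> n"
  then have "{..<n} \<inter> {i. i < m} = {..<m}" by auto
  then show ?thesis by simp
qed

lemma less_two_power_length_binary: "m < 2 ^ length (binary m)"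
proof (induction m rule: less_induct)
  case (less m)
  show ?case
  proof (cases "m = 0")
    case False
    then have "length (binary m) = Suc (length (binary (m div 2)))" by (simp add: binary.simps[of m])
    then show ?thesis using less[of "m div 2"] False by simp
  qed (simp add: binary.simps)
qed

lemma length_binary_le: "length (binary m) \<le> length (encode_nat m)"
  by (simp add: encode_nat_def length_concat o_def sum_list_triv)

lemma less_two_power: "length (encode_nat m) \<le> b \<Longrightarrow> m < 2 ^ b"
  using less_two_power_length_binary[of m] length_binary_le[of m]
  by (meson le_trans one_le_numeral order_less_le_trans power_increasing)

lemma length_concat_ge: "xs \<in> set xss \<Longrightarrow> length xs \<le> length (concat xss)"
  by (induction xss) auto

section \<open>Certificates\<close>

text \<open>A certificate is a family of tables \<open>C kind\<close> with at most four indices: 0 marks vertex \<open>a\<close> as a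
  possible \<open>s\<close>-th vertex of the chosen walk from \<open>u\<close> to \<open>v\<close>; 1 the edges; 2 and 3 the binary digits of weights
  and distances; 4 and 5 those of \<open>\<beta>\<close> and \<open>\<gamma>\<close>; 6 the selected edges; 7 and 8 the slack numbers of the two
  budget inequalities, in unary; 9 the vertices.\<close>

type_synonym certificate = "nat \<Rightarrow> nat \<Rightarrow> nat \<Rightarrow> nat \<Rightarrow> nat \<Rightarrow> bool"

definition nodes :: "nat \<Rightarrow> certificate \<Rightarrow> nat" where
  "nodes b C = (\<Sum>i<b. of_bool (C 9 i 0 0 0))"

text \<open>Three indices below \<open>b\<close> allow values up to the cube of \<open>b\<close>,
  enough for a column that counts the \<open>n\<close> steps of the walks for all pairs of vertices.
  The value 0 from \<open>b\<close> on supplies the boundary condition of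
  \<open>slack_sound\<close>.\<close>

definition slack :: "nat \<Rightarrow> nat \<Rightarrow> certificate \<Rightarrow> nat \<Rightarrow> nat" where
  "slack m b C k = (if k < b then \<Sum>p<b. \<Sum>q<b. \<Sum>r<b. of_bool (C m k p q r) else 0)"

definition col_w :: "nat \<Rightarrow> certificate \<Rightarrow> nat \<Rightarrow> nat" where
  "col_w n C k = (\<Sum>i<n. \<Sum>j<n. of_bool (C 6 i j 0 0 \<and> C 2 i j k 0))"

text \<open>Every pair of distinct vertices marked at consecutive positions is charged, so the sum
  bounds the length of any walk picked from the marks, even if a position carries several.\<close>

definition col_d :: "nat \<Rightarrow> certificate \<Rightarrow> nat \<Rightarrow> nat" where
  "col_d n C k = (\<Sum>u<n. \<Sum>v<n. \<Sum>s<n. \<Sum>a<n. \<Sum>c<n.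
     of_bool (C 0 u v s a \<and> C 0 u v (Suc s) c \<and> a \<noteq> c \<and> C 3 a c k 0))"

definition listed :: "nat \<Rightarrow> nat \<Rightarrow> certificate \<Rightarrow> bool list" where
  "listed n b C = encode_instance n {(i, j). i < n \<and> j < n \<and> C 1 i j 0 0}
     (\<lambda>(i, j). val b (\<lambda>k. C 2 i j k 0)) (\<lambda>(i, j). val b (\<lambda>k. C 3 i j k 0))
     (val b (\<lambda>k. C 4 k 0 0 0)) (val b (\<lambda>k. C 5 k 0 0 0))"

text \<open>All walks have exactly \<open>n\<close> steps, where a step may stay put; this gives the
  table a fixed layout. As any two consecutive marks must be joined, every selection of marks is a
  walk.\<close>

definition walks_ok :: "nat \<Rightarrow> certificate \<Rightarrow> bool" where
  "walks_ok n C \<longleftrightarrow> (\<forall>u<n. \<forall>v<n. C 0 u v 0 u \<and> C 0 u v n v \<and>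
     (\<forall>s<n. (\<exists>a<n. C 0 u v s a) \<and>
       (\<forall>a<n. \<forall>c<n. C 0 u v s a \<and> C 0 u v (Suc s) c \<longrightarrow> a = c \<or> C 6 a c 0 0)))"

definition check :: "bool list \<Rightarrow> nat \<Rightarrow> certificate \<Rightarrow> bool" where
  "check x b C \<longleftrightarrow> (let n = nodes b C in
     x = listed n b C \<and> (\<forall>i<n. \<forall>j<n. C 6 i j 0 0 \<longrightarrow> C 1 i j 0 0) \<and> walks_ok n C \<and>
     slack_ok b (slack 7 b C) (col_w n C) (\<lambda>k. C 4 k 0 0 0) \<and>
     slack_ok b (slack 8 b C) (col_d n C) (\<lambda>k. C 5 k 0 0 0))"

section \<open>Soundness of the check\<close>

lemma check_sound:
  assumes "check x b C"
  shows "x \<in> DiNDP"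
proof -
  define n where "n = nodes b C"
  define E where "E = {(i, j). i < n \<and> j < n \<and> C 1 i j 0 0}"
  define E' where "E' = {(i, j). i < n \<and> j < n \<and> C 6 i j 0 0}"
  define w where "w = (\<lambda>(i, j). val b (\<lambda>k. C 2 i j k 0))"
  define d where "d = (\<lambda>(i, j). val b (\<lambda>k. C 3 i j k 0))"
  let ?\<beta> = "val b (\<lambda>k. C 4 k 0 0 0)" and ?\<gamma> = "val b (\<lambda>k. C 5 k 0 0 0)"
  have x: "x = encode_instance n E w d ?\<beta> ?\<gamma>"
    and sub: "E' \<subseteq> E"
    and walks: "walks_ok n C"
    and sw: "slack_ok b (slack 7 b C) (col_w n C) (\<lambda>k. C 4 k 0 0 0)"
    and sd: "slack_ok b (slack 8 b C) (col_d n C) (\<lambda>k. C 5 k 0 0 0)"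
    using assms by (auto simp: check_def Let_def listed_def n_def E_def E'_def w_def d_def)
  have "(\<Sum>e\<in>E'. w e) = (\<Sum>i<n. \<Sum>j<n. of_bool (C 6 i j 0 0) * w (i, j))"
  proof -
    have "(\<Sum>e\<in>E'. w e) = (\<Sum>e\<in>{..<n} \<times> {..<n}. of_bool (e \<in> E') * w e)"
      by (intro sum.mono_neutral_cong_left) (auto simp: E'_def)
    also have "\<dots> = (\<Sum>i<n. \<Sum>j<n. of_bool ((i, j) \<in> E') * w (i, j))"
      by (simp only: sum.cartesian_product split_def prod.collapse)
    finally show ?thesis by (simp add: E'_def del: sum_of_bool_mult_eq sum_mult_of_bool_eq)
  qed
  also have "\<dots> = (\<Sum>e\<in>{..<n} \<times> {..<n}. val b (\<lambda>k. C 6 (fst e) (snd e) 0 0 \<and> C 2 (fst e) (snd e) k 0))"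
    unfolding sum.cartesian_product
    by (intro sum.cong) (auto simp: w_def val_def)
  also have "\<dots> = (\<Sum>k<b. col_w n C k * 2 ^ k)"
    by (subst sum_val) (simp_all only: col_w_def sum.cartesian_product split_def
        finite_cartesian_product finite_lessThan)
  also have "\<dots> \<le> ?\<beta>" using sw by (rule slack_sound) (simp add: slack_def)
  finally have weight: "(\<Sum>e\<in>E'. w e) \<le> ?\<beta>" .
  define cost where "cost u v = (\<Sum>s<n. \<Sum>a<n. \<Sum>c<n.
     of_bool (C 0 u v s a \<and> C 0 u v (Suc s) c \<and> a \<noteq> c) * d (a, c))" for u v
  have "graph_dist {0..<n} E' d u v \<le> enat (cost u v)" if uv: "u < n" "v < n" for u v
  proof -
    \<comment> \<open>One marked vertex per position; the ends are set explicitly because further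
      vertices may be marked there.\<close>
    define f where "f s = (if s = 0 then u else if s = n then v else SOME a. a < n \<and> C 0 u v s a)" for s
    have f: "f s < n \<and> C 0 u v s (f s)" if "s \<le> n" for s
    proof (cases "s = 0 \<or> s = n")
      case True
      then show ?thesis using walks uv by (auto simp: f_def walks_ok_def)
    next
      case False
      then have "\<exists>a. a < n \<and> C 0 u v s a" using walks uv that by (auto simp: walks_ok_def)
      from someI_ex[OF this] False show ?thesis by (simp add: f_def)
    qed
    have step: "f s = f (Suc s) \<or> (f s, f (Suc s)) \<in> E'" if "s < n" for s
      using f[of s] f[of "Suc s"] walks uv that by (auto simp: walks_ok_def E'_def)
    \<comment> \<open>Staying put costs nothing, whatever length the table gives to a loop at that
      vertex.\<close>
    define c where "c s = of_bool (f s \<noteq> f (Suc s)) * d (f s, f (Suc s))" for s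
    have "s \<le> n \<Longrightarrow> graph_dist {0..<n} E' d u (f s) \<le> enat (\<Sum>j<s. c j)" for s
    proof (induction s)
      case 0
      then show ?case using graph_dist_refl[of u "{0..<n}"] uv by (simp add: f_def)
    next
      case (Suc s)
      then have IH: "graph_dist {0..<n} E' d u (f s) \<le> enat (\<Sum>j<s. c j)" by simp
      show ?case
      proof (cases "f s = f (Suc s)")
        case True
        then show ?thesis using IH by (simp add: c_def)
      next
        case False
        then show ?thesis using graph_dist_step[OF IH, of "f (Suc s)"] step[of s] f[of "Suc s"] Suc.prems
          by (simp add: c_def)
      qed
    qed
    from this[of n] have "graph_dist {0..<n} E' d u v \<le> enat (\<Sum>j<n. c j)"
      using uv by (auto simp: f_def)
    also have "(\<Sum>j<n. c j) \<le> cost u v"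
      unfolding cost_def
    proof (intro sum_mono)
      fix s assume s: "s \<in> {..<n}"
      define g where "g a c = of_bool (C 0 u v s a \<and> C 0 u v (Suc s) c \<and> a \<noteq> c) * d (a, c)" for a c
      have "c s = g (f s) (f (Suc s))" using f[of s] f[of "Suc s"] s by (simp add: c_def g_def)
      also have "\<dots> \<le> (\<Sum>c<n. g (f s) c)" using f[of "Suc s"] s by (intro member_le_sum) auto
      also have "\<dots> \<le> (\<Sum>a<n. \<Sum>c<n. g a c)"
        using f[of s] s by (intro member_le_sum[of _ _ "\<lambda>a. \<Sum>c<n. g a c"]) auto
      finally show "c s \<le> (\<Sum>a<n. \<Sum>c<n. of_bool (C 0 u v s a \<and> C 0 u v (Suc s) c \<and> a \<noteq> c) * d (a, c))"
        unfolding g_def .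
    qed
    finally show ?thesis by simp
  qed
  then have "routing_cost {0..<n} E' d \<le> enat (\<Sum>u<n. \<Sum>v<n. cost u v)"
    using routing_cost_le[of "{0..<n}" E' d cost] by (simp add: atLeast0LessThan)
  also have "(\<Sum>u<n. \<Sum>v<n. cost u v) =
      (\<Sum>(u, v, s, a, c)\<in>{..<n} \<times> {..<n} \<times> {..<n} \<times> {..<n} \<times> {..<n}.
        of_bool (C 0 u v s a \<and> C 0 u v (Suc s) c \<and> a \<noteq> c) * d (a, c))"
    unfolding cost_def by (simp only: sum.cartesian_product split_def fst_conv snd_conv)
  also have "\<dots> = (\<Sum>e\<in>{..<n} \<times> {..<n} \<times> {..<n} \<times> {..<n} \<times> {..<n}. val b
      (\<lambda>k. case e of (u, v, s, a, c) \<Rightarrow> C 0 u v s a \<and> C 0 u v (Suc s) c \<and> a \<noteq> c \<and> C 3 a c k 0))"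
    by (intro sum.cong) (auto simp: d_def val_def)
  also have "\<dots> = (\<Sum>k<b. col_d n C k * 2 ^ k)"
    by (subst sum_val) (simp_all only: col_d_def sum.cartesian_product split_def fst_conv snd_conv
        finite_cartesian_product finite_lessThan)
  also have "\<dots> \<le> ?\<gamma>" using sd by (rule slack_sound) (simp add: slack_def)
  finally have "DiNDP_yes {0..<n} E w d ?\<beta> ?\<gamma>"
    unfolding DiNDP_yes_def using weight sub by (intro exI[of _ E']) simp
  moreover have "E \<subseteq> {0..<n} \<times> {0..<n}" by (auto simp: E_def)
  ultimately show ?thesis unfolding DiNDP_def x by blast
qed


section \<open>Completeness of the check\<close>

lemma val_cong: "(\<And>k. k < b \<Longrightarrow> f k = g k) \<Longrightarrow> val b f = val b g"
  unfolding val_def by (intro sum.cong) auto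

lemma val_conj: "val b (\<lambda>k. P \<and> f k) = of_bool P * val b f"
  by (cases P) (simp_all add: val_def)

lemma sum_delta2:
  fixes K x y n :: nat
  assumes "x < n" "y < n"
  shows "(\<Sum>a<n. \<Sum>c<n. if a = x then if c = y then K else 0 else 0) = K"
proof -
  have "(\<Sum>c<n. if a = x then if c = y then K else 0 else 0) = (if a = x then K else 0)" for a
    using assms(2) by simp
  then show ?thesis using assms(1) by simp
qed

lemma encode_instance_cong:
  assumes "\<And>e. e \<in> {0..<n} \<times> {0..<n} \<Longrightarrow> e \<in> E \<longleftrightarrow> e \<in> E'"
    and "\<And>e. e \<in> {0..<n} \<times> {0..<n} \<Longrightarrow> e \<in> E \<Longrightarrow> w e = w' e \<and> d e = d' e"
  shows "encode_instance n E w d \<beta> \<gamma> = encode_instance n E' w' d' \<beta> \<gamma>"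
proof -
  have "map (encode_entry E w d) (List.product [0..<n] [0..<n]) =
      map (encode_entry E' w' d') (List.product [0..<n] [0..<n])"
    using assms by (intro map_cong refl) (auto simp: encode_entry_def)
  then show ?thesis unfolding encode_instance_def by (simp only:)
qed

lemma length_encode_instance:
  "n < Suc (length (encode_instance n E w d \<beta> \<gamma>))"
  "length (encode_nat \<beta>) \<le> length (encode_instance n E w d \<beta> \<gamma>)"
  "length (encode_nat \<gamma>) \<le> length (encode_instance n E w d \<beta> \<gamma>)"
  "e \<in> E \<Longrightarrow> E \<subseteq> {0..<n} \<times> {0..<n} \<Longrightarrow> length (encode_nat (w e)) \<le> length (encode_instance n E w d \<beta> \<gamma>)"
  "e \<in> E \<Longrightarrow> E \<subseteq> {0..<n} \<times> {0..<n} \<Longrightarrow> length (encode_nat (d e)) \<le> length (encode_instance n E w d \<beta> \<gamma>)"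
proof -
  have entry: "length (encode_entry E w d e) \<le> length (encode_instance n E w d \<beta> \<gamma>)"
    if "e \<in> E" "E \<subseteq> {0..<n} \<times> {0..<n}"
  proof -
    have "encode_entry E w d e \<in> set (map (encode_entry E w d) (List.product [0..<n] [0..<n]))"
      using that by auto
    from length_concat_ge[OF this] show ?thesis by (simp add: encode_instance_def)
  qed
  show "e \<in> E \<Longrightarrow> E \<subseteq> {0..<n} \<times> {0..<n} \<Longrightarrow> length (encode_nat (w e)) \<le> length (encode_instance n E w d \<beta> \<gamma>)"
    "e \<in> E \<Longrightarrow> E \<subseteq> {0..<n} \<times> {0..<n} \<Longrightarrow> length (encode_nat (d e)) \<le> length (encode_instance n E w d \<beta> \<gamma>)"
    using entry by (auto simp: encode_entry_def)
qed (simp_all add: encode_instance_def)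

text \<open>The conclusion covers every \<open>D\<close> agreeing with \<open>C\<close> on small
  indices, because a finite certificate word fixes the tables only there. The bound \<open>b\<close>
  exceeds \<open>n\<close>, and \<open>b\<close> digits suffice for every number of the instance,
  since each is spelled out in \<open>x\<close>.\<close>

lemma check_complete:
  assumes "x \<in> DiNDP"
  defines "b \<equiv> Suc (length x)"
  shows "\<exists>C. \<forall>D. (\<forall>m<10. \<forall>i<b. \<forall>j<b. \<forall>k<b. \<forall>l<b. D m i j k l = C m i j k l) \<longrightarrow> check x b D"
proof -
  obtain n E w d \<beta> \<gamma> where x: "x = encode_instance n E w d \<beta> \<gamma>"
    and E: "E \<subseteq> {0..<n} \<times> {0..<n}" and yes: "DiNDP_yes {0..<n} E w d \<beta> \<gamma>"
    using assms by (auto simp: DiNDP_def)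
  obtain E' where E': "E' \<subseteq> E" "(\<Sum>e\<in>E'. w e) \<le> \<beta>" "routing_cost {0..<n} E' d \<le> enat \<gamma>"
    using yes by (auto simp: DiNDP_yes_def)
  have b0: "0 < b" and nb: "n < b" using length_encode_instance(1)[of n E w d \<beta> \<gamma>] by (simp_all add: b_def x)
  have bits: "val b (\<lambda>k. odd (m div 2 ^ k)) = m" if "length (encode_nat m) \<le> length x" for m
    using that by (intro val_bits less_two_power) (simp add: b_def)
  have bits_wd: "val b (\<lambda>k. odd (w e div 2 ^ k)) = w e" "val b (\<lambda>k. odd (d e div 2 ^ k)) = d e" if "e \<in> E" for e
    using length_encode_instance(4,5)[OF that E, where w = w and d = d and \<beta> = \<beta> and \<gamma> = \<gamma>] x
    by (simp_all add: bits)
  have bits_bg: "val b (\<lambda>k. odd (\<beta> div 2 ^ k)) = \<beta>" "val b (\<lambda>k. odd (\<gamma> div 2 ^ k)) = \<gamma>"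
    using length_encode_instance(2,3)[where n = n and E = E and w = w and d = d and \<beta> = \<beta> and \<gamma> = \<gamma>] x
    by (simp_all add: bits)
  obtain c where c: "\<And>u v. u < n \<Longrightarrow> v < n \<Longrightarrow> graph_dist {0..<n} E' d u v = enat (c u v)"
    and c_sum: "(\<Sum>u<n. \<Sum>v<n. c u v) \<le> \<gamma>"
    using E'(3) by (rule routing_cost_le_D[rotated]) (auto simp: atLeast0LessThan)
  have "\<exists>f. f 0 = u \<and> f n = v \<and> (\<forall>s. f s < n) \<and> (\<forall>s<n. f s = f (Suc s) \<or> (f s, f (Suc s)) \<in> E') \<and>
      (\<Sum>s<n. of_bool (f s \<noteq> f (Suc s)) * d (f s, f (Suc s))) \<le> c u v"
    (is "\<exists>f. ?good f u v") if uv: "u < n" "v < n" for u v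
  proof -
    have "graph_dist {0..<n} E' d u v \<le> enat (c u v)" using c uv by simp
    then obtain p where p: "dipath {0..<n} E' u v p" "path_length d p \<le> c u v"
      unfolding graph_dist_le_iff by blast
    obtain q where q: "dipath {0..<n} E' u v q" "distinct q" "path_length d q \<le> path_length d p"
      using dipath_distinct[OF p(1)] by blast
    have q': "q \<noteq> []" "hd q = u" "last q = v" "set q \<subseteq> {0..<n}" "successively (\<lambda>x y. (x, y) \<in> E') q"
      using q(1) by (auto simp: dipath_def)
    \<comment> \<open>A simple path has fewer than \<open>n\<close> steps; the walk \<open>f\<close>
      below follows it and then waits at its last vertex.\<close>
    have len: "length q \<le> n"
      using card_mono[OF _ q'(4)] distinct_card[OF q(2)] by simp
    define f where "f s = q ! min s (length q - 1)" for s
    have stop: "f s = f (Suc s)" if "\<not> Suc s < length q" for s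
    proof -
      have "length q - 1 \<le> s" using that by simp
      then show ?thesis by (simp add: f_def min_absorb2)
    qed
    have "f 0 = u" using q' by (simp add: f_def hd_conv_nth)
    moreover have "f n = v"
    proof -
      have "min n (length q - 1) = length q - 1" using len by simp
      then show ?thesis using q' by (simp add: f_def last_conv_nth)
    qed
    moreover have "f s < n" for s
    proof -
      have "f s \<in> set q" unfolding f_def using q'(1) by (intro nth_mem) (cases q, auto simp: min_def)
      then show ?thesis using q'(4) by auto
    qed
    moreover have "f s = f (Suc s) \<or> (f s, f (Suc s)) \<in> E'" for s
    proof (cases "Suc s < length q")
      case True
      then have "(q ! s, q ! Suc s) \<in> E'" using q'(5) by (simp add: successively_conv_nth)
      then show ?thesis using True by (simp add: f_def min_def)
    qed (rule disjI1, rule stop)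
    moreover have "(\<Sum>s<n. of_bool (f s \<noteq> f (Suc s)) * d (f s, f (Suc s))) \<le> c u v"
    proof -
      have "(\<Sum>s<n. of_bool (f s \<noteq> f (Suc s)) * d (f s, f (Suc s)))
          = (\<Sum>s<length q - 1. of_bool (f s \<noteq> f (Suc s)) * d (f s, f (Suc s)))"
      proof (rule sum.mono_neutral_right)
        show "{..<length q - 1} \<subseteq> {..<n}" using len by auto
        show "\<forall>s\<in>{..<n} - {..<length q - 1}. of_bool (f s \<noteq> f (Suc s)) * d (f s, f (Suc s)) = 0"
        proof
          fix s assume "s \<in> {..<n} - {..<length q - 1}"
          then have "f s = f (Suc s)" by (intro stop) auto
          then show "of_bool (f s \<noteq> f (Suc s)) * d (f s, f (Suc s)) = 0" by simp
        qed
      qed simp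
      also have "\<dots> \<le> (\<Sum>s<length q - 1. d (q ! s, q ! Suc s))"
        by (intro sum_mono) (auto simp: f_def min_def)
      finally show ?thesis using q(3) p(2) by (simp only: path_length_nth)
    qed
    ultimately show ?thesis by blast
  qed
  then have "\<exists>f. u < n \<and> v < n \<longrightarrow> ?good f u v" for u v by blast
  then have "\<exists>f. \<forall>u v. u < n \<and> v < n \<longrightarrow> ?good (f u v) u v" by (intro choice allI)
  then obtain f where f: "\<And>u v. u < n \<Longrightarrow> v < n \<Longrightarrow> f u v 0 = u \<and> f u v n = v \<and> (\<forall>s. f u v s < n) \<and>
      (\<forall>s<n. f u v s = f u v (Suc s) \<or> (f u v s, f u v (Suc s)) \<in> E') \<and>
      (\<Sum>s<n. of_bool (f u v s \<noteq> f u v (Suc s)) * d (f u v s, f u v (Suc s))) \<le> c u v"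
    by blast
  define cw where "cw k = (\<Sum>i<n. \<Sum>j<n. of_bool ((i, j) \<in> E' \<and> odd (w (i, j) div 2 ^ k)) :: nat)" for k
  define cd where "cd k = (\<Sum>u<n. \<Sum>v<n. \<Sum>s<n. of_bool (f u v s \<noteq> f u v (Suc s) \<and>
      odd (d (f u v s, f u v (Suc s)) div 2 ^ k)) :: nat)" for k
  have cw_le: "cw k \<le> b * b * b" for k
  proof -
    have "cw k \<le> (\<Sum>i<n. \<Sum>j<n. 1)" unfolding cw_def by (intro sum_mono) simp
    also have "\<dots> = n * n * 1" by simp
    also have "\<dots> \<le> b * b * b" using nb by (intro mult_le_mono) auto
    finally show ?thesis .
  qed
  have cd_le: "cd k \<le> b * b * b" for k
  proof -
    have "cd k \<le> (\<Sum>u<n. \<Sum>v<n. \<Sum>s<n. 1)" unfolding cd_def by (intro sum_mono) simp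
    also have "\<dots> \<le> b * b * b" using nb by (simp add: mult_le_mono mult.assoc)
    finally show ?thesis .
  qed
  have "(\<Sum>k<b. cw k * 2 ^ k) \<le> val b (\<lambda>k. odd (\<beta> div 2 ^ k))"
  proof -
    have "(\<Sum>k<b. cw k * 2 ^ k) = (\<Sum>e\<in>{..<n} \<times> {..<n}. val b (\<lambda>k. e \<in> E' \<and> odd (w e div 2 ^ k)))"
      by (subst sum_val) (simp_all only: cw_def sum.cartesian_product split_def prod.collapse
          finite_cartesian_product finite_lessThan)
    also have "\<dots> = (\<Sum>e\<in>E'. w e)"
    proof -
      have sub: "E' \<subseteq> {..<n} \<times> {..<n}" using E E'(1) unfolding atLeast0LessThan by blast
      have "val b (\<lambda>k. e \<in> E' \<and> odd (w e div 2 ^ k)) = w e" if "e \<in> E'" for e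
        using bits_wd(1)[of e] that E'(1) by auto
      then show ?thesis using sub
        by (intro sum.mono_neutral_cong_right) (simp_all add: val_def)
    qed
    finally show ?thesis using E'(2) by (simp add: bits_bg)
  qed
  from slack_complete[OF this cw_le] obtain Sw where
    Sw: "slack_ok b Sw cw (\<lambda>k. odd (\<beta> div 2 ^ k))" "\<And>k. Sw k \<le> b * b * b" "Sw b = 0" by blast
  have "(\<Sum>k<b. cd k * 2 ^ k) \<le> val b (\<lambda>k. odd (\<gamma> div 2 ^ k))"
  proof -
    have "(\<Sum>k<b. cd k * 2 ^ k) = (\<Sum>e\<in>{..<n} \<times> {..<n} \<times> {..<n}. val b
       (\<lambda>k. case e of (u, v, s) \<Rightarrow> f u v s \<noteq> f u v (Suc s) \<and> odd (d (f u v s, f u v (Suc s)) div 2 ^ k)))"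
      by (subst sum_val) (simp_all only: cd_def sum.cartesian_product split_def fst_conv snd_conv
          finite_cartesian_product finite_lessThan)
    also have "\<dots> = (\<Sum>(u, v, s)\<in>{..<n} \<times> {..<n} \<times> {..<n}.
        of_bool (f u v s \<noteq> f u v (Suc s)) * d (f u v s, f u v (Suc s)))"
    proof (rule sum.cong[OF refl])
      fix e assume e': "e \<in> {..<n} \<times> {..<n} \<times> {..<n}"
      obtain u v s where e: "e = (u, v, s)" by (cases e)
      have "f u v s = f u v (Suc s) \<or> (f u v s, f u v (Suc s)) \<in> E"
        using f[of u v] E'(1) e' by (auto simp: e)
      then show "val b (\<lambda>k. case e of (u, v, s) \<Rightarrow> f u v s \<noteq> f u v (Suc s) \<and> odd (d (f u v s, f u v (Suc s)) div 2 ^ k))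
          = (case e of (u, v, s) \<Rightarrow> of_bool (f u v s \<noteq> f u v (Suc s)) * d (f u v s, f u v (Suc s)))"
        unfolding e prod.case val_conj using bits_wd(2) by auto
    qed
    also have "\<dots> = (\<Sum>u<n. \<Sum>v<n. \<Sum>s<n. of_bool (f u v s \<noteq> f u v (Suc s)) * d (f u v s, f u v (Suc s)))"
      by (simp only: sum.cartesian_product split_def fst_conv snd_conv)
    also have "\<dots> \<le> (\<Sum>u<n. \<Sum>v<n. c u v)" using f by (intro sum_mono) auto
    finally show ?thesis using c_sum by (simp add: bits_bg)
  qed
  from slack_complete[OF this cd_le] obtain Sd where
    Sd: "slack_ok b Sd cd (\<lambda>k. odd (\<gamma> div 2 ^ k))" "\<And>k. Sd k \<le> b * b * b" "Sd b = 0" by blast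
  \<comment> \<open>In tables 7 and 8 the last three indices are read as a number in base
    \<open>b\<close>, and the first \<open>Sw i\<close> or \<open>Sd i\<close> of these numbers are
    marked.\<close>
  define C :: certificate where "C m i j k l =
     (if m = 0 then l = f i j k else if m = 1 then (i, j) \<in> E
      else if m = 2 then odd (w (i, j) div 2 ^ k) else if m = 3 then odd (d (i, j) div 2 ^ k)
      else if m = 4 then odd (\<beta> div 2 ^ i) else if m = 5 then odd (\<gamma> div 2 ^ i)
      else if m = 6 then (i, j) \<in> E' else if m = 7 then (j * b + k) * b + l < Sw i
      else if m = 8 then (j * b + k) * b + l < Sd i else i < n)" for m i j k l
  show ?thesis
  proof (intro exI[of _ C] allI impI)
    fix D assume "\<forall>m<10. \<forall>i<b. \<forall>j<b. \<forall>k<b. \<forall>l<b. D m i j k l = C m i j k l"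
    then have D: "D m i j k l = C m i j k l" if "m < 10" "i < b" "j < b" "k < b" "l < b" for m i j k l
      using that by blast
    have nodes: "nodes b D = n"
    proof -
      have "nodes b D = (\<Sum>i<b. of_bool (i < n))"
        unfolding nodes_def by (intro sum.cong refl) (simp add: D b0 C_def)
      then show ?thesis using nb by (simp only: sum_of_bool_less less_imp_le)
    qed
    have less: "i < b" if "i < n" for i using that nb by simp
    have "listed n b D = x"
    proof -
      have "val b (\<lambda>k. D 4 k 0 0 0) = \<beta>" "val b (\<lambda>k. D 5 k 0 0 0) = \<gamma>"
        using bits_bg by (simp_all add: D b0 C_def cong: val_cong)
      moreover have "val b (\<lambda>k. D 2 i j k 0) = w (i, j)" "val b (\<lambda>k. D 3 i j k 0) = d (i, j)" if "(i, j) \<in> E" for i j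
      proof -
        have "i < b" "j < b" using that E nb by auto
        then show "val b (\<lambda>k. D 2 i j k 0) = w (i, j)" "val b (\<lambda>k. D 3 i j k 0) = d (i, j)"
          using bits_wd[OF that] by (simp_all add: D b0 C_def cong: val_cong)
      qed
      moreover have "D 1 i j 0 0 \<longleftrightarrow> (i, j) \<in> E" if "i < n" "j < n" for i j
        using that less by (simp add: D b0 C_def)
      ultimately show ?thesis
        unfolding listed_def x by (auto intro!: encode_instance_cong)
    qed
    moreover have "\<forall>i<n. \<forall>j<n. D 6 i j 0 0 \<longrightarrow> D 1 i j 0 0"
      using E'(1) less by (auto simp: D b0 C_def)
    moreover have D0: "D 0 u v s a \<longleftrightarrow> a = f u v s" if "u < n" "v < n" "s \<le> n" "a < n" for u v s a
      using that less nb by (simp add: D C_def)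
    have slack: "slack m b D k = V k"
      if V: "k \<le> b" "V b = 0" "\<And>k. V k \<le> b * b * b"
        and eq: "\<And>i p q r. i < b \<Longrightarrow> p < b \<Longrightarrow> q < b \<Longrightarrow> r < b \<Longrightarrow> D m i p q r \<longleftrightarrow> (p * b + q) * b + r < V i" for m k V
    proof (cases "k = b")
      case False
      then have "slack m b D k = (\<Sum>p<b. \<Sum>q<b. \<Sum>r<b. of_bool ((p * b + q) * b + r < V k))"
        using V(1) eq unfolding slack_def by (auto simp del: sum_of_bool_eq intro!: sum.cong)
      also have "\<dots> = V k" using V(3)[of k]
        by (simp only: sum_digits[of "\<lambda>i. \<Sum>r<b. of_bool (i * b + r < V k)"]
            sum_digits[of "\<lambda>i. of_bool (i < V k)"] sum_of_bool_less)
      finally show ?thesis .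
    qed (simp add: slack_def V)
    have "walks_ok n D"
      unfolding walks_ok_def
    proof (intro allI impI conjI)
      fix u v assume uv: "u < n" "v < n"
      show "D 0 u v 0 u" "D 0 u v n v" using uv f D0 by auto
      fix s assume s: "s < n"
      show "\<exists>a<n. D 0 u v s a" using D0[OF uv, of s "f u v s"] f[OF uv] s by auto
      fix a a' assume "a < n" "a' < n" "D 0 u v s a \<and> D 0 u v (Suc s) a'"
      then show "a = a' \<or> D 6 a a' 0 0"
        using D0[OF uv] f[OF uv] s less by (auto simp: D b0 C_def)
    qed
    moreover have "col_w n D k = cw k" if "k < b" for k
      unfolding col_w_def cw_def using that less by (intro sum.cong refl) (simp add: D b0 C_def)
    moreover have "col_d n D k = cd k" if k: "k < b" for k
      unfolding col_d_def cd_def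
    proof (intro sum.cong refl)
      fix u v s assume "u \<in> {..<n}" "v \<in> {..<n}" "s \<in> {..<n}"
      then have uvs: "u < n" "v < n" "s < n" by auto
      let ?x = "f u v s" and ?y = "f u v (Suc s)"
      have xy: "?x < n" "?y < n" using f uvs by auto
      \<comment> \<open>Each position carries a single mark here, so the double sum collapses to the
        pair actually traversed.\<close>
      have "(\<Sum>a<n. \<Sum>a'<n. of_bool (D 0 u v s a \<and> D 0 u v (Suc s) a' \<and> a \<noteq> a' \<and> D 3 a a' k 0) :: nat)
          = (\<Sum>a<n. \<Sum>a'<n. if a = ?x then if a' = ?y then of_bool (?x \<noteq> ?y \<and> odd (d (?x, ?y) div 2 ^ k)) else 0 else 0)"
        using uvs k less by (intro sum.cong refl) (auto simp: D0 D b0 C_def)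
      also have "\<dots> = of_bool (?x \<noteq> ?y \<and> odd (d (?x, ?y) div 2 ^ k))"
        by (rule sum_delta2[OF xy])
      finally show "(\<Sum>a<n. \<Sum>a'<n. of_bool (D 0 u v s a \<and> D 0 u v (Suc s) a' \<and> a \<noteq> a' \<and> D 3 a a' k 0) :: nat)
          = of_bool (?x \<noteq> ?y \<and> odd (d (?x, ?y) div 2 ^ k))" .
    qed
    moreover have "slack 7 b D k = Sw k" "slack 8 b D k = Sd k" if "k \<le> b" for k
      using slack[where m = 7 and V = Sw and k = k] slack[where m = 8 and V = Sd and k = k] that Sw(2,3) Sd(2,3)
      by (simp_all add: D C_def)
    moreover have "D 4 k 0 0 0 = odd (\<beta> div 2 ^ k)" "D 5 k 0 0 0 = odd (\<gamma> div 2 ^ k)" if "k < b" for k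
      using that by (simp_all add: D b0 C_def)
    ultimately show "check x b D"
      using Sw(1) Sd(1) unfolding check_def nodes Let_def slack_ok_def by simp
  qed
qed

text \<open>The position of the delimiter, obtained by counting the nonempty prefixes that are free
  of it.\<close>

definition xlen :: "symbol list \<Rightarrow> nat" where
  "xlen w = (\<Sum>i<length w. of_bool (\<forall>j<Suc i. cell w (int j) \<noteq> sep_sym))"

definition input :: "symbol list \<Rightarrow> bool list" where
  "input w = map (\<lambda>i. cell w (int i) = 2) [0..<xlen w]"

text \<open>Table number and indices are digits in base \<open>Suc (xlen w)\<close>, so looking up
  an entry is a polynomial expression in tame quantities.\<close>

definition cert_bit :: "symbol list \<Rightarrow> certificate" where
  "cert_bit w m i j k l \<longleftrightarrow> cell w (int (Suc (xlen w) +
     ((((m * Suc (xlen w) + i) * Suc (xlen w) + j) * Suc (xlen w) + k) * Suc (xlen w) + l))) = 2"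

lemma bit_sym_eq_2: "bit_sym b = 2 \<longleftrightarrow> b"
  by (cases b) auto

lemma bit_sym_neq_sep: "bit_sym b \<noteq> sep_sym"
  by (cases b) (auto simp: sep_sym_def)

lemma cell_pair_word:
  "i < length x \<Longrightarrow> cell (pair_word x u) (int i) = bit_sym (x ! i)"
  "cell (pair_word x u) (int (length x)) = sep_sym"
  "cell (pair_word x u) (int (Suc (length x) + i)) = (if i < length u then bit_sym (u ! i) else blank)"
  by (auto simp: cell_def word_tape_def pair_word_def nth_append nat_add_distrib nth_Cons split: nat.split)

lemma xlen_pair_word: "xlen (pair_word x u) = length x"
proof -
  have "(\<forall>j<Suc i. cell (pair_word x u) (int j) \<noteq> sep_sym) \<longleftrightarrow> i < length x" for i
  proof
    assume a: "\<forall>j<Suc i. cell (pair_word x u) (int j) \<noteq> sep_sym"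
    show "i < length x"
    proof (rule ccontr)
      assume "\<not> i < length x"
      then show False using a cell_pair_word(2)[of x u] by auto
    qed
  qed (simp add: cell_pair_word(1) bit_sym_neq_sep)
  then show ?thesis
    unfolding xlen_def by (simp only:) (rule sum_of_bool_less, simp add: pair_word_def)
qed

lemma input_pair_word: "input (pair_word x u) = x"
  unfolding input_def xlen_pair_word
  by (rule nth_equalityI) (simp_all add: cell_pair_word(1) bit_sym_eq_2)

lemma div_mod_digit: "l < b \<Longrightarrow> (a * b + l) div b = a \<and> (a * b + l) mod b = (l :: nat)"
  by simp

lemma digits_less:
  fixes b :: nat
  assumes "m < n" "i < b"
  shows "m * b + i < n * b"
proof -
  have "m * b + i < Suc m * b" using assms(2) by simp
  also have "\<dots> \<le> n * b" using assms(1) by (intro mult_le_mono1) simp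
  finally show ?thesis .
qed

text \<open>The polynomial is the size of ten tables with four indices below
  \<open>Suc (length x)\<close>.\<close>

lemma DiNDP_iff:
  "x \<in> DiNDP \<longleftrightarrow> (\<exists>u. length u \<le> poly ([:10:] * [:1, 1:] ^ 4) (length x) \<and>
     check (input (pair_word x u)) (Suc (xlen (pair_word x u))) (cert_bit (pair_word x u)))"
  (is "_ \<longleftrightarrow> ?R")
proof
  assume "x \<in> DiNDP"
  define b where "b = Suc (length x)"
  from check_complete[OF \<open>x \<in> DiNDP\<close>] obtain C where
    C: "\<And>D. \<forall>m<10. \<forall>i<b. \<forall>j<b. \<forall>k<b. \<forall>l<b. D m i j k l = C m i j k l \<Longrightarrow> check x b D"
    unfolding b_def by blast
  \<comment> \<open>This inverts the layout used by \<open>cert_bit\<close>.\<close>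
  define g where "g t = C (t div b div b div b div b) (t div b div b div b mod b) (t div b div b mod b)
     (t div b mod b) (t mod b)" for t
  define u where "u = map g [0..<10 * b * b * b * b]"
  have "check x b (cert_bit (pair_word x u))"
  proof (rule C, intro allI impI)
    fix m i j k l :: nat assume less: "m < 10" "i < b" "j < b" "k < b" "l < b"
    let ?t = "(((m * b + i) * b + j) * b + k) * b + l"
    have t: "?t < 10 * b * b * b * b" using less by (intro digits_less)
    have "cert_bit (pair_word x u) m i j k l \<longleftrightarrow> u ! ?t"
      using t unfolding cert_bit_def xlen_pair_word b_def[symmetric]
      unfolding b_def cell_pair_word(3) by (simp add: u_def b_def bit_sym_eq_2)
    also have "\<dots> \<longleftrightarrow> g ?t" using t by (simp add: u_def)
    also have "\<dots> \<longleftrightarrow> C m i j k l" using less by (simp only: g_def div_mod_digit)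
    finally show "cert_bit (pair_word x u) m i j k l = C m i j k l" .
  qed
  moreover have "length u \<le> poly ([:10:] * [:1, 1:] ^ 4) (length x)"
    by (simp add: u_def b_def power4_eq_xxxx algebra_simps)
  ultimately show ?R
    by (intro exI[of _ u]) (simp add: input_pair_word xlen_pair_word b_def)
next
  assume ?R
  then show "x \<in> DiNDP" unfolding input_pair_word by (auto dest: check_sound)
qed

lemma tc_xlen: "tc (\<lambda>w e. xlen w)"
  unfolding xlen_def by (intro tc_intros)

lemma tcw_input: "tcw (\<lambda>w e. input w)"
  unfolding input_def by (intro tcw_intros tc_intros tc_xlen)

lemma tcb_cert:
  "tc I \<Longrightarrow> tc J \<Longrightarrow> tc K \<Longrightarrow> tc L \<Longrightarrow> tcb (\<lambda>w e. cert_bit w m (I w e) (J w e) (K w e) (L w e))"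
  unfolding cert_bit_def by (intro tc_intros tc_xlen)

lemma tc_nodes: "tc (\<lambda>w e. nodes (Suc (xlen w)) (cert_bit w))"
  unfolding nodes_def by (intro tc_intros tc_xlen tcb_cert)

lemma tc_slack: "tc A \<Longrightarrow> tc (\<lambda>w e. slack m (Suc (xlen w)) (cert_bit w) (A w e))"
  by (rule tc_app1[of "\<lambda>w. slack m (Suc (xlen w)) (cert_bit w)"])
    (unfold slack_def, intro tc_intros tc_xlen tcb_cert)

lemma tcb_check: "tcb (\<lambda>w e. check (input w) (Suc (xlen w)) (cert_bit w))"
proof -
  have "tcb (\<lambda>w e. input w = listed (nodes (Suc (xlen w)) (cert_bit w)) (Suc (xlen w)) (cert_bit w))"
    unfolding listed_def
    by (intro tcw_eq tcw_input tcw_encode_instance tcw_encode_val tc_nodes tcb_cert tc_intros tc_xlen)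
  then show ?thesis
    unfolding check_def Let_def walks_ok_def slack_ok_def col_w_def col_d_def
    by (intro tc_intros tc_xlen tcb_cert tc_nodes tc_slack)
qed

lemma DiNDP_in_NP: "DiNDP \<in> NP"
  using tcb_check DiNDP_iff by (rule NP_tcb)

section \<open>Reduction from a hitting set problem\<close>

lemma encode_nat_prefix:
  assumes "encode_nat a @ xs = encode_nat b @ ys"
  shows "a = b \<and> xs = ys"
proof -
  let ?f = "\<lambda>bs. concat (map (\<lambda>b. [True, b]) bs)"
  \<comment> \<open>Markers and bits alternate, so markers face markers in both words, and the first
    \<open>False\<close> marker ends both numbers at once.\<close>
  have prefix: "?f bs @ False # xs = ?f cs @ False # ys \<Longrightarrow> bs = cs \<and> xs = ys" for bs cs
  proof (induction bs arbitrary: cs)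
    case Nil
    then show ?case by (cases cs) auto
  next
    case (Cons b bs)
    note prems = Cons.prems and IH = Cons.IH
    show ?case
    proof (cases cs)
      case Nil
      then show ?thesis using prems by simp
    next
      case (Cons c cs')
      then have "b = c" and "?f bs @ False # xs = ?f cs' @ False # ys" using prems by simp_all
      from this(1) IH[OF this(2)] Cons show ?thesis by simp
    qed
  qed
  have "?f (binary a) @ False # xs = ?f (binary b) @ False # ys" using assms by (simp add: encode_nat_def)
  from prefix[OF this] have "binary a = binary b" "xs = ys" by simp_all
  moreover have "binary a = binary b \<Longrightarrow> a = b" for a b
  proof (induction a arbitrary: b rule: less_induct)
    case (less a)
    show ?case
    proof (cases "a = 0 \<or> b = 0")
      case True
      then show ?thesis using less.prems binary.simps[of a] binary.simps[of b] by (auto split: if_splits)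
    next
      case False
      then have "odd a = odd b" "binary (a div 2) = binary (b div 2)"
        using less.prems binary.simps[of a] binary.simps[of b] by auto
      then have "a div 2 = b div 2" "a mod 2 = b mod 2"
        using less.IH[of "a div 2"] False by (auto simp: odd_iff_mod_2_eq_one even_iff_mod_2_eq_zero)
      then show ?thesis by (metis div_mult_mod_eq)
    qed
  qed
  ultimately show ?thesis by blast
qed

lemma encode_entry_prefix:
  assumes "encode_entry E w d e @ xs = encode_entry E' w' d' e @ ys"
  shows "(e \<in> E \<longleftrightarrow> e \<in> E') \<and> (e \<in> E \<longrightarrow> w e = w' e \<and> d e = d' e) \<and> xs = ys"
  using assms by (auto simp: encode_entry_def split: if_splits dest!: encode_nat_prefix)

lemma encode_entries_prefix:
  "concat (map (encode_entry E w d) es) @ xs = concat (map (encode_entry E' w' d') es) @ ys \<Longrightarrow>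
     (\<forall>e\<in>set es. (e \<in> E \<longleftrightarrow> e \<in> E') \<and> (e \<in> E \<longrightarrow> w e = w' e \<and> d e = d' e)) \<and> xs = ys"
proof (induction es)
  case (Cons e es)
  from Cons.prems encode_entry_prefix[of E w d e _ E' w' d'] have
    "(e \<in> E \<longleftrightarrow> e \<in> E') \<and> (e \<in> E \<longrightarrow> w e = w' e \<and> d e = d' e)"
    "concat (map (encode_entry E w d) es) @ xs = concat (map (encode_entry E' w' d') es) @ ys"
    by auto
  with Cons.IH show ?case by simp
qed simp

text \<open>Membership in \<open>DiNDP\<close> only says that a word encodes some yes-instance, so
  hardness requires the word to determine its instance. Off the edges it carries no weights or
  distances, hence the restriction to \<open>e \<in> E\<close>.\<close>

lemma encode_instance_eqD:
  assumes eq: "encode_instance n E w d \<beta> \<gamma> = encode_instance n' E' w' d' \<beta>' \<gamma>'"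
    and sub: "E \<subseteq> {0..<n} \<times> {0..<n}" "E' \<subseteq> {0..<n'} \<times> {0..<n'}"
  shows "n = n'" "E = E'" "\<And>e. e \<in> E \<Longrightarrow> w e = w' e \<and> d e = d' e" "\<beta> = \<beta>'" "\<gamma> = \<gamma>'"
proof -
  have unary: "replicate n True @ False # xs = replicate n' True @ False # ys \<Longrightarrow> n = n' \<and> xs = ys" for n n' xs ys
  proof (induction n arbitrary: n')
    case 0
    then show ?case by (cases n') auto
  next
    case (Suc n)
    then obtain k where k: "n' = Suc k" by (cases n') auto
    then have "replicate n True @ False # xs = replicate k True @ False # ys" using Suc.prems by simp
    from Suc.IH[OF this] k show ?case by simp
  qed
  let ?ps = "List.product [0..<n] [0..<n]"
  have n: "n = n'" and rest: "concat (map (encode_entry E w d) ?ps) @ encode_nat \<beta> @ encode_nat \<gamma> =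
      concat (map (encode_entry E' w' d') ?ps) @ encode_nat \<beta>' @ encode_nat \<gamma>'"
    using unary[OF eq[unfolded encode_instance_def append_Cons append_Nil]] by auto
  from encode_entries_prefix[OF rest] have
    e: "\<And>e. e \<in> {0..<n} \<times> {0..<n} \<Longrightarrow> (e \<in> E \<longleftrightarrow> e \<in> E') \<and> (e \<in> E \<longrightarrow> w e = w' e \<and> d e = d' e)"
    and tail: "encode_nat \<beta> @ encode_nat \<gamma> = encode_nat \<beta>' @ encode_nat \<gamma>'"
    by auto
  show "n = n'" by (rule n)
  show "E = E'" using e sub n by blast
  show "w e = w' e \<and> d e = d' e" if "e \<in> E" for e using e that sub by blast
  show "\<beta> = \<beta>'" using encode_nat_prefix[OF tail] by simp
  have "encode_nat \<gamma> @ [] = encode_nat \<gamma>' @ []" using encode_nat_prefix[OF tail] by simp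
  from encode_nat_prefix[OF this] show "\<gamma> = \<gamma>'" by simp
qed

lemma DiNDP_yes_cong:
  assumes "\<And>e. e \<in> E \<Longrightarrow> w e = w' e \<and> d e = d' e" and "DiNDP_yes V E w d \<beta> \<gamma>"
  shows "DiNDP_yes V E w' d' \<beta> \<gamma>"
proof -
  obtain F where F: "F \<subseteq> E" "(\<Sum>e\<in>F. w e) \<le> \<beta>" "routing_cost V F d \<le> enat \<gamma>"
    using assms(2) by (auto simp: DiNDP_yes_def)
  have "path_length d p = path_length d' p" if "successively (\<lambda>x y. (x, y) \<in> F) p" for p
    using that
  proof (induction p rule: induct_list012)
    case (3 x y zs)
    then show ?case using F(1) assms(1) by auto
  qed (simp_all add: path_length_def)
  then have "graph_dist V F d = graph_dist V F d'"
    unfolding graph_dist_def fun_eq_iff by (auto simp: dipath_def intro!: INF_cong)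
  then have "routing_cost V F d = routing_cost V F d'" by (simp add: routing_cost_def)
  moreover have "(\<Sum>e\<in>F. w e) = (\<Sum>e\<in>F. w' e)" using F(1) assms(1) by (intro sum.cong) auto
  ultimately show ?thesis using F unfolding DiNDP_yes_def by auto
qed

lemma encode_instance_in_DiNDP:
  assumes "E \<subseteq> {0..<n} \<times> {0..<n}"
  shows "encode_instance n E w d \<beta> \<gamma> \<in> DiNDP \<longleftrightarrow> DiNDP_yes {0..<n} E w d \<beta> \<gamma>"
proof
  assume "encode_instance n E w d \<beta> \<gamma> \<in> DiNDP"
  then obtain n' E' w' d' \<beta>' \<gamma>' where
    eq: "encode_instance n E w d \<beta> \<gamma> = encode_instance n' E' w' d' \<beta>' \<gamma>'"
    and E': "E' \<subseteq> {0..<n'} \<times> {0..<n'}" and yes: "DiNDP_yes {0..<n'} E' w' d' \<beta>' \<gamma>'"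
    by (auto simp: DiNDP_def)
  note same = encode_instance_eqD[OF eq assms E']
  show "DiNDP_yes {0..<n} E w d \<beta> \<gamma>"
    using yes same(3) unfolding same(1,4,5) same(2)[symmetric] by (intro DiNDP_yes_cong[of E w' w d' d]) auto
next
  assume "DiNDP_yes {0..<n} E w d \<beta> \<gamma>"
  with assms show "encode_instance n E w d \<beta> \<gamma> \<in> DiNDP" unfolding DiNDP_def by blast
qed

section \<open>From hitting sets to network design\<close>

text \<open>A hitting set instance with \<open>I\<close> items and \<open>R\<close> targets becomes a graph with a source 0, a hub 1,
  and vertices for items and targets. Only edges into the hub have length 1, and only edges from the source to items have
  weight. Every distance is 0 or 1, and the selected edges decide which items and targets the source
  reaches at distance 0.\<close>

definition is_item :: "nat \<Rightarrow> nat \<Rightarrow> bool" where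
  "is_item I v \<longleftrightarrow> 2 \<le> v \<and> v < 2 + I"

definition is_target :: "nat \<Rightarrow> nat \<Rightarrow> bool" where
  "is_target I v \<longleftrightarrow> 2 + I \<le> v"

definition hits :: "nat \<Rightarrow> (nat \<Rightarrow> nat \<Rightarrow> bool) \<Rightarrow> nat \<Rightarrow> nat \<Rightarrow> bool" where
  "hits I inc u v \<longleftrightarrow> is_item I u \<and> is_target I v \<and> inc (v - (2 + I)) (u - 2)"

definition edge :: "nat \<Rightarrow> (nat \<Rightarrow> nat \<Rightarrow> bool) \<Rightarrow> nat \<Rightarrow> nat \<Rightarrow> bool" where
  "edge I inc u v \<longleftrightarrow> v = 1 \<or> u = 1 \<or> (u = 0 \<and> is_item I v) \<or> hits I inc u v"

text \<open>The pairs that are at distance 0 when all items are selected and every target is hit.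
  All other pairs cost at least 1 under any selection.\<close>

definition near :: "nat \<Rightarrow> (nat \<Rightarrow> nat \<Rightarrow> bool) \<Rightarrow> nat \<Rightarrow> nat \<Rightarrow> bool" where
  "near I inc u v \<longleftrightarrow> u = v \<or> u = 1 \<or> (u = 0 \<and> (is_item I v \<or> is_target I v)) \<or> hits I inc u v"

text \<open>Beyond the unavoidable pairs, the budget grants one unit for each item that a selection
  of \<open>m\<close> leaves out, and none for missed targets.\<close>

definition cost_bound :: "nat \<Rightarrow> nat \<Rightarrow> (nat \<Rightarrow> nat \<Rightarrow> bool) \<Rightarrow> nat \<Rightarrow> nat" where
  "cost_bound I R inc m = (\<Sum>u<2 + I + R. \<Sum>v<2 + I + R. of_bool (\<not> near I inc u v)) + (I - m)"

definition hit_yes :: "nat \<Rightarrow> nat \<Rightarrow> (nat \<Rightarrow> nat \<Rightarrow> bool) \<Rightarrow> nat \<Rightarrow> bool" where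
  "hit_yes I R inc m \<longleftrightarrow> DiNDP_yes {0..<2 + I + R} {(u, v). u < 2 + I + R \<and> v < 2 + I + R \<and> edge I inc u v}
     (\<lambda>(u, v). of_bool (u = 0 \<and> v \<noteq> 1)) (\<lambda>(u, v). of_bool (v = 1)) m (cost_bound I R inc m)"

definition zero_dist :: "nat \<Rightarrow> (nat \<Rightarrow> nat \<Rightarrow> bool) \<Rightarrow> nat set \<Rightarrow> nat \<Rightarrow> nat \<Rightarrow> bool" where
  "zero_dist I inc S u v \<longleftrightarrow> u = v \<or> u = 1 \<or> hits I inc u v \<or> (u = 0 \<and> is_item I v \<and> v - 2 \<in> S) \<or>
     (u = 0 \<and> is_target I v \<and> (\<exists>i\<in>S. inc (v - (2 + I)) i))"

lemma Suc_Suc_diff_2: "2 \<le> v \<Longrightarrow> Suc (Suc (v - 2)) = v"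
  by linarith

text \<open>\<open>zero_dist\<close> and \<open>near\<close> differ only in the row of the source,
  and there exactly at the unselected items and the targets that no selected item hits.\<close>

lemma sum_zero_dist:
  assumes S: "S \<subseteq> {..<I}"
  shows "(\<Sum>u<2 + I + R. \<Sum>v<2 + I + R. of_bool (\<not> zero_dist I inc S u v)) =
    (\<Sum>u<2 + I + R. \<Sum>v<2 + I + R. of_bool (\<not> near I inc u v))
      + (I - card S) + card {t. t < R \<and> (\<forall>i\<in>S. \<not> inc t i)}"
proof -
  let ?n = "2 + I + R"
  let ?a = "\<lambda>v. is_item I v \<and> v - 2 \<notin> S" and ?b = "\<lambda>v. is_target I v \<and> (\<forall>i\<in>S. \<not> inc (v - (2 + I)) i)"
  have split: "(of_bool (\<not> zero_dist I inc S u v) :: nat) =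
      of_bool (\<not> near I inc u v) + of_bool (u = 0) * (of_bool (?a v) + of_bool (?b v))" for u v
    unfolding zero_dist_def near_def hits_def is_item_def is_target_def by auto
  have first: "(\<Sum>u<?n. of_bool (u = 0) * k) = k" for k :: nat
  proof -
    have "of_bool (u = 0) * k = (if u = 0 then k else 0)" for u :: nat by simp
    then show ?thesis by (simp only: sum.delta finite_lessThan) simp
  qed
  have a: "(\<Sum>v<?n. of_bool (?a v)) = I - card S"
  proof -
    have "{..<?n} \<inter> {v. ?a v} = (\<lambda>i. i + 2) ` ({..<I} - S)"
    proof (intro set_eqI iffI)
      fix v assume "v \<in> {..<?n} \<inter> {v. ?a v}"
      then show "v \<in> (\<lambda>i. i + 2) ` ({..<I} - S)" by (intro image_eqI[of _ _ "v - 2"]) (auto simp: is_item_def)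
    qed (auto simp: is_item_def)
    then have "(\<Sum>v<?n. of_bool (?a v)) = card ((\<lambda>i. i + 2) ` ({..<I} - S))"
      by (simp only: sum_of_bool_eq finite_lessThan of_nat_id)
    also have "\<dots> = I - card S" using S by (subst card_image) (auto simp: card_Diff_subset finite_subset inj_on_def)
    finally show ?thesis .
  qed
  have b: "(\<Sum>v<?n. of_bool (?b v)) = card {t. t < R \<and> (\<forall>i\<in>S. \<not> inc t i)}"
  proof -
    have "{..<?n} \<inter> {v. ?b v} = (\<lambda>t. t + (2 + I)) ` {t. t < R \<and> (\<forall>i\<in>S. \<not> inc t i)}"
    proof (intro set_eqI iffI)
      fix v assume "v \<in> {..<?n} \<inter> {v. ?b v}"
      then show "v \<in> (\<lambda>t. t + (2 + I)) ` {t. t < R \<and> (\<forall>i\<in>S. \<not> inc t i)}"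
        by (intro image_eqI[of _ _ "v - (2 + I)"]) (auto simp: is_target_def)
    qed (auto simp: is_target_def)
    then have "(\<Sum>v<?n. of_bool (?b v)) = card ((\<lambda>t. t + (2 + I)) ` {t. t < R \<and> (\<forall>i\<in>S. \<not> inc t i)})"
      by (simp only: sum_of_bool_eq finite_lessThan of_nat_id)
    then show ?thesis by (subst (asm) card_image) (auto simp: inj_on_def)
  qed
  have "(\<Sum>u<?n. \<Sum>v<?n. of_bool (\<not> zero_dist I inc S u v) :: nat) =
      (\<Sum>u<?n. \<Sum>v<?n. of_bool (\<not> near I inc u v)) +
      (\<Sum>u<?n. of_bool (u = 0) * ((\<Sum>v<?n. of_bool (?a v)) + (\<Sum>v<?n. of_bool (?b v))))"
    by (simp only: split sum.distrib sum_distrib_left[symmetric])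
  then show ?thesis unfolding a b first by (simp only: add.assoc)
qed

lemma weight_selected:
  assumes "F \<subseteq> {(u, v). u < n \<and> v < n \<and> edge I inc u v}"
  shows "(\<Sum>(u, v)\<in>F. of_bool (u = 0 \<and> v \<noteq> 1)) = card {i. i < I \<and> (0, i + 2) \<in> F}"
proof -
  have fin: "finite F" by (rule finite_subset[of _ "{..<n} \<times> {..<n}"]) (use assms in auto)
  have "F \<inter> {e. case e of (u, v) \<Rightarrow> u = 0 \<and> v \<noteq> 1} = (\<lambda>i. (0, i + 2)) ` {i. i < I \<and> (0, i + 2) \<in> F}"
  proof (intro set_eqI iffI)
    fix e assume e: "e \<in> F \<inter> {e. case e of (u, v) \<Rightarrow> u = 0 \<and> v \<noteq> 1}"
    then obtain v where v: "e = (0, v)" "v \<noteq> 1" by auto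
    then have "is_item I v" using e assms by (auto simp: edge_def hits_def is_item_def)
    then show "e \<in> (\<lambda>i. (0, i + 2)) ` {i. i < I \<and> (0, i + 2) \<in> F}"
      using e v by (intro image_eqI[of _ _ "v - 2"]) (auto simp: is_item_def Suc_Suc_diff_2)
  qed auto
  moreover have "(\<Sum>(u, v)\<in>F. of_bool (u = 0 \<and> v \<noteq> 1)) =
      card (F \<inter> {e. case e of (u, v) \<Rightarrow> u = 0 \<and> v \<noteq> 1})"
    using fin by (simp add: split_def)
  moreover have "card ((\<lambda>i. (0 :: nat, i + 2)) ` A) = card A" for A :: "nat set"
    by (rule card_image) (auto simp: inj_on_def)
  ultimately show ?thesis by simp
qed

text \<open>A path of length 0 never enters the hub, so from the source it can only go to a selected
  item and from there to a target hit by that item.\<close>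

lemma zero_dist_path:
  assumes F: "F \<subseteq> {(u, v). u < n \<and> v < n \<and> edge I inc u v}"
    and "dipath V F u v p" "path_length (\<lambda>(u, v). of_bool (v = 1)) p = 0"
  shows "zero_dist I inc {i. i < I \<and> (0, i + 2) \<in> F} u v"
  using assms(2,3)
proof (induction p arbitrary: v rule: rev_induct)
  case Nil
  then show ?case by (simp add: dipath_def)
next
  case (snoc x p)
  show ?case
  proof (cases "p = []")
    case True
    then show ?thesis using snoc.prems by (auto simp: dipath_def zero_dist_def)
  next
    case False
    then have x: "x = v" "dipath V F u (last p) p" "(last p, v) \<in> F"
      using snoc.prems by (auto simp: dipath_def successively_append_iff)
    then have "zero_dist I inc {i. i < I \<and> (0, i + 2) \<in> F} u (last p)" and "v \<noteq> 1"
      using snoc False by (auto simp: path_length_snoc)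
    moreover have "edge I inc (last p) v" using x(3) F by auto
    moreover have "is_item I v \<Longrightarrow> v - 2 + 2 = v" by (simp add: is_item_def Suc_Suc_diff_2)
    ultimately show ?thesis
      using x(3) unfolding zero_dist_def edge_def hits_def
      by (auto simp: is_item_def is_target_def)
  qed
qed

text \<open>With at most \<open>m\<close> items selected, the others cost at least
  \<open>I - m\<close>, which consumes the whole allowance.\<close>

lemma hit_yes_imp:
  assumes "hit_yes I R inc m" "m \<le> I"
  shows "\<exists>S\<subseteq>{..<I}. card S \<le> m \<and> (\<forall>t<R. \<exists>i\<in>S. inc t i)"
proof -
  let ?n = "2 + I + R" and ?d = "\<lambda>(u, v). of_bool (v = (1 :: nat)) :: nat"
  obtain F where F: "F \<subseteq> {(u, v). u < ?n \<and> v < ?n \<and> edge I inc u v}"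
    and w: "(\<Sum>(u, v)\<in>F. of_bool (u = 0 \<and> v \<noteq> 1)) \<le> m"
    and r: "routing_cost {0..<?n} F ?d \<le> enat (cost_bound I R inc m)"
    using assms(1) unfolding hit_yes_def DiNDP_yes_def by blast
  define S where "S = {i. i < I \<and> (0, i + 2) \<in> F}"
  have S: "S \<subseteq> {..<I}" and cS: "card S \<le> m"
    using w unfolding weight_selected[OF F] S_def by auto
  obtain c where c: "\<And>u v. u < ?n \<Longrightarrow> v < ?n \<Longrightarrow> graph_dist {0..<?n} F ?d u v = enat (c u v)"
    and c_sum: "(\<Sum>u<?n. \<Sum>v<?n. c u v) \<le> cost_bound I R inc m"
    using r by (rule routing_cost_le_D[rotated]) (auto simp: atLeast0LessThan)
  have "of_bool (\<not> zero_dist I inc S u v) \<le> c u v" if "u < ?n" "v < ?n" for u v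
  proof (cases "c u v")
    case 0
    then have "graph_dist {0..<?n} F ?d u v \<le> enat 0" using c[OF that] by simp
    then obtain p where "dipath {0..<?n} F u v p" "path_length ?d p = 0" unfolding graph_dist_le_iff by auto
    from zero_dist_path[OF F this] show ?thesis by (simp add: S_def)
  qed simp
  then have "(\<Sum>u<?n. \<Sum>v<?n. of_bool (\<not> zero_dist I inc S u v)) \<le> (\<Sum>u<?n. \<Sum>v<?n. c u v)"
    by (intro sum_mono) simp
  with c_sum have "(I - card S) + card {t. t < R \<and> (\<forall>i\<in>S. \<not> inc t i)} \<le> I - m"
    unfolding sum_zero_dist[OF S] cost_bound_def by linarith
  then have "card {t. t < R \<and> (\<forall>i\<in>S. \<not> inc t i)} = 0" using cS assms(2) by linarith
  then have "{t. t < R \<and> (\<forall>i\<in>S. \<not> inc t i)} = {}" by simp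
  then show ?thesis using S cS by (intro exI[of _ S]) auto
qed

text \<open>Keeping every edge except those from the source to unselected items spends weight only
  on \<open>S\<close>, and the hub then joins any two vertices at distance at most 1.\<close>

lemma hit_yes_if:
  assumes S: "S \<subseteq> {..<I}" and cS: "card S = m" and cov: "\<And>t. t < R \<Longrightarrow> \<exists>i\<in>S. inc t i"
  shows "hit_yes I R inc m"
proof -
  let ?n = "2 + I + R" and ?d = "\<lambda>(u, v). of_bool (v = (1 :: nat)) :: nat"
  let ?E = "{(u, v). u < ?n \<and> v < ?n \<and> edge I inc u v}"
  define F where "F = {(u, v). (u, v) \<in> ?E \<and> (u = 0 \<and> is_item I v \<longrightarrow> v - 2 \<in> S)}"
  have F: "F \<subseteq> ?E" by (auto simp: F_def)
  have "{i. i < I \<and> (0, i + 2) \<in> F} = S"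
    using S by (auto simp: F_def edge_def is_item_def)
  then have w: "(\<Sum>(u, v)\<in>F. of_bool (u = 0 \<and> v \<noteq> 1)) = m"
    unfolding weight_selected[OF F] using cS by simp
  let ?g = "graph_dist {0..<?n} F ?d"
  have step: "?g u y \<le> enat (k + ?d (x, y))" if "?g u x \<le> enat k" "(x, y) \<in> F" for u x y k
    using graph_dist_step[OF that] that(2) F by auto
  have refl: "?g u u \<le> enat 0" if "u < ?n" for u using that by (intro graph_dist_refl) simp
  have "?g u v \<le> enat (of_bool (\<not> zero_dist I inc S u v))" if uv: "u < ?n" "v < ?n" for u v
  proof -
    have hub: "?g u 1 \<le> enat 1" if "u < ?n" "u \<noteq> 1" for u
      using step[OF refl[OF that(1)], of 1] that by (auto simp: F_def edge_def is_item_def)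
    have from_hub: "?g u v \<le> enat k" if "?g u 1 \<le> enat k" "v < ?n" "v \<noteq> 1" for u v k
      using step[OF that(1), of v] that by (auto simp: F_def edge_def)
    have hit: "?g u v \<le> enat k" if "?g u x \<le> enat k" "hits I inc x v" "x < ?n" "v < ?n" for u x v k
      using step[OF that(1), of v] that by (auto simp: F_def edge_def hits_def is_item_def is_target_def)
    have sel: "?g 0 v \<le> enat 0" if "is_item I v" "v - 2 \<in> S" for v
      using step[OF refl[of 0], of v] that by (auto simp: F_def edge_def is_item_def)
    show ?thesis
    proof (cases "zero_dist I inc S u v")
      case True
      then consider "u = v" | "u = 1" "v \<noteq> 1" | "hits I inc u v" | "u = 0" "is_item I v" "v - 2 \<in> S"
        | i where "u = 0" "is_target I v" "i \<in> S" "inc (v - (2 + I)) i"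
        unfolding zero_dist_def by blast
      then have "?g u v \<le> enat 0"
      proof cases
        case 2
        then show ?thesis using from_hub[OF refl[of 1]] uv by simp
      next
        case 3
        then show ?thesis using hit[OF refl[of u]] uv by simp
      next
        case 5
        then have "i < I" using S by auto
        then have "is_item I (i + 2)" "hits I inc (i + 2) v" "i + 2 < ?n"
          using 5 by (auto simp: is_item_def hits_def)
        then show ?thesis using hit[OF sel[of "i + 2"]] 5 uv by simp
      qed (use refl sel uv in auto)
      with True show ?thesis by simp
    next
      case False
      then have "u \<noteq> 1" by (simp add: zero_dist_def)
      then show ?thesis using False hub[OF uv(1)] from_hub[OF hub[OF uv(1)] uv(2)] by (cases "v = 1") auto
    qed
  qed
  then have "routing_cost {0..<?n} F ?d \<le> enat (\<Sum>u<?n. \<Sum>v<?n. of_bool (\<not> zero_dist I inc S u v))"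
    using routing_cost_le[of "{0..<?n}" F ?d] by (simp only: atLeast0LessThan lessThan_iff)
  also have "{t. t < R \<and> (\<forall>i\<in>S. \<not> inc t i)} = {}" using cov by auto
  then have "(\<Sum>u<?n. \<Sum>v<?n. of_bool (\<not> zero_dist I inc S u v)) = cost_bound I R inc m"
    unfolding sum_zero_dist[OF S] cost_bound_def cS by simp
  finally show ?thesis using F w unfolding hit_yes_def DiNDP_yes_def by (intro exI[of _ F]) simp
qed

section \<open>From choice functions to hitting sets\<close>

text \<open>One value below \<open>K\<close> is to be chosen for each of \<open>m\<close> groups. Item \<open>g * K + v\<close> stands for value \<open>v\<close> of group \<open>g\<close>;
  besides the clauses, every group is a target, so that \<open>m\<close> items hitting all targets form a
  choice function.\<close>

definition choosable :: "nat \<Rightarrow> nat \<Rightarrow> nat \<Rightarrow> (nat \<Rightarrow> nat \<Rightarrow> nat \<Rightarrow> bool) \<Rightarrow> bool" where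
  "choosable m K R cl \<longleftrightarrow> (\<exists>\<alpha>. (\<forall>g<m. \<alpha> g < K) \<and> (\<forall>c<R. \<exists>g<m. cl c g (\<alpha> g)))"

definition group_inc :: "nat \<Rightarrow> nat \<Rightarrow> (nat \<Rightarrow> nat \<Rightarrow> nat \<Rightarrow> bool) \<Rightarrow> nat \<Rightarrow> nat \<Rightarrow> bool" where
  "group_inc m K cl t i \<longleftrightarrow> (if t < m then i div K = t else cl (t - m) (i div K) (i mod K))"

lemma choosable_iff_hit_yes:
  assumes "0 < K"
  shows "choosable m K R cl \<longleftrightarrow> hit_yes (m * K) (m + R) (group_inc m K cl) m"
proof
  assume "choosable m K R cl"
  then obtain \<alpha> where \<alpha>: "\<And>g. g < m \<Longrightarrow> \<alpha> g < K" "\<And>c. c < R \<Longrightarrow> \<exists>g<m. cl c g (\<alpha> g)"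
    by (auto simp: choosable_def)
  define S where "S = (\<lambda>g. g * K + \<alpha> g) ` {..<m}"
  have dm: "(g * K + \<alpha> g) div K = g \<and> (g * K + \<alpha> g) mod K = \<alpha> g" if "g < m" for g
    using div_mod_digit[OF \<alpha>(1)[OF that]] .
  have "inj_on (\<lambda>g. g * K + \<alpha> g) {..<m}"
    by (rule inj_on_inverseI[of _ "\<lambda>i. i div K"]) (use dm in simp)
  then have "card S = m" by (simp add: S_def card_image)
  moreover have "S \<subseteq> {..<m * K}" using \<alpha>(1) digits_less by (auto simp: S_def)
  moreover have "\<exists>i\<in>S. group_inc m K cl t i" if t: "t < m + R" for t
  proof (cases "t < m")
    case True
    then show ?thesis using dm[OF True] by (auto simp: S_def group_inc_def)
  next
    case False
    then have "t - m < R" using t by linarith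
    then obtain g where "g < m" "cl (t - m) g (\<alpha> g)" using \<alpha>(2) by blast
    then have "g * K + \<alpha> g \<in> S" "group_inc m K cl t (g * K + \<alpha> g)"
      using dm[of g] False by (auto simp: S_def group_inc_def)
    then show ?thesis by blast
  qed
  ultimately show "hit_yes (m * K) (m + R) (group_inc m K cl) m" by (intro hit_yes_if)
next
  assume "hit_yes (m * K) (m + R) (group_inc m K cl) m"
  from hit_yes_imp[OF this] assms obtain S where
    S: "S \<subseteq> {..<m * K}" "card S \<le> m" "\<And>t. t < m + R \<Longrightarrow> \<exists>i\<in>S. group_inc m K cl t i" by auto
  have fin: "finite S" using S(1) finite_subset by blast
  have groups: "(\<lambda>i. i div K) ` S = {..<m}"
  proof (intro set_eqI iffI)
    fix g assume "g \<in> (\<lambda>i. i div K) ` S"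
    then show "g \<in> {..<m}" using S(1) assms by (auto simp: less_mult_imp_div_less)
  next
    fix g assume "g \<in> {..<m}"
    then show "g \<in> (\<lambda>i. i div K) ` S" using S(3)[of g] by (auto simp: group_inc_def)
  qed
  then have "card S = card ((\<lambda>i. i div K) ` S)"
    using S(2) card_image_le[OF fin, of "\<lambda>i. i div K"] by simp
  \<comment> \<open>Equal cardinalities of \<open>S\<close> and its image make the group number
    injective on \<open>S\<close>, so each group has exactly one item.\<close>
  then have inj: "inj_on (\<lambda>i. i div K) S" using fin by (simp add: inj_on_iff_eq_card)
  define \<alpha> where "\<alpha> g = inv_into S (\<lambda>i. i div K) g mod K" for g
  have sel: "i mod K = \<alpha> (i div K)" if "i \<in> S" for i
    using inv_into_f_f[OF inj that] by (simp add: \<alpha>_def)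
  have "\<exists>g<m. cl c g (\<alpha> g)" if c: "c < R" for c
  proof -
    obtain i where i: "i \<in> S" "group_inc m K cl (m + c) i" using S(3)[of "m + c"] c by auto
    then have "cl c (i div K) (\<alpha> (i div K))" using sel by (simp add: group_inc_def)
    moreover have "i div K < m" using groups i(1) by blast
    ultimately show ?thesis by blast
  qed
  moreover have "\<alpha> g < K" for g using assms by (simp add: \<alpha>_def)
  ultimately show "choosable m K R cl" unfolding choosable_def by blast
qed

text \<open>This settles everything about graphs and encodings; a reduction from a given language
  now only has to supply tame sizes and a tame clause predicate.\<close>

lemma choosable_reduction:
  assumes m: "tc (\<lambda>w e. m w)" and K: "tc (\<lambda>w e. K w)" and R: "tc (\<lambda>w e. R w)"
    and cl: "tcb (\<lambda>w e. cl w (e 0) (e 1) (e 2))"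
    and pos: "\<And>w. 0 < K w"
    and L: "\<And>x. x \<in> L \<longleftrightarrow> choosable (m (map bit_sym x)) (K (map bit_sym x)) (R (map bit_sym x)) (cl (map bit_sym x))"
  shows "L \<le>\<^sub>p DiNDP"
proof -
  define I where "I w = m w * K w" for w
  define n where "n w = 2 + I w + (m w + R w)" for w
  define inc where "inc w = group_inc (m w) (K w) (cl w)" for w
  define F where "F w = encode_instance (n w) {(u, v). u < n w \<and> v < n w \<and> edge (I w) (inc w) u v}
     (\<lambda>(u, v). of_bool (u = 0 \<and> v \<noteq> 1)) (\<lambda>(u, v). of_bool (v = 1)) (m w)
     (cost_bound (I w) (m w + R w) (inc w) (m w))" for w
  have I: "tc (\<lambda>w e. I w)" unfolding I_def by (intro tc_intros m K)
  have n: "tc (\<lambda>w e. n w)" unfolding n_def by (intro tc_intros m R I)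
  have inc: "tcb (\<lambda>w e. inc w (A w e) (B w e))" if "tc A" "tc B" for A B
    unfolding inc_def group_inc_def by (intro tc_intros that m K tc_app3[OF cl])
  have hits: "tcb (\<lambda>w e. hits (I w) (inc w) (A w e) (B w e))" if "tc A" "tc B" for A B
    unfolding hits_def is_item_def is_target_def by (intro tc_intros that I inc)
  have edge: "tcb (\<lambda>w e. edge (I w) (inc w) (e 0) (e 1))"
    unfolding edge_def is_item_def by (intro tc_intros I hits)
  have cost: "tc (\<lambda>w e. cost_bound (I w) (m w + R w) (inc w) (m w))"
    unfolding cost_bound_def near_def is_item_def is_target_def by (intro tc_intros m R I hits)
  have "tcw (\<lambda>w e. F w)"
    unfolding F_def by (intro tcw_encode_instance tcw_encode_nat n edge cost m tc_intros)
  from poly_time_computable_tcw[OF this] have "poly_time_computable (\<lambda>x. F (map bit_sym x))" .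
  moreover have "x \<in> L \<longleftrightarrow> F (map bit_sym x) \<in> DiNDP" for x
  proof -
    have "F w \<in> DiNDP \<longleftrightarrow> hit_yes (I w) (m w + R w) (inc w) (m w)" for w
      unfolding F_def by (subst encode_instance_in_DiNDP) (auto simp: hit_yes_def n_def)
    then show ?thesis unfolding L choosable_iff_hit_yes[OF pos] I_def inc_def by simp
  qed
  ultimately show ?thesis unfolding poly_reducible_def by blast
qed

section \<open>Tableaux of machine runs\<close>

locale machine_tableau =
  fixes M :: tm
  assumes tm: "turing_machine M"
begin

text \<open>A state and the symbols under all heads, packed into one number. The transition function
  sees nothing else, so a single group of the tableau determines the next state, the written symbols
  and the movements.\<close>

definition controls :: "nat set" where
  "controls = to_nat ` (states M \<times> {ss. set ss \<subseteq> alphabet M \<and> length ss = tapes M})"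

definition scanned :: "nat \<Rightarrow> symbol list" where
  "scanned a = snd (from_nat a :: nat \<times> symbol list)"

definition state :: "nat \<Rightarrow> nat" where
  "state a = fst (from_nat a :: nat \<times> symbol list)"

text \<open>Halting configurations repeat, as under \<open>step\<close>, so acceptance can be tested
  at one fixed time.\<close>

definition next_state :: "nat \<Rightarrow> nat" where
  "next_state a = (if state a \<in> {accept M, reject M} then state a else fst (delta M (state a) (scanned a)))"

definition written :: "nat \<Rightarrow> nat \<Rightarrow> symbol" where
  "written j a = (if state a \<in> {accept M, reject M} then scanned a ! j
     else fst (snd (delta M (state a) (scanned a)) ! j))"

text \<open>Head movements are shifted by one so that they become natural numbers.\<close>

definition moved :: "nat \<Rightarrow> nat \<Rightarrow> nat" where
  "moved j a = (if state a \<in> {accept M, reject M} then 1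
     else nat (offset (snd (snd (delta M (state a) (scanned a)) ! j)) + 1))"

definition control :: "config \<Rightarrow> nat" where
  "control cf = to_nat (fst cf, map scan (snd cf))"

definition wf_config :: "config \<Rightarrow> bool" where
  "wf_config cf \<longleftrightarrow> fst cf \<in> states M \<and> length (snd cf) = tapes M \<and>
     (\<forall>j<tapes M. \<forall>z. fst (snd cf ! j) z \<in> alphabet M)"

lemma finite_controls: "finite controls"
proof -
  have "finite (states M)" "finite (alphabet M)" using tm by (auto simp: turing_machine_def)
  then show ?thesis unfolding controls_def by (intro finite_imageI finite_cartesian_product finite_lists_length_eq)
qed

lemma tapes_pos: "0 < tapes M"
  using tm by (simp add: turing_machine_def)

lemma scan_conv: "scan tp = fst tp (snd tp)"
  by (cases tp) simp

lemma act_conv: "act (s, m) tp = ((fst tp)(snd tp := s), snd tp + offset m)"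
  by (cases tp) simp

lemma control_simps [simp]: "state (control cf) = fst cf" "scanned (control cf) = map scan (snd cf)"
  by (simp_all add: state_def scanned_def control_def)

lemma control_eqI:
  assumes "a \<in> controls" "state a = fst cf" "scanned a = map scan (snd cf)"
  shows "a = control cf"
proof -
  obtain b :: "nat \<times> symbol list" where "a = to_nat b" using assms(1) by (auto simp: controls_def)
  then show ?thesis using assms(2,3) by (simp add: state_def scanned_def control_def prod_eq_iff)
qed

lemma scanned_in: "wf_config cf \<Longrightarrow> set (map scan (snd cf)) \<subseteq> alphabet M"
  by (simp add: wf_config_def image_subset_iff all_set_conv_all_nth scan_conv)

lemma control_in: "wf_config cf \<Longrightarrow> control cf \<in> controls"
  using scanned_in[of cf] unfolding controls_def control_def by (auto simp: wf_config_def)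

lemma delta_wf:
  assumes "wf_config cf" "\<not> halted M cf"
  shows "fst (delta M (fst cf) (map scan (snd cf))) \<in> states M"
    "length (snd (delta M (fst cf) (map scan (snd cf)))) = tapes M"
    "fst ` set (snd (delta M (fst cf) (map scan (snd cf)))) \<subseteq> alphabet M"
  using tm assms scanned_in[OF assms(1)]
  by (auto simp: turing_machine_def halted_def wf_config_def split_beta)

lemma step_fst: "fst (step M cf) = next_state (control cf)"
  by (simp add: step_def halted_def next_state_def split_beta)

lemma offset_moved: "offset m = int (nat (offset m + 1)) - 1"
  by (cases m) auto

lemma step_tape:
  assumes "wf_config cf" "j < tapes M"
  shows "snd (step M cf) ! j = ((fst (snd cf ! j))(snd (snd cf ! j) := written j (control cf)),
    snd (snd cf ! j) + int (moved j (control cf)) - 1)"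
proof (cases "halted M cf")
  case True
  then show ?thesis using assms
    by (simp add: step_def written_def moved_def halted_def wf_config_def scan_conv)
next
  case False
  let ?as = "snd (delta M (fst cf) (map scan (snd cf)))"
  have "snd (step M cf) ! j = act (?as ! j) (snd cf ! j)"
    using False assms delta_wf(2)[OF assms(1) False] by (simp add: step_def split_beta wf_config_def)
  also have "\<dots> = ((fst (snd cf ! j))(snd (snd cf ! j) := fst (?as ! j)), snd (snd cf ! j) + offset (snd (?as ! j)))"
    using act_conv[of "fst (?as ! j)" "snd (?as ! j)"] by simp
  finally show ?thesis
    using False offset_moved[of "snd (?as ! j)"] by (simp add: halted_def written_def moved_def)
qed

lemma written_in:
  assumes "wf_config cf" "j < tapes M"
  shows "written j (control cf) \<in> alphabet M"
proof (cases "halted M cf")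
  case True
  then show ?thesis using assms by (simp add: written_def halted_def wf_config_def scan_conv)
next
  case False
  then show ?thesis
    using assms delta_wf(2,3)[OF assms(1) False] by (auto simp: written_def halted_def)
qed

lemma wf_step:
  assumes "wf_config cf"
  shows "wf_config (step M cf)"
proof -
  have "fst (step M cf) \<in> states M"
    using delta_wf(1)[OF assms] assms by (cases "halted M cf") (auto simp: step_def wf_config_def split_beta)
  moreover have "length (snd (step M cf)) = tapes M"
    using delta_wf(2)[OF assms] assms by (cases "halted M cf") (auto simp: step_def wf_config_def split_beta)
  moreover have "fst (snd (step M cf) ! j) z \<in> alphabet M" if "j < tapes M" for j z
    using step_tape[OF assms that] written_in[OF assms that] assms that by (auto simp: wf_config_def)
  ultimately show ?thesis by (simp add: wf_config_def)
qed

lemma run_0: "run M ws 0 = initial M ws"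
  by (simp add: run_def)

lemma run_Suc: "run M ws (Suc t) = step M (run M ws t)"
  by (simp add: run_def)

lemma initial_tape:
  assumes "j < tapes M"
  shows "snd (initial M ws) ! j = (if j = 0 then (cell ws, 0) else (\<lambda>_. blank, 0))"
  using assms tapes_pos
  by (cases j) (auto simp: initial_def cell_def word_tape_def)

lemma wf_run:
  assumes "set ws \<subseteq> alphabet M"
  shows "wf_config (run M ws t)"
proof (induction t)
  case 0
  have "cell ws z \<in> alphabet M" for z
    using assms tm by (auto simp: cell_def word_tape_def turing_machine_def intro!: nth_mem subsetD[OF assms])
  then show ?case
    using tm initial_tape[of _ ws] tapes_pos
    by (auto simp: run_0 wf_config_def turing_machine_def initial_def)
next
  case (Suc t)
  then show ?case by (simp add: run_Suc wf_step)
qed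

lemma moved_le: "moved j a \<le> 2"
proof -
  have "offset m \<le> 1" for m by (cases m) auto
  then show ?thesis by (simp add: moved_def nat_le_iff)
qed

lemma head_bound:
  assumes "set ws \<subseteq> alphabet M" "j < tapes M"
  shows "\<bar>snd (snd (run M ws t) ! j)\<bar> \<le> int t"
proof (induction t)
  case 0
  then show ?case using initial_tape[OF assms(2), of ws] by (simp add: run_0)
next
  case (Suc t)
  then show ?case
    using step_tape[OF wf_run[OF assms(1)] assms(2), of t] moved_le[of j "control (run M ws t)"]
    by (simp add: run_Suc)
qed

lemma pair_word_in: "set (pair_word x u) \<subseteq> alphabet M"
proof -
  have "bit_sym b \<in> alphabet M" for b using tm by (cases b) (auto simp: turing_machine_def)
  moreover have "sep_sym \<in> alphabet M" using tm by (auto simp: turing_machine_def)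
  ultimately show ?thesis by (auto simp: pair_word_def)
qed

section \<open>Tableaux and accepting runs\<close>

text \<open>A tableau gives, for all times up to \<open>N\<close>, the controls \<open>A\<close>, the head positions \<open>H\<close>, and the tape contents \<open>S\<close>
  of an accepting run on \<open>x\<close> and some certificate of length at most \<open>l\<close>. Tape positions are shifted by \<open>Q\<close>.\<close>

definition init_ok :: "bool list \<Rightarrow> nat \<Rightarrow> nat \<Rightarrow> nat \<Rightarrow> nat \<Rightarrow> symbol \<Rightarrow> bool" where
  "init_ok x l Q j p v \<longleftrightarrow>
     (if j = 0 \<and> Q \<le> p then
        if p - Q < length x then v = bit_sym (x ! (p - Q))
        else if p - Q = length x then v = 3
        else if p - Q \<le> length x + l then v \<le> 2
        else v = 0
      else v = 0)"

text \<open>The scanned symbols recorded in \<open>A t\<close> are tied to the tapes through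
  \<open>S t j (H t j)\<close>. The condition that a blank is followed by a blank keeps the guessed
  certificate contiguous, since \<open>init_ok\<close> alone would allow gaps.\<close>

definition tableau ::
  "bool list \<Rightarrow> nat \<Rightarrow> nat \<Rightarrow> nat \<Rightarrow> (nat \<Rightarrow> nat) \<Rightarrow> (nat \<Rightarrow> nat \<Rightarrow> nat) \<Rightarrow> (nat \<Rightarrow> nat \<Rightarrow> nat \<Rightarrow> nat) \<Rightarrow> bool" where
  "tableau x l N Q A H S \<longleftrightarrow>
     (\<forall>t\<le>N. A t \<in> controls) \<and>
     (\<forall>t<N. state (A (Suc t)) = next_state (A t)) \<and>
     (\<forall>t<N. \<forall>j<tapes M. H (Suc t) j = H t j + moved j (A t) - 1) \<and>
     (\<forall>t\<le>N. \<forall>j<tapes M. S t j (H t j) = scanned (A t) ! j) \<and>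
     (\<forall>t<N. \<forall>j<tapes M. S (Suc t) j (H t j) = written j (A t)) \<and>
     (\<forall>t<N. \<forall>j<tapes M. \<forall>p<2 * Q. p \<noteq> H t j \<longrightarrow> S (Suc t) j p = S t j p) \<and>
     state (A 0) = start M \<and>
     (\<forall>j<tapes M. H 0 j = Q) \<and>
     (\<forall>j<tapes M. \<forall>p<2 * Q. init_ok x l Q j p (S 0 j p)) \<and>
     (\<forall>p. Q + length x < p \<and> Suc p < 2 * Q \<and> S 0 0 p = 0 \<longrightarrow> S 0 0 (Suc p) = 0) \<and>
     state (A N) = accept M"

lemma tableauD:
  assumes "tableau x l N Q A H S"
  shows "t \<le> N \<Longrightarrow> A t \<in> controls"
    and "t < N \<Longrightarrow> state (A (Suc t)) = next_state (A t)"
    and "t < N \<Longrightarrow> j < tapes M \<Longrightarrow> H (Suc t) j = H t j + moved j (A t) - 1"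
    and "t \<le> N \<Longrightarrow> j < tapes M \<Longrightarrow> S t j (H t j) = scanned (A t) ! j"
    and "t < N \<Longrightarrow> j < tapes M \<Longrightarrow> S (Suc t) j (H t j) = written j (A t)"
    and "t < N \<Longrightarrow> j < tapes M \<Longrightarrow> p < 2 * Q \<Longrightarrow> p \<noteq> H t j \<Longrightarrow> S (Suc t) j p = S t j p"
    and "state (A 0) = start M"
    and "j < tapes M \<Longrightarrow> H 0 j = Q"
    and "j < tapes M \<Longrightarrow> p < 2 * Q \<Longrightarrow> init_ok x l Q j p (S 0 j p)"
    and "Q + length x < p \<Longrightarrow> Suc p < 2 * Q \<Longrightarrow> S 0 0 p = 0 \<Longrightarrow> S 0 0 (Suc p) = 0"
    and "state (A N) = accept M"
  using assms unfolding tableau_def by (elim conjE; simp)+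

lemma cell_pair_word_int:
  "cell (pair_word x u) z =
     (if z < 0 then blank else if nat z < length x then bit_sym (x ! nat z) else if nat z = length x then sep_sym
      else if nat z < Suc (length x) + length u then bit_sym (u ! (nat z - Suc (length x))) else blank)"
  by (auto simp: cell_def word_tape_def pair_word_def nth_append nth_Cons' nat_less_iff)

lemma bit_sym_le: "bit_sym b \<le> 2" "bit_sym b \<noteq> 0"
  by (cases b; simp)+

text \<open>As \<open>Q\<close> exceeds \<open>N\<close>, shifted head positions stay strictly
  between 0 and \<open>2 * Q\<close>, so neither \<open>nat\<close> nor truncated subtraction loses
  information.\<close>

lemma tableau_of_run:
  assumes u: "length u \<le> l" and Q: "N + length x + l + 2 \<le> Q"
    and acc: "fst (run M (pair_word x u) N) = accept M"
  defines "cf \<equiv> run M (pair_word x u)"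
  shows "tableau x l N Q (\<lambda>t. control (cf t)) (\<lambda>t j. nat (snd (snd (cf t) ! j) + int Q))
    (\<lambda>t j p. fst (snd (cf t) ! j) (int p - int Q))"
proof -
  have wf: "wf_config (cf t)" for t unfolding cf_def by (rule wf_run[OF pair_word_in])
  have len: "length (snd (cf t)) = tapes M" for t using wf[of t] by (simp add: wf_config_def)
  have bound: "\<bar>snd (snd (cf t) ! j)\<bar> \<le> int t" if "j < tapes M" for t j
    unfolding cf_def by (rule head_bound[OF pair_word_in that])
  have head: "int (nat (snd (snd (cf t) ! j) + int Q)) = snd (snd (cf t) ! j) + int Q"
    if "j < tapes M" "t \<le> N" for t j using bound[OF that(1), of t] that(2) Q by simp
  have cf_Suc: "cf (Suc t) = step M (cf t)" for t by (simp add: cf_def run_Suc)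
  have tape_Suc: "snd (cf (Suc t)) ! j = ((fst (snd (cf t) ! j))(snd (snd (cf t) ! j) := written j (control (cf t))),
      snd (snd (cf t) ! j) + int (moved j (control (cf t))) - 1)" if "j < tapes M" for t j
    unfolding cf_Suc by (rule step_tape[OF wf that])
  have init: "snd (cf 0) ! j = (if j = 0 then (cell (pair_word x u), 0) else (\<lambda>_. blank, 0))"
    if "j < tapes M" for j unfolding cf_def run_0 by (rule initial_tape[OF that])
  show ?thesis
    unfolding tableau_def
  proof (intro conjI allI impI)
    show "control (cf t) \<in> controls" for t by (rule control_in[OF wf])
    show "state (control (cf (Suc t))) = next_state (control (cf t))" for t
      by (simp add: cf_Suc step_fst)
    show "nat (snd (snd (cf (Suc t)) ! j) + int Q) = nat (snd (snd (cf t) ! j) + int Q) + moved j (control (cf t)) - 1"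
      if "t < N" "j < tapes M" for t j
      using tape_Suc[OF that(2), of t] head[OF that(2), of t] that bound[OF that(2), of t] Q by simp
    show "fst (snd (cf t) ! j) (int (nat (snd (snd (cf t) ! j) + int Q)) - int Q) = scanned (control (cf t)) ! j"
      if "t \<le> N" "j < tapes M" for t j
      unfolding head[OF that(2,1)] using that len by (simp add: scan_conv)
    show "fst (snd (cf (Suc t)) ! j) (int (nat (snd (snd (cf t) ! j) + int Q)) - int Q) = written j (control (cf t))"
      if "t < N" "j < tapes M" for t j
      unfolding head[OF that(2) less_imp_le[OF that(1)]] using that by (simp add: tape_Suc)
    show "fst (snd (cf (Suc t)) ! j) (int p - int Q) = fst (snd (cf t) ! j) (int p - int Q)"
      if "t < N" "j < tapes M" "p \<noteq> nat (snd (snd (cf t) ! j) + int Q)" for t j p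
      using that by (auto simp: tape_Suc)
    show "state (control (cf 0)) = start M" by (simp add: cf_def run_0 initial_def)
    show "nat (snd (snd (cf 0) ! j) + int Q) = Q" if "j < tapes M" for j
      using init[OF that] by simp
    show "init_ok x l Q j p (fst (snd (cf 0) ! j) (int p - int Q))" if "j < tapes M" for j p
    proof (cases "j = 0 \<and> Q \<le> p")
      case True
      then have eq: "int p - int Q = int (p - Q)" by simp
      show ?thesis using init[OF that] True u unfolding eq
        by (auto simp: init_ok_def cell_pair_word_int sep_sym_def blank_def bit_sym_le simp del: of_nat_diff)
    next
      case False
      then show ?thesis using init[OF that]
        by (auto simp: init_ok_def cell_pair_word_int blank_def)
    qed
    show "fst (snd (cf 0) ! 0) (int (Suc p) - int Q) = 0"
      if "Q + length x < p \<and> Suc p < 2 * Q \<and> fst (snd (cf 0) ! 0) (int p - int Q) = 0" for p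
    proof -
      have eq: "int p - int Q = int (p - Q)" "int (Suc p) - int Q = int (Suc (p - Q))" using that by simp_all
      show ?thesis using that init[OF tapes_pos] unfolding eq
        by (auto simp: cell_pair_word_int blank_def bit_sym_le split: if_splits)
    qed
    show "state (control (cf N)) = accept M" using acc by (simp add: cf_def)
  qed
qed

lemma run_of_tableau:
  assumes tab: "tableau x l N Q A H S" and Q: "N + length x + l + 2 \<le> Q"
  shows "\<exists>u. length u \<le> l \<and> accepts M (pair_word x u)"
proof -
  note c0 = tableauD(1)[OF tab] and c1 = tableauD(2)[OF tab] and c2 = tableauD(3)[OF tab] and c3 = tableauD(4)[OF tab]
    and c4 = tableauD(5)[OF tab] and c5 = tableauD(6)[OF tab] and c6 = tableauD(7-9)[OF tab] and c7 = tableauD(10)[OF tab]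
    and c8 = tableauD(11)[OF tab]
  define o' where "o' = Q + length x + 1"
  \<comment> \<open>The cell just behind the certificate region must be blank, so a first blank
    exists and the guessed certificate has length at most \<open>l\<close>.\<close>
  have end0: "S 0 0 (o' + l) = 0"
    using c6(3)[OF tapes_pos, of "o' + l"] Q by (simp add: init_ok_def o'_def)
  define L where "L = (LEAST i. S 0 0 (o' + i) = 0)"
  have L: "S 0 0 (o' + L) = 0" "L \<le> l" "\<And>i. i < L \<Longrightarrow> S 0 0 (o' + i) \<noteq> 0"
    unfolding L_def using end0 by (auto intro: LeastI Least_le dest: not_less_Least)
  define u where "u = map (\<lambda>i. S 0 0 (o' + i) = 2) [0..<L]"
  have tail: "o' + L + i < 2 * Q \<Longrightarrow> S 0 0 (o' + L + i) = 0" for i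
  proof (induction i)
    case (Suc i)
    then show ?case using c7[of "o' + L + i"] by (simp add: o'_def)
  qed (use L in simp)
  have S0: "S 0 0 p = cell (pair_word x u) (int p - int Q)" if p: "p < 2 * Q" for p
  proof (cases "Q + length x < p")
    case True
    define i where "i = p - o'"
    have i: "p = o' + i" using True by (simp add: i_def o'_def)
    have z: "int p - int Q = int (Suc (length x) + i)" by (simp add: i o'_def)
    show ?thesis
    proof (cases "i < L")
      case True
      then have "S 0 0 p \<le> 2" "S 0 0 p \<noteq> 0"
        using c6(3)[OF tapes_pos p] L by (auto simp: init_ok_def i o'_def split: if_splits)
      then have "S 0 0 p = bit_sym (S 0 0 p = 2)" by (cases "S 0 0 p = 2") auto
      then show ?thesis using True unfolding z cell_pair_word(3) by (simp add: u_def i)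
    next
      case False
      then have "S 0 0 p = 0" using tail[of "i - L"] p by (simp add: i)
      then show ?thesis using False unfolding z cell_pair_word(3) by (simp add: u_def blank_def)
    qed
  next
    case False
    then show ?thesis using c6(3)[OF tapes_pos p]
      by (auto simp: init_ok_def cell_pair_word_int sep_sym_def blank_def nat_diff_distrib' split: if_splits)
  qed
  define cf where "cf = run M (pair_word x u)"
  have wf: "wf_config (cf t)" for t unfolding cf_def by (rule wf_run[OF pair_word_in])
  have len: "length (snd (cf t)) = tapes M" for t using wf[of t] by (simp add: wf_config_def)
  have bound: "\<bar>snd (snd (cf t) ! j)\<bar> \<le> int t" if "j < tapes M" for t j
    unfolding cf_def by (rule head_bound[OF pair_word_in that])
  have cf_Suc: "cf (Suc t) = step M (cf t)" for t by (simp add: cf_def run_Suc)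
  \<comment> \<open>Scanned symbols are not part of the invariant: they follow from head positions
    and tape contents, and together with the state they identify the control.\<close>
  have "t \<le> N \<Longrightarrow> state (A t) = fst (cf t) \<and> (\<forall>j<tapes M. int (H t j) = snd (snd (cf t) ! j) + int Q \<and>
      (\<forall>p<2 * Q. S t j p = fst (snd (cf t) ! j) (int p - int Q)))" for t
  proof (induction t)
    case 0
    have "int (H 0 j) = snd (snd (cf 0) ! j) + int Q \<and>
        (\<forall>p<2 * Q. S 0 j p = fst (snd (cf 0) ! j) (int p - int Q))" if j: "j < tapes M" for j
      using initial_tape[OF j, of "pair_word x u"] c6(2)[OF j] S0 c6(3)[OF j]
      by (auto simp: cf_def run_0 init_ok_def blank_def)
    then show ?case using c6(1) by (simp add: cf_def run_0 initial_def)
  next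
    case (Suc t)
    then have t: "t < N" "t \<le> N" by simp_all
    have IH: "state (A t) = fst (cf t)" "\<And>j. j < tapes M \<Longrightarrow> int (H t j) = snd (snd (cf t) ! j) + int Q"
      "\<And>j p. j < tapes M \<Longrightarrow> p < 2 * Q \<Longrightarrow> S t j p = fst (snd (cf t) ! j) (int p - int Q)"
      using Suc.IH t by auto
    \<comment> \<open>The upper bound keeps the scanned cell inside the tableau; the lower one makes
      the subtraction in the movement condition exact.\<close>
    have H: "H t j < 2 * Q" "0 < H t j" if "j < tapes M" for j
      using bound[OF that, of t] IH(2)[OF that] t Q by linarith+
    have "length (scanned (A t)) = tapes M"
      using c0[OF t(2)] by (auto simp: controls_def scanned_def)
    then have "scanned (A t) = map scan (snd (cf t))"
      using c3[OF t(2)] IH(2,3) H len by (intro nth_equalityI) (auto simp: scan_conv simp flip: c3[OF t(2)])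
    then have A: "A t = control (cf t)" using control_eqI[OF c0[OF t(2)] IH(1)] by simp
    have "int (H (Suc t) j) = snd (snd (cf (Suc t)) ! j) + int Q \<and>
        (\<forall>p<2 * Q. S (Suc t) j p = fst (snd (cf (Suc t)) ! j) (int p - int Q))" if j: "j < tapes M" for j
    proof -
      note tape = step_tape[OF wf[of t] j, folded cf_Suc A]
      have "int (H (Suc t) j) = int (H t j) + int (moved j (A t)) - 1"
        using c2[OF t(1) j] H[OF j] by simp
      moreover have "S (Suc t) j p = fst (snd (cf (Suc t)) ! j) (int p - int Q)" if p: "p < 2 * Q" for p
      proof (cases "p = H t j")
        case True
        then show ?thesis using c4[OF t(1) j] IH(2)[OF j] by (simp add: tape)
      next
        case False
        then have "int p - int Q \<noteq> snd (snd (cf t) ! j)" using IH(2)[OF j] by linarith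
        then show ?thesis using c5[OF t(1) j p False] IH(3)[OF j p] by (simp add: tape)
      qed
      ultimately show ?thesis using IH(2)[OF j] by (simp add: tape)
    qed
    then show ?case using c1[OF t(1)] by (simp add: cf_Suc step_fst A)
  qed
  from this[of N] c8 have "fst (cf N) = accept M" by simp
  then have "accepts M (pair_word x u)" unfolding accepts_def cf_def by blast
  moreover have "length u \<le> l" using L(2) by (simp add: u_def)
  ultimately show ?thesis by blast
qed

end

section \<open>The reduction\<close>

lemma tc_finite2:
  assumes "tc I" "tc A"
  shows "tc (\<lambda>w e. if I w e < n then if A w e < n' then f (I w e) (A w e) else 0 else 0)"
  using assms by (intro tc_table[where F = "\<lambda>i w e. if A w e < n' then f i (A w e) else 0"]
      tc_table[where F = "\<lambda>a w e. f i a" for i] tc_const)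

lemma tcb_finite2:
  assumes "tc I" "tc A"
  shows "tcb (\<lambda>w e. I w e < n \<and> A w e < n' \<and> P (I w e) (A w e))"
  using assms by (intro tcb_table[where F = "\<lambda>i w e. A w e < n' \<and> P i (A w e)"]
      tcb_table[where F = "\<lambda>a w e. P i a" for i] tc_const)

lemma tcb_finite:
  assumes "tc A"
  shows "tcb (\<lambda>w e. A w e < n \<and> P (A w e))"
  using assms by (intro tcb_table[where F = "\<lambda>a w e. P a"] tc_const)

text \<open>Kind, time, tape and position are digits in base \<open>B\<close>; coordinates without
  meaning for a kind are set to 0.\<close>

definition grp :: "nat \<Rightarrow> nat \<Rightarrow> nat \<Rightarrow> nat \<Rightarrow> nat \<Rightarrow> nat" where
  "grp B k t j p = ((k * B + t) * B + j) * B + p"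

lemma grp_less: "k < n \<Longrightarrow> t < B \<Longrightarrow> j < B \<Longrightarrow> p < B \<Longrightarrow> grp B k t j p < n * B * B * B"
  unfolding grp_def by (intro digits_less)

lemma grp_digits:
  assumes "t < B" "j < B" "p < B"
  shows "grp B k t j p mod B = p" "grp B k t j p div B mod B = j"
    "grp B k t j p div B div B mod B = t" "grp B k t j p div B div B div B = k"
  unfolding grp_def using assms by (simp_all only: div_mod_digit)

text \<open>The leading digit, the kind of clause, is not reduced modulo \<open>B\<close>, so with
  five digits below it \<open>n\<close> kinds fill an initial segment of the clause numbers.\<close>

definition on_digits :: "nat \<Rightarrow> (nat \<Rightarrow> nat \<Rightarrow> nat \<Rightarrow> nat \<Rightarrow> nat \<Rightarrow> nat \<Rightarrow> 'a) \<Rightarrow> nat \<Rightarrow> 'a" where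
  "on_digits B P c = P (c div B div B div B div B div B) (c div B div B div B div B mod B)
     (c div B div B div B mod B) (c div B div B mod B) (c div B mod B) (c mod B)"

lemma all_digits:
  fixes B :: nat
  assumes "0 < B"
  shows "(\<forall>c<n * B * B * B * B * B. on_digits B P c) \<longleftrightarrow>
    (\<forall>k<n. \<forall>t<B. \<forall>j<B. \<forall>x<B. \<forall>y<B. \<forall>z<B. P k t j x y z)"
proof (intro iffI allI impI)
  fix k t j x y z
  assume all: "\<forall>c<n * B * B * B * B * B. on_digits B P c"
    and less: "k < n" "t < B" "j < B" "x < B" "y < B" "z < B"
  let ?c = "((((k * B + t) * B + j) * B + x) * B + y) * B + z"
  have "?c < n * B * B * B * B * B" using less by (intro digits_less)
  with all have "on_digits B P ?c" by blast
  then show "P k t j x y z" using less by (simp only: on_digits_def div_mod_digit)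
next
  fix c
  assume all: "\<forall>k<n. \<forall>t<B. \<forall>j<B. \<forall>x<B. \<forall>y<B. \<forall>z<B. P k t j x y z"
    and "c < n * B * B * B * B * B"
  then have "c div B div B div B div B div B < n" by (intro less_mult_imp_div_less)
  then show "on_digits B P c"
    using all assms by (simp add: on_digits_def)
qed

section \<open>Tableau conditions as clauses\<close>

context machine_tableau
begin

text \<open>A constant of the machine, independent of the input, below which lie all controls,
  symbols and tape numbers; functions of these are finite tables.\<close>

definition bnd :: nat where
  "bnd = Suc (Max (insert (tapes M) (controls \<union> alphabet M)))"

lemma less_bnd: "a \<in> controls \<Longrightarrow> a < bnd" "a \<in> alphabet M \<Longrightarrow> a < bnd" "tapes M < bnd"
proof -
  have fin: "finite (insert (tapes M) (controls \<union> alphabet M))"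
    using tm finite_controls by (simp add: turing_machine_def)
  show "a \<in> controls \<Longrightarrow> a < bnd" "a \<in> alphabet M \<Longrightarrow> a < bnd" "tapes M < bnd"
    unfolding bnd_def using Max_ge[OF fin] by (auto simp: less_Suc_eq_le)
qed

text \<open>The restriction to constantly many arguments is what makes an arbitrary \<open>f\<close>
  tame.\<close>

definition lookup :: "(nat \<Rightarrow> nat \<Rightarrow> nat) \<Rightarrow> nat \<Rightarrow> nat \<Rightarrow> nat" where
  "lookup f j a = (if j < tapes M then if a < bnd then f j a else 0 else 0)"

text \<open>Groups of kind 0, 1, 2 hold the controls, the head positions and the tape contents.
  The value \<open>v\<close> of group \<open>g\<close> satisfies the clause. Digits \<open>t, j, x, y, z\<close> of the clause stand for a time, a tape
  and values or positions; a clause of which they are no instance is omitted by making it true.\<close>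

definition clause ::
  "symbol list \<Rightarrow> nat \<Rightarrow> nat \<Rightarrow> nat \<Rightarrow> nat \<Rightarrow> nat \<Rightarrow> nat \<Rightarrow> nat \<Rightarrow> nat \<Rightarrow> nat \<Rightarrow> nat \<Rightarrow> nat \<Rightarrow> nat \<Rightarrow> bool" where
  "clause w l N Q B k t j x y z g v \<longleftrightarrow>
     (k = 0 \<longrightarrow> t \<le> N \<longrightarrow> g = grp B 0 t 0 0 \<and> v < bnd \<and> v \<in> controls) \<and>
     (k = 1 \<longrightarrow> t < N \<and> x < bnd \<longrightarrow> g = grp B 0 t 0 0 \<and> v \<noteq> x \<or>
        g = grp B 0 (Suc t) 0 0 \<and> v < bnd \<and> x < bnd \<and> state v = next_state x) \<and>
     (k = 2 \<longrightarrow> t < N \<and> j < tapes M \<and> x < bnd \<longrightarrow> g = grp B 0 t 0 0 \<and> v \<noteq> x \<or> g = grp B 1 t j 0 \<and> v \<noteq> y \<or>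
        g = grp B 1 (Suc t) j 0 \<and> v = y + lookup moved j x - 1) \<and>
     (k = 3 \<longrightarrow> t \<le> N \<and> j < tapes M \<and> x < bnd \<longrightarrow> g = grp B 0 t 0 0 \<and> v \<noteq> x \<or> g = grp B 1 t j 0 \<and> v \<noteq> y \<or>
        g = grp B 2 t j y \<and> v = lookup (\<lambda>j a. scanned a ! j) j x) \<and>
     (k = 4 \<longrightarrow> t < N \<and> j < tapes M \<and> x < bnd \<longrightarrow> g = grp B 0 t 0 0 \<and> v \<noteq> x \<or> g = grp B 1 t j 0 \<and> v \<noteq> y \<or>
        g = grp B 2 (Suc t) j y \<and> v = lookup written j x) \<and>
     (k = 5 \<longrightarrow> t < N \<and> j < tapes M \<and> y < 2 * Q \<and> y \<noteq> x \<longrightarrow> g = grp B 1 t j 0 \<and> v \<noteq> x \<or>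
        g = grp B 2 t j y \<and> v \<noteq> z \<or> g = grp B 2 (Suc t) j y \<and> v = z) \<and>
     (k = 6 \<longrightarrow> g = grp B 0 0 0 0 \<and> v < bnd \<and> state v = start M) \<and>
     (k = 7 \<longrightarrow> j < tapes M \<longrightarrow> g = grp B 1 0 j 0 \<and> v = Q) \<and>
     (k = 8 \<longrightarrow> j < tapes M \<and> y < 2 * Q \<longrightarrow> g = grp B 2 0 j y \<and>
        (if j = 0 \<and> Q \<le> y then
           if y - Q < length w then v = 1 \<and> cell w (int (y - Q)) = 1 \<or> v = 2 \<and> cell w (int (y - Q)) = 2
           else if y - Q = length w then v = 3
           else if y - Q \<le> length w + l then v \<le> 2
           else v = 0
         else v = 0)) \<and>
     (k = 9 \<longrightarrow> Q + length w < y \<and> Suc y < 2 * Q \<longrightarrow>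
        g = grp B 2 0 0 y \<and> v \<noteq> 0 \<or> g = grp B 2 0 0 (Suc y) \<and> v = 0) \<and>
     (k = 10 \<longrightarrow> g = grp B 0 N 0 0 \<and> v < bnd \<and> state v = accept M)"

lemma tcb_clause:
  assumes "tc (\<lambda>w e. l w)" "tc (\<lambda>w e. N w)" "tc (\<lambda>w e. Q w)" "tc (\<lambda>w e. B w)"
    and "tc k" "tc t" "tc j" "tc x" "tc y" "tc z" "tc g" "tc v"
  shows "tcb (\<lambda>w e. clause w (l w) (N w) (Q w) (B w) (k w e) (t w e) (j w e) (x w e) (y w e) (z w e) (g w e) (v w e))"
proof -
  have look: "tc (\<lambda>w e. lookup f (j w e) (x w e))" for f
    unfolding lookup_def using assms by (intro tc_finite2)
  have grp: "tc (\<lambda>w e. grp (B w) (K w e) (T w e) (J w e) (P w e))" if "tc K" "tc T" "tc J" "tc P" for K T J P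
    unfolding grp_def by (intro tc_intros that assms)
  show ?thesis
    unfolding clause_def
    by (intro tcb_finite tcb_finite2 tc_intros assms grp look)
qed

lemma cell_map_bit_sym: "i < length x \<Longrightarrow> cell (map bit_sym x) (int i) = bit_sym (x ! i)"
  by (simp add: cell_def word_tape_def)

lemma init_ok_iff:
  "(if j = 0 \<and> Q \<le> y then
      if y - Q < length (map bit_sym x) then v = 1 \<and> cell (map bit_sym x) (int (y - Q)) = 1 \<or>
        v = 2 \<and> cell (map bit_sym x) (int (y - Q)) = 2
      else if y - Q = length (map bit_sym x) then v = 3
      else if y - Q \<le> length (map bit_sym x) + l then v \<le> 2
      else v = 0
    else v = 0) \<longleftrightarrow> init_ok x l Q j y v"
proof -
  have "(v = 1 \<and> bit_sym b = 1 \<or> v = 2 \<and> bit_sym b = 2) = (v = bit_sym b)" for b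
    by (cases b) auto
  then show ?thesis unfolding init_ok_def by (simp add: cell_map_bit_sym del: of_nat_diff)
qed

text \<open>Each clause is instantiated with the values actually chosen. Its negative literals such
  as \<open>v \<noteq> x\<close> then fail, and the remaining literal is the wanted
  condition.\<close>

lemma tableau_of_choice:
  assumes \<alpha>: "\<And>g. g < 3 * B * B * B \<Longrightarrow> \<alpha> g < B"
    and cl: "\<And>k t j x' y z. k < 11 \<Longrightarrow> t < B \<Longrightarrow> j < B \<Longrightarrow> x' < B \<Longrightarrow> y < B \<Longrightarrow> z < B \<Longrightarrow>
      \<exists>g<3 * B * B * B. clause (map bit_sym x) l N Q B k t j x' y z g (\<alpha> g)"
    and B: "2 * Q + bnd \<le> B" "N < Q"
  shows "tableau x l N Q (\<lambda>t. \<alpha> (grp B 0 t 0 0)) (\<lambda>t j. \<alpha> (grp B 1 t j 0)) (\<lambda>t j p. \<alpha> (grp B 2 t j p))"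
proof -
  have B0: "0 < B" "tapes M < B" using B less_bnd(3) by simp_all
  have val: "\<alpha> (grp B k t j p) < B" if "k < 3" "t < B" "j < B" "p < B" for k t j p
    by (rule \<alpha>) (rule grp_less[OF that])
  note clD = cl[unfolded clause_def]
  have c0: "\<alpha> (grp B 0 t 0 0) \<in> controls" if "t \<le> N" for t
    using clD[of 0 t 0 0 0 0] that B B0 by auto
  have c0': "\<alpha> (grp B 0 t 0 0) < bnd" if "t \<le> N" for t using less_bnd(1)[OF c0[OF that]] .
  have H: "\<alpha> (grp B 1 t j 0) < B" if "t \<le> N" "j < tapes M" for t j
    using that B B0 by (intro val) auto
  show ?thesis
    unfolding tableau_def
  proof (intro conjI allI impI)
    show "\<alpha> (grp B 0 t 0 0) \<in> controls" if "t \<le> N" for t using c0[OF that] .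
    show "state (\<alpha> (grp B 0 (Suc t) 0 0)) = next_state (\<alpha> (grp B 0 t 0 0))" if "t < N" for t
      using clD[of 1 t 0 "\<alpha> (grp B 0 t 0 0)" 0 0] that B B0 c0'[of t] by auto
    show "\<alpha> (grp B 1 (Suc t) j 0) = \<alpha> (grp B 1 t j 0) + moved j (\<alpha> (grp B 0 t 0 0)) - 1"
      if "t < N" "j < tapes M" for t j
      using clD[of 2 t j "\<alpha> (grp B 0 t 0 0)" "\<alpha> (grp B 1 t j 0)" 0] that B B0 c0'[of t] H[of t j]
      by (auto simp: lookup_def)
    show "\<alpha> (grp B 2 t j (\<alpha> (grp B 1 t j 0))) = scanned (\<alpha> (grp B 0 t 0 0)) ! j"
      if "t \<le> N" "j < tapes M" for t j
      using clD[of 3 t j "\<alpha> (grp B 0 t 0 0)" "\<alpha> (grp B 1 t j 0)" 0] that B B0 c0'[of t] H[of t j]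
      by (auto simp: lookup_def)
    show "\<alpha> (grp B 2 (Suc t) j (\<alpha> (grp B 1 t j 0))) = written j (\<alpha> (grp B 0 t 0 0))"
      if "t < N" "j < tapes M" for t j
      using clD[of 4 t j "\<alpha> (grp B 0 t 0 0)" "\<alpha> (grp B 1 t j 0)" 0] that B B0 c0'[of t] H[of t j]
      by (auto simp: lookup_def)
    show "\<alpha> (grp B 2 (Suc t) j p) = \<alpha> (grp B 2 t j p)"
      if "t < N" "j < tapes M" "p < 2 * Q" "p \<noteq> \<alpha> (grp B 1 t j 0)" for t j p
      using clD[of 5 t j "\<alpha> (grp B 1 t j 0)" p "\<alpha> (grp B 2 t j p)"] that B B0 H[of t j] val[of 2 t j p]
      by auto
    show "state (\<alpha> (grp B 0 0 0 0)) = start M" using clD[of 6 0 0 0 0 0] B0 by auto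
    show "\<alpha> (grp B 1 0 j 0) = Q" if "j < tapes M" for j
      using clD[of 7 0 j 0 0 0] B0 that by auto
    show "init_ok x l Q j p (\<alpha> (grp B 2 0 j p))" if "j < tapes M" "p < 2 * Q" for j p
      unfolding init_ok_iff[symmetric] using clD[of 8 0 j 0 p 0] B B0 that by auto
    show "\<alpha> (grp B 2 0 0 (Suc p)) = 0"
      if "Q + length x < p \<and> Suc p < 2 * Q \<and> \<alpha> (grp B 2 0 0 p) = 0" for p
      using clD[of 9 0 0 0 p 0] B B0 that by auto
    show "state (\<alpha> (grp B 0 N 0 0)) = accept M" using clD[of 10 0 0 0 0 0] B0 by auto
  qed
qed

text \<open>In a violated clause the failing negative literals force the digits \<open>x'\<close>,
  \<open>y\<close>, \<open>z\<close> to be the actual tableau entries, and then the tableau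
  condition makes the positive literal true.\<close>

lemma choice_of_tableau:
  assumes tab: "tableau x l N Q A H S"
    and H: "\<And>t j. t \<le> N \<Longrightarrow> j < tapes M \<Longrightarrow> H t j < 2 * Q"
    and S: "\<And>t j p. t \<le> N \<Longrightarrow> j < tapes M \<Longrightarrow> p < 2 * Q \<Longrightarrow> S t j p < B"
    and B: "2 * Q + bnd \<le> B" "N < Q"
  shows "\<exists>\<alpha>. (\<forall>g. \<alpha> g < B) \<and> (\<forall>k<11. \<forall>t<B. \<forall>j<B. \<forall>x'<B. \<forall>y<B. \<forall>z<B.
    \<exists>g<3 * B * B * B. clause (map bit_sym x) l N Q B k t j x' y z g (\<alpha> g))"
proof -
  have B0: "0 < B" "tapes M < B" "N < B" using B less_bnd(3) by simp_all
  note c0 = tableauD(1)[OF tab] and c1 = tableauD(2)[OF tab] and c2 = tableauD(3)[OF tab] and c3 = tableauD(4)[OF tab]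
    and c4 = tableauD(5)[OF tab] and c5 = tableauD(6)[OF tab] and c6 = tableauD(7-9)[OF tab] and c7 = tableauD(10)[OF tab]
    and c8 = tableauD(11)[OF tab]
  \<comment> \<open>Groups outside the tableau receive the legal default value 0.\<close>
  define \<alpha> where "\<alpha> g = (let k = g div B div B div B; t = g div B div B mod B; j = g div B mod B; p = g mod B in
    if k = 0 \<and> t \<le> N then A t else if k = 1 \<and> t \<le> N \<and> j < tapes M then H t j
    else if k = 2 \<and> t \<le> N \<and> j < tapes M \<and> p < 2 * Q then S t j p else 0)" for g
  have A_less: "A t < bnd" if "t \<le> N" for t by (rule less_bnd(1)[OF c0[OF that]])
  have "\<alpha> g < B" for g
    using A_less[of "g div B div B mod B"] H[of "g div B div B mod B" "g div B mod B"]
      S[of "g div B div B mod B" "g div B mod B" "g mod B"] B B0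
    by (auto simp: \<alpha>_def Let_def)
  moreover have \<alpha>A: "\<alpha> (grp B 0 t 0 0) = A t" if "t \<le> N" for t
    using that B0 by (simp add: \<alpha>_def grp_digits)
  have \<alpha>H: "\<alpha> (grp B (Suc 0) t j 0) = H t j" if "t \<le> N" "j < tapes M" for t j
    using that B0 by (simp add: \<alpha>_def grp_digits)
  have \<alpha>S: "\<alpha> (grp B 2 t j p) = S t j p" if "t \<le> N" "j < tapes M" "p < 2 * Q" for t j p
    using that B0 B by (simp add: \<alpha>_def grp_digits)
  have "\<exists>g<3 * B * B * B. clause (map bit_sym x) l N Q B k t j x' y z g (\<alpha> g)"
    if less: "k < 11" "t < B" "j < B" "x' < B" "y < B" "z < B" for k t j x' y z
  proof (rule ccontr)
    let ?w = "map bit_sym x"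
    assume "\<not> ?thesis"
    then have no: "\<not> clause ?w l N Q B k t j x' y z (grp B i t' j' p') (\<alpha> (grp B i t' j' p'))"
      if "i < 3" "t' < B" "j' < B" "p' < B" for i t' j' p' using grp_less[OF that] by blast
    have noA: "\<not> clause ?w l N Q B k t j x' y z (grp B 0 t' 0 0) (A t')" if "t' \<le> N" for t'
      using no[of 0 t' 0 0] that B0 by (simp add: \<alpha>A)
    have noH: "\<not> clause ?w l N Q B k t j x' y z (grp B 1 t' j' 0) (H t' j')" if "t' \<le> N" "j' < tapes M" for t' j'
      using no[of 1 t' j' 0] that B0 by (simp add: \<alpha>H)
    have noS: "\<not> clause ?w l N Q B k t j x' y z (grp B 2 t' j' p') (S t' j' p')"
      if "t' \<le> N" "j' < tapes M" "p' < 2 * Q" for t' j' p'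
      using no[of 2 t' j' p'] that B0 B by (simp add: \<alpha>S)
    consider "k = 0" | "k = 1" | "k = 2" | "k = 3" | "k = 4" | "k = 5" | "k = 6" | "k = 7" | "k = 8" | "k = 9" | "k = 10"
      using less(1) by (fastforce simp: eval_nat_numeral less_Suc_eq)
    then show False
    proof cases
      case 1
      \<comment> \<open>A violated clause must be properly instantiated, as otherwise every group
        satisfies it. Probing the group \<open>grp B 0 0 0 0\<close> reveals this, here and in later
        cases.\<close>
      then show False using no[of 0 0 0 0] noA[of t] B0 c0[of t] A_less[of t] by (auto simp: clause_def)
    next
      case 2
      then have "t < N" "A t = x'" using no[of 0 0 0 0] noA[of t] B0 by (auto simp: clause_def)
      then show False using 2 noA[of "Suc t"] c1[of t] A_less[of t] A_less[of "Suc t"] by (auto simp: clause_def)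
    next
      case 3
      then have "t < N" "j < tapes M" using no[of 0 0 0 0] B0 by (auto simp: clause_def)
      moreover from this have "A t = x'" "H t j = y" using 3 noA[of t] noH[of t j] by (auto simp: clause_def)
      ultimately show False using 3 noH[of "Suc t" j] c2[of t j] A_less[of t] by (auto simp: clause_def lookup_def)
    next
      case 4
      then have "t \<le> N" "j < tapes M" using no[of 0 0 0 0] B0 by (auto simp: clause_def)
      moreover from this have "A t = x'" "H t j = y" using 4 noA[of t] noH[of t j] by (auto simp: clause_def)
      ultimately show False using 4 noS[of t j y] c3[of t j] H[of t j] A_less[of t] by (auto simp: clause_def lookup_def)
    next
      case 5
      then have "t < N" "j < tapes M" using no[of 0 0 0 0] B0 by (auto simp: clause_def)
      moreover from this have "A t = x'" "H t j = y" using 5 noA[of t] noH[of t j] by (auto simp: clause_def)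
      ultimately show False using 5 noS[of "Suc t" j y] c4[of t j] H[of t j] A_less[of t]
        by (auto simp: clause_def lookup_def)
    next
      case 6
      then have *: "t < N" "j < tapes M" "y < 2 * Q" "y \<noteq> x'" using no[of 0 0 0 0] B0 by (auto simp: clause_def)
      then have "H t j = x'" "S t j y = z" using 6 noH[of t j] noS[of t j y] by (auto simp: clause_def)
      then show False using * 6 noS[of "Suc t" j y] c5[of t j y] by (auto simp: clause_def)
    next
      case 7
      then show False using noA[of 0] c6(1) A_less[of 0] by (auto simp: clause_def)
    next
      case 8
      then show False using no[of 0 0 0 0] noH[of 0 j] B0 c6(2)[of j] by (auto simp: clause_def)
    next
      case 9
      then have "j < tapes M" "y < 2 * Q" using no[of 0 0 0 0] B0 by (auto simp: clause_def)
      then show False using noS[of 0 j y] 9 c6(3)[of j y] unfolding clause_def init_ok_iff by simp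
    next
      case 10
      then have *: "Q + length x < y" "Suc y < 2 * Q" using no[of 0 0 0 0] B0 by (auto simp: clause_def)
      then have "S 0 0 y = 0" using 10 noS[of 0 0 y] tapes_pos by (auto simp: clause_def)
      then show False using * 10 noS[of 0 0 "Suc y"] c7[of y] tapes_pos by (auto simp: clause_def)
    next
      case 11
      then show False using noA[of N] c8 A_less[of N] by (auto simp: clause_def)
    qed
  qed
  ultimately show ?thesis by (intro exI[of _ \<alpha>]) simp
qed

lemma language_reducible:
  fixes T p :: "nat poly"
  assumes halt: "\<And>x u. halted M (run M (pair_word x u) (poly T (length x + length u)))"
    and L: "\<And>x. x \<in> L \<longleftrightarrow> (\<exists>u. length u \<le> poly p (length x) \<and> accepts M (pair_word x u))"
  shows "L \<le>\<^sub>p DiNDP"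
proof -
  define l where "l w = poly p (length w)" for w :: "symbol list"
  define N where "N w = poly T (length w + l w)" for w
  define Q where "Q w = N w + length w + l w + 2" for w
  \<comment> \<open>\<open>B\<close> is both the number of values per group and the base of all
    indices: it exceeds every time and tape position and, through \<open>bnd\<close>, every control,
    symbol and tape number.\<close>
  define B where "B w = 2 * Q w + bnd" for w
  define cl where "cl w c g v = on_digits (B w) (\<lambda>k t j x y z. clause w (l w) (N w) (Q w) (B w) k t j x y z g v) c"
    for w c g v
  have l: "tc (\<lambda>w e. l w)" unfolding l_def by (intro tc_intros)
  have N: "tc (\<lambda>w e. N w)" unfolding N_def by (intro tc_intros l)
  have Q: "tc (\<lambda>w e. Q w)" unfolding Q_def by (intro tc_intros l N)
  have B: "tc (\<lambda>w e. B w)" unfolding B_def by (intro tc_intros Q)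
  have B_pos: "0 < B w" for w by (simp add: B_def Q_def)
  \<comment> \<open>Groups consist of one of 3 kinds and three digits, clauses of one of 11 kinds
    and five digits.\<close>
  have "x \<in> L \<longleftrightarrow> choosable (3 * B w * B w * B w) (B w) (11 * B w * B w * B w * B w * B w) (cl w)"
    if w: "w = map bit_sym x" for x w
  proof -
    have len: "l w = poly p (length x)" "length w = length x" by (simp_all add: w l_def)
    have Q_ge: "N w + length x + l w + 2 \<le> Q w" by (simp add: Q_def len)
    have B_ge: "2 * Q w + bnd \<le> B w" "N w < Q w" by (simp_all add: B_def Q_def)
    have choose: "choosable (3 * B w * B w * B w) (B w) (11 * B w * B w * B w * B w * B w) (cl w) \<longleftrightarrow>
      (\<exists>\<alpha>. (\<forall>g<3 * B w * B w * B w. \<alpha> g < B w) \<and>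
        (\<forall>k<11. \<forall>t<B w. \<forall>j<B w. \<forall>x'<B w. \<forall>y<B w. \<forall>z<B w. \<exists>g<3 * B w * B w * B w.
          clause (map bit_sym x) (l w) (N w) (Q w) (B w) k t j x' y z g (\<alpha> g)))"
      unfolding choosable_def cl_def w[symmetric]
      using all_digits[OF B_pos, where n = 11 and P = "\<lambda>k t j x y z. \<exists>g<3 * B w * B w * B w.
        clause w (l w) (N w) (Q w) (B w) k t j x y z g (\<alpha> g)" for \<alpha>]
      by (simp only: on_digits_def)
    show ?thesis
    proof
      assume "x \<in> L"
      then obtain u where u: "length u \<le> l w" and acc: "accepts M (pair_word x u)" using L len by auto
      \<comment> \<open>The certificate may be shorter than allowed, but the time bound is monotone
        in its length and halting configurations persist, so \<open>N w\<close> serves all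
        certificates.\<close>
      have "poly T (length x + length u) \<le> N w"
        unfolding N_def len(2) using u by (intro poly_nat_mono) simp
      from run_halted[OF halt this] have "fst (run M (pair_word x u) (N w)) = accept M"
        using acc accepts_iff_halted[OF halt] by simp
      note tab = tableau_of_run[OF u Q_ge this]
      have "\<exists>\<alpha>. (\<forall>g. \<alpha> g < B w) \<and> (\<forall>k<11. \<forall>t<B w. \<forall>j<B w. \<forall>x'<B w. \<forall>y<B w. \<forall>z<B w.
        \<exists>g<3 * B w * B w * B w. clause (map bit_sym x) (l w) (N w) (Q w) (B w) k t j x' y z g (\<alpha> g))"
      proof (rule choice_of_tableau[OF tab _ _ B_ge])
        show "nat (snd (snd (run M (pair_word x u) t) ! j) + int (Q w)) < 2 * Q w"
          if "t \<le> N w" "j < tapes M" for t j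
          using head_bound[OF pair_word_in that(2), of x u t] that B_ge by linarith
        show "fst (snd (run M (pair_word x u) t) ! j) (int q - int (Q w)) < B w"
          if "t \<le> N w" "j < tapes M" for t j q
        proof -
          have "fst (snd (run M (pair_word x u) t) ! j) (int q - int (Q w)) \<in> alphabet M"
            using wf_run[OF pair_word_in, of x u t] that by (simp add: wf_config_def)
          then show ?thesis using less_bnd(2) B_ge by (meson le_add2 le_trans order_less_le_trans)
        qed
      qed
      then show "choosable (3 * B w * B w * B w) (B w) (11 * B w * B w * B w * B w * B w) (cl w)"
        unfolding choose by blast
    next
      assume "choosable (3 * B w * B w * B w) (B w) (11 * B w * B w * B w * B w * B w) (cl w)"
      then obtain \<alpha> where "\<forall>g<3 * B w * B w * B w. \<alpha> g < B w"
        and "\<forall>k<11. \<forall>t<B w. \<forall>j<B w. \<forall>x'<B w. \<forall>y<B w. \<forall>z<B w. \<exists>g<3 * B w * B w * B w.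
          clause (map bit_sym x) (l w) (N w) (Q w) (B w) k t j x' y z g (\<alpha> g)"
        unfolding choose by (elim exE conjE) (rule that)
      from run_of_tableau[OF tableau_of_choice[OF this[rule_format] B_ge] Q_ge]
      show "x \<in> L" unfolding L len(1) by blast
    qed
  qed
  moreover have "tc (\<lambda>w e. 3 * B w * B w * B w)" "tc (\<lambda>w e. 11 * B w * B w * B w * B w * B w)"
    by (intro tc_intros B)+
  moreover have "tcb (\<lambda>w e. cl w (e 0) (e 1) (e 2))"
    unfolding cl_def on_digits_def by (intro tcb_clause tc_intros l N Q B)
  ultimately show ?thesis using B B_pos by (intro choosable_reduction) auto
qed

end

theorem lemmaA1: "NP_complete DiNDP"
  unfolding NP_complete_def NP_hard_def
proof (intro conjI ballI)
  show "DiNDP \<in> NP" by (rule DiNDP_in_NP)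
  fix L assume "L \<in> NP"
  then obtain M and T p :: "nat poly" where "turing_machine M"
    and "\<And>x u. halted M (run M (pair_word x u) (poly T (length x + length u)))"
    and "\<And>x. x \<in> L \<longleftrightarrow> (\<exists>u. length u \<le> poly p (length x) \<and> accepts M (pair_word x u))"
    unfolding NP_def by blast
  then show "L \<le>\<^sub>p DiNDP" by (intro machine_tableau.language_reducible machine_tableau.intro)
qed

end
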